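(* Let $\hbar\in\mathbb{R}_{>0}\setminus\mathbb{Q}$, let $\Gamma^{(0)}$ be a $\mathcal{D}$-seed of rank $n$ with exchange matrix $\varepsilon^{(0)}$, and let $i,j\in\{1,\dots,n\}$ be distinct with $\varepsilon^{(0)}_{ij}=0=\varepsilon^{(0)}_{ji}$. Put $\Gamma^{(1)}=\mu_i(\Gamma^{(0)})$, $\Gamma^{(2)}=\mu_j(\Gamma^{(1)})$, $\Gamma^{(3)}=\mu_j(\Gamma^{(0)})$, so that $\Gamma^{(2)}=\mu_i(\Gamma^{(3)})$. Let $c_{A_1\times A_1}\in\mathrm{U}(1)\subset\mathbb{C}^\times$ be the constant such that $$\mathbf{K}^\hbar_{\Gamma^{(0)}\stackrel{i}{\to}\Gamma^{(1)}}\,\mathbf{K}^\hbar_{\Gamma^{(1)}\stackrel{j}{\to}\Gamma^{(2)}}=c_{A_1\times A_1}\cdot\mathbf{K}^\hbar_{\Gamma^{(0)}\stackrel{j}{\to}\Gamma^{(3)}}\,\mathbf{K}^\hbar_{\Gamma^{(3)}\stackrel{i}{\to}\Gamma^{(2)}}$$ (such a constant exists by a theorem of Fock and Goncharov). Then $c_{A_1\times A_1}=1$.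
   Context: **Seeds and mutations.** Fix $n\ge1$; $[a]_+=\max(a,0)$. A $\mathcal{D}$-seed $\Gamma$ has an exchange matrix $\varepsilon=(\varepsilon_{ij})\in\mathbb{Z}^{n\times n}$ and a skew-symmetrizer $d=(d_1,\dots,d_n)$ of positive integers such that $\varepsilon_{ij}d_j^{-1}=-\varepsilon_{ji}d_i^{-1}$ for all $i,j$. (It also carries $2n$ formal cluster variables $B_i,X_i$, which play no role in the operators below; all operators depend only on $(\varepsilon,d)$.) The mutated seed $\Gamma'=\mu_k(\Gamma)$ has data $(\varepsilon',d')$ with $d'=d$, $\varepsilon'_{ij}=-\varepsilon_{ij}$ if $i=k$ or $j=k$, and $\varepsilon'_{ij}=\varepsilon_{ij}+\frac12(|\varepsilon_{ik}|\varepsilon_{kj}+\varepsilon_{ik}|\varepsilon_{kj}|)$ otherwise. **Hilbert space and operators.** $\hbar_k:=\hbar/d_k$. To each seed is attached $\mathscr{H}_\Gamma=L^2(\mathbb{R}^n,da_1\cdots da_n)$ and the dense subspace $D_\Gamma$ spanned by the functions $e^{-\sum_i(\alpha_ia_i^2+\beta_ia_i)}P(a_1,\dots,a_n)$ with $\alpha_i,\beta_i\in\mathbb{C}$, $\mathrm{Re}(\alpha_i)>0$, $P$ a complex polynomial. On $D_\Gamma$ put $\widehat{\mathbf q}_i^\hbar=a_i$ (multiplication), $\widehat{\mathbf p}_i^\hbar=2\pi\sqrt{-1}\,\hbar\,\frac{\partial}{\partial a_i}$, and $$\widehat{\mathbf x}^\hbar_{\Gamma;i}=\tfrac12d_i^{-1}\widehat{\mathbf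 p}_i^\hbar-\sum_{j}\varepsilon_{ij}\widehat{\mathbf q}_j^\hbar,\qquad \widehat{\widetilde{\mathbf x}}{}^\hbar_{\Gamma;i}=\tfrac12d_i^{-1}\widehat{\mathbf p}_i^\hbar+\sum_{j}\varepsilon_{ij}\widehat{\mathbf q}_j^\hbar .$$ These are essentially self-adjoint on $D_\Gamma$; the same symbols denote the unique self-adjoint extensions inside functional calculus. **Quantum dilogarithm.** For real $h>0$ and real $z$, $$\Phi^h(z)=\exp\left(-\frac14\int_\Omega\frac{e^{-\sqrt{-1}\,pz}}{\sinh(\pi p)\sinh(\pi hp)}\frac{dp}{p}\right),$$ where $\Omega$ is the real line (oriented left to right) avoiding the origin by a small half circle above it. One has $|\Phi^h(z)|=1$ for real $z$. **Intertwiner.** For $\Gamma'=\mu_k(\Gamma)$, $\mathbf{K}^\hbar_{\Gamma\stackrel{k}{\to}\Gamma'}:\mathscr{H}_{\Gamma'}\to\mathscr{H}_\Gamma$ is the unitary map $$\mathbf{K}^\hbar_{\Gamma\stackrel{k}{\to}\Gamma'}=\Phi^{\hbar_k}(\widehat{\mathbf x}^\hbar_{\Gamma;k})\,\bigl(\Phi^{\hbar_k}(\widehat{\widetilde{\mathbf x}}{}^\hbar_{\Gamma;k})\bigr)^{-1}\circ\mathbf{K}'_{\Gamma\stackrel{k}{\to}\Gamma'},$$ where the first two factors are defined by functional calculus and $(\mathbf{K}'_{\Gamma\stackrel{k}{\to}\Gamma'}f)(a_1,\dots,a_n)=f(a_1',\dots,a_n')$ with $a'_i=a_i$ for $i\ne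 k$ and $a'_k=-a_k+\sum_{j=1}^n[-\varepsilon_{kj}]_+a_j$. *)

theory Defs
  imports "HOL-Complex_Analysis.Complex_Analysis"
begin

section \<open>Seeds and mutations\<close>

text \<open>The rank is the cardinality of the finite index type \<open>'n\<close>.  The formal cluster variables
  of a seed are omitted, since no operator below depends on them.\<close>

record 'n seed =
  exch :: "'n \<Rightarrow> 'n \<Rightarrow> int"
  symm :: "'n \<Rightarrow> nat"

definition D_seed :: "'n seed \<Rightarrow> bool" where
  "D_seed \<Gamma> \<longleftrightarrow>
     (\<forall>i. 0 < symm \<Gamma> i) \<and>
     (\<forall>i j. of_int (exch \<Gamma> i j) / of_nat (symm \<Gamma> j)
            = (- of_int (exch \<Gamma> j i) / of_nat (symm \<Gamma> i) :: rat))"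

text \<open>The division by two is exact (\<open>mutate_div_exact\<close>).\<close>

definition mutate :: "'n \<Rightarrow> 'n seed \<Rightarrow> 'n seed" where
  "mutate k \<Gamma> =
     \<lparr> exch = (\<lambda>i j. if i = k \<or> j = k then - exch \<Gamma> i j
               else exch \<Gamma> i j
                    + (\<bar>exch \<Gamma> i k\<bar> * exch \<Gamma> k j + exch \<Gamma> i k * \<bar>exch \<Gamma> k j\<bar>) div 2),
       symm = symm \<Gamma> \<rparr>"

lemma mutate_div_exact: "2 dvd (\<bar>a\<bar> * b + a * \<bar>b\<bar>)" for a b :: int
  by (cases "0 \<le> a"; cases "0 \<le> b") auto

lemma D_seed_exch_symm:
  assumes "D_seed \<Gamma>"
  shows "exch \<Gamma> i j * int (symm \<Gamma> i) = - exch \<Gamma> j i * int (symm \<Gamma> j)"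
proof -
  have pos: "symm \<Gamma> i > 0" "symm \<Gamma> j > 0"
    and eq: "of_int (exch \<Gamma> i j) / of_nat (symm \<Gamma> j)
            = (- of_int (exch \<Gamma> j i) / of_nat (symm \<Gamma> i) :: rat)"
    using assms unfolding D_seed_def by blast+
  have "(of_int (exch \<Gamma> i j * int (symm \<Gamma> i)) :: rat)
      = of_int (- exch \<Gamma> j i * int (symm \<Gamma> j))"
    using eq pos by (simp add: field_simps)
  then show ?thesis by (simp only: of_int_eq_iff)
qed

lemma D_seed_exch_diag:
  assumes "D_seed \<Gamma>"
  shows "exch \<Gamma> i i = 0"
proof -
  have "symm \<Gamma> i > 0" using assms by (simp add: D_seed_def)
  then show ?thesis using D_seed_exch_symm[OF assms, of i i] by simp
qed

lemma mutate_commute: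
  assumes "exch \<Gamma> i j = 0" and "exch \<Gamma> j i = 0"
  shows "mutate j (mutate i \<Gamma>) = mutate i (mutate j \<Gamma>)"
  using assms by (auto simp: mutate_def fun_eq_iff)


section \<open>The Hilbert space of square integrable functions\<close>

definition sq_integrable :: "(real^'n::finite \<Rightarrow> complex) \<Rightarrow> bool" where
  "sq_integrable f \<longleftrightarrow>
     f \<in> borel_measurable lborel \<and> integrable lborel (\<lambda>a. (cmod (f a))\<^sup>2)"

lemma sq_integrable_measurable: "sq_integrable f \<Longrightarrow> f \<in> borel_measurable lborel"
  by (simp add: sq_integrable_def)

lemma sq_integrable_zero: "sq_integrable (\<lambda>a. 0)"
  by (simp add: sq_integrable_def)

lemma sq_integrable_scale:
  assumes "sq_integrable f"
  shows "sq_integrable (\<lambda>a. c * f a)"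
  using assms by (auto simp: sq_integrable_def norm_mult power_mult_distrib)

lemma sq_integrable_add:
  assumes "sq_integrable f" "sq_integrable g"
  shows "sq_integrable (\<lambda>a. f a + g a)"
proof -
  note [measurable] = sq_integrable_measurable[OF assms(1)] sq_integrable_measurable[OF assms(2)]
  have "integrable lborel (\<lambda>a. (cmod (f a + g a))\<^sup>2)"
  proof (rule Bochner_Integration.integrable_bound)
    show "integrable lborel (\<lambda>a. 2 * (cmod (f a))\<^sup>2 + 2 * (cmod (g a))\<^sup>2)"
      using assms by (auto simp: sq_integrable_def)
    have "(cmod (f a + g a))\<^sup>2 \<le> 2 * (cmod (f a))\<^sup>2 + 2 * (cmod (g a))\<^sup>2" for a
    proof -
      have "(cmod (f a + g a))\<^sup>2 \<le> (cmod (f a) + cmod (g a))\<^sup>2"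
        by (intro power_mono norm_triangle_ineq) auto
      also have "\<dots> \<le> 2 * (cmod (f a))\<^sup>2 + 2 * (cmod (g a))\<^sup>2"
        using zero_le_power2[of "cmod (f a) - cmod (g a)"]
        unfolding power2_sum power2_diff by linarith
      finally show ?thesis .
    qed
    then show "AE a in lborel. norm ((cmod (f a + g a))\<^sup>2)
        \<le> norm (2 * (cmod (f a))\<^sup>2 + 2 * (cmod (g a))\<^sup>2)"
      by (auto simp: abs_of_nonneg)
  qed measurable
  then show ?thesis by (simp add: sq_integrable_def)
qed

lemma borel_measurable_cnj_mult:
  fixes f g :: "'a \<Rightarrow> complex"
  assumes "f \<in> borel_measurable M" "g \<in> borel_measurable M"
  shows "(\<lambda>a. cnj (f a) * g a) \<in> borel_measurable M"
proof (rule borel_measurable_times)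
  have "cnj \<in> borel_measurable borel"
    by (intro borel_measurable_continuous_onI continuous_intros)
  from measurable_compose[OF assms(1) this] show "(\<lambda>a. cnj (f a)) \<in> borel_measurable M" .
qed (rule assms(2))

lemma sq_integrable_prod:
  assumes "sq_integrable f" "sq_integrable g"
  shows "integrable lborel (\<lambda>a. cnj (f a) * g a)"
proof -
  show ?thesis
  proof (rule Bochner_Integration.integrable_bound)
    show "integrable lborel (\<lambda>a. (cmod (f a))\<^sup>2 + (cmod (g a))\<^sup>2)"
      using assms by (auto simp: sq_integrable_def)
    have "cmod (f a) * cmod (g a) \<le> (cmod (f a))\<^sup>2 + (cmod (g a))\<^sup>2" for a
    proof -
      have "2 * (cmod (f a) * cmod (g a)) \<le> (cmod (f a))\<^sup>2 + (cmod (g a))\<^sup>2"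
        using zero_le_power2[of "cmod (f a) - cmod (g a)"] unfolding power2_diff by linarith
      moreover have "0 \<le> cmod (f a) * cmod (g a)" by simp
      ultimately show ?thesis by linarith
    qed
    then show "AE a in lborel. norm (cnj (f a) * g a)
        \<le> norm ((cmod (f a))\<^sup>2 + (cmod (g a))\<^sup>2)"
      by (auto simp: norm_mult abs_of_nonneg)
  qed (intro borel_measurable_cnj_mult sq_integrable_measurable assms)
qed

definition l2_rel :: "(real^'n::finite \<Rightarrow> complex) \<Rightarrow> (real^'n \<Rightarrow> complex) \<Rightarrow> bool" where
  "l2_rel f g \<longleftrightarrow> sq_integrable f \<and> sq_integrable g \<and> (AE a in lborel. f a = g a)"

lemma part_equivp_l2_rel: "part_equivp l2_rel"
proof (rule part_equivpI)
  show "\<exists>f. l2_rel f f" by (auto simp: l2_rel_def intro!: exI[of _ "\<lambda>a. 0"] sq_integrable_zero)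
  show "symp l2_rel" by (rule sympI) (auto simp: l2_rel_def elim: eventually_mono)
  show "transp l2_rel"
  proof (rule transpI)
    fix f g h :: "real^'n \<Rightarrow> complex"
    assume "l2_rel f g" "l2_rel g h"
    then show "l2_rel f h" by (auto simp: l2_rel_def elim: eventually_elim2)
  qed
qed

quotient_type 'n l2 = "real^'n::finite \<Rightarrow> complex" / partial: l2_rel
  by (rule part_equivp_l2_rel)

text \<open>The inner product is linear in its second argument.\<close>

lift_definition cinner :: "'n::finite l2 \<Rightarrow> 'n l2 \<Rightarrow> complex"
  is "\<lambda>f g. LINT a|lborel. cnj (f a) * g a"
proof -
  fix f f' g g' :: "real^'n \<Rightarrow> complex"
  assume f: "l2_rel f f'" and g: "l2_rel g g'"
  then have m: "f \<in> borel_measurable lborel" "f' \<in> borel_measurable lborel"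
      "g \<in> borel_measurable lborel" "g' \<in> borel_measurable lborel"
    by (auto simp: l2_rel_def sq_integrable_def)
  show "(LINT a|lborel. cnj (f a) * g a) = (LINT a|lborel. cnj (f' a) * g' a)"
  proof (rule integral_cong_AE)
    show "AE a in lborel. cnj (f a) * g a = cnj (f' a) * g' a"
      using f g by (auto simp: l2_rel_def elim: eventually_elim2)
  qed (intro borel_measurable_cnj_mult m)+
qed

lift_definition scaleC :: "complex \<Rightarrow> 'n::finite l2 \<Rightarrow> 'n l2" (infixr "*\<^sub>C" 75)
  is "\<lambda>c f a. c * f a"
  by (auto simp: l2_rel_def sq_integrable_scale elim: eventually_mono)

instantiation l2 :: (finite) real_inner
begin

lift_definition zero_l2 :: "'a l2" is "\<lambda>a. 0"
  by (simp add: l2_rel_def sq_integrable_zero)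

lift_definition plus_l2 :: "'a l2 \<Rightarrow> 'a l2 \<Rightarrow> 'a l2" is "\<lambda>f g a. f a + g a"
  by (auto simp: l2_rel_def sq_integrable_add elim: eventually_elim2)

definition uminus_l2 :: "'a l2 \<Rightarrow> 'a l2" where "uminus_l2 f = (-1) *\<^sub>C f"

definition minus_l2 :: "'a l2 \<Rightarrow> 'a l2 \<Rightarrow> 'a l2" where "minus_l2 f g = f + - g"

definition scaleR_l2 :: "real \<Rightarrow> 'a l2 \<Rightarrow> 'a l2" where "scaleR_l2 r f = of_real r *\<^sub>C f"

definition inner_l2 :: "'a l2 \<Rightarrow> 'a l2 \<Rightarrow> real" where "inner_l2 f g = Re (cinner f g)"

definition norm_l2 :: "'a l2 \<Rightarrow> real" where "norm_l2 f = sqrt (inner f f)"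

definition dist_l2 :: "'a l2 \<Rightarrow> 'a l2 \<Rightarrow> real" where "dist_l2 f g = norm (f - g)"

definition sgn_l2 :: "'a l2 \<Rightarrow> 'a l2" where "sgn_l2 f = of_real (inverse (norm f)) *\<^sub>C f"

definition uniformity_l2 :: "('a l2 \<times> 'a l2) filter" where
  "uniformity_l2 = (INF e\<in>{0<..}. principal {(f, g). dist f g < e})"

definition open_l2 :: "'a l2 set \<Rightarrow> bool" where
  "open_l2 U \<longleftrightarrow> (\<forall>f\<in>U. eventually (\<lambda>(f', g). f' = f \<longrightarrow> g \<in> U) uniformity)"

instance
proof
  fix f g h :: "'a l2" and r s :: real
  show "f + g + h = f + (g + h)"
    by transfer (auto simp: l2_rel_def sq_integrable_add add.assoc)
  show "f + g = g + f"
    by transfer (auto simp: l2_rel_def sq_integrable_add add.commute)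
  show "0 + f = f"
    by transfer (auto simp: l2_rel_def)
  show "- f + f = 0"
    unfolding uminus_l2_def
    by transfer (auto simp: l2_rel_def sq_integrable_zero)
  show "f - g = f + - g" by (rule minus_l2_def)
  show "r *\<^sub>R (f + g) = r *\<^sub>R f + r *\<^sub>R g"
    unfolding scaleR_l2_def
    by transfer (auto simp: l2_rel_def sq_integrable_add sq_integrable_scale distrib_left)
  show "(r + s) *\<^sub>R f = r *\<^sub>R f + s *\<^sub>R f"
    unfolding scaleR_l2_def
    by transfer (auto simp: l2_rel_def sq_integrable_add sq_integrable_scale distrib_right
        simp flip: distrib_right)
  show "r *\<^sub>R s *\<^sub>R f = (r * s) *\<^sub>R f"
    unfolding scaleR_l2_def
    by transfer (auto simp: l2_rel_def sq_integrable_scale mult.assoc simp flip: of_real_mult)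
  show "1 *\<^sub>R f = f"
    unfolding scaleR_l2_def by transfer (auto simp: l2_rel_def)
  show "sgn f = inverse (norm f) *\<^sub>R f" by (simp only: sgn_l2_def scaleR_l2_def)
  show "dist f g = norm (f - g)" by (rule dist_l2_def)
  show "norm f = sqrt (inner f f)" by (rule norm_l2_def)
  show "inner f g = inner g f"
    unfolding inner_l2_def
  proof transfer
    fix f g :: "real^'a \<Rightarrow> complex"
    have "(LINT a|lborel. cnj (f a) * g a) = (LINT a|lborel. cnj (cnj (g a) * f a))"
      by (simp add: mult.commute)
    also have "\<dots> = cnj (LINT a|lborel. cnj (g a) * f a)"
      by (rule Bochner_Integration.integral_cnj)
    finally show "Re (LINT a|lborel. cnj (f a) * g a) = Re (LINT a|lborel. cnj (g a) * f a)"
      by simp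
  qed
  show "inner (f + g) h = inner f h + inner g h"
    unfolding inner_l2_def
  proof transfer
    fix f g h :: "real^'a \<Rightarrow> complex"
    assume "l2_rel f f" "l2_rel g g" "l2_rel h h"
    then have "integrable lborel (\<lambda>a. cnj (f a) * h a)" "integrable lborel (\<lambda>a. cnj (g a) * h a)"
      by (auto simp: l2_rel_def sq_integrable_prod)
    then show "Re (LINT a|lborel. cnj (f a + g a) * h a)
        = Re (LINT a|lborel. cnj (f a) * h a) + Re (LINT a|lborel. cnj (g a) * h a)"
      by (simp add: distrib_right Bochner_Integration.integral_add)
  qed
  show "inner (r *\<^sub>R f) g = r * inner f g"
    unfolding inner_l2_def scaleR_l2_def
    by transfer (simp add: mult.assoc)
  have sq: "cnj z * z = of_real ((cmod z)\<^sup>2)" for z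
    by (simp add: mult.commute complex_norm_square[symmetric] del: of_real_power)
  show "0 \<le> inner f f"
    unfolding inner_l2_def
    by transfer (simp add: sq del: of_real_power)
  show "inner f f = 0 \<longleftrightarrow> f = 0"
    unfolding inner_l2_def
  proof transfer
    fix f :: "real^'a \<Rightarrow> complex"
    assume "l2_rel f f"
    then have f: "sq_integrable f" by (simp add: l2_rel_def)
    have "Re (LINT a|lborel. cnj (f a) * f a) = (LINT a|lborel. (cmod (f a))\<^sup>2)"
      by (simp add: sq del: of_real_power)
    also have "\<dots> = 0 \<longleftrightarrow> (AE a in lborel. (cmod (f a))\<^sup>2 = 0)"
      using f by (intro integral_nonneg_eq_0_iff_AE) (auto simp: sq_integrable_def)
    also have "\<dots> \<longleftrightarrow> l2_rel f (\<lambda>a. 0)"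
      using f by (auto simp: l2_rel_def sq_integrable_zero)
    finally show "(Re (LINT a|lborel. cnj (f a) * f a) = 0) = l2_rel f (\<lambda>a. 0)" .
  qed
  show "uniformity = (INF e\<in>{0<..}. principal {(f, g :: 'a l2). dist f g < e})"
    by (rule uniformity_l2_def)
  show "open U \<longleftrightarrow> (\<forall>f\<in>U. \<forall>\<^sub>F (f', g) in uniformity. f' = f \<longrightarrow> g \<in> U)" for U :: "'a l2 set"
    by (rule open_l2_def)
qed

end


section \<open>Self-adjoint operators and functional calculus\<close>

text \<open>An unbounded operator is represented by its graph.\<close>

type_synonym 'n unbounded_op = "('n l2 \<times> 'n l2) set"

definition adjoint_op :: "'n::finite unbounded_op \<Rightarrow> 'n unbounded_op" where
  "adjoint_op T = {(u, v). \<forall>(f, g)\<in>T. cinner u g = cinner v f}"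

text \<open>Density of the domain makes the relation \<open>adjoint_op T\<close> single-valued and linear, hence
  so is \<open>T\<close>.\<close>

definition self_adjoint :: "'n::finite unbounded_op \<Rightarrow> bool" where
  "self_adjoint T \<longleftrightarrow> closure (Domain T) = UNIV \<and> adjoint_op T = T"

text \<open>Meaningful for essentially self-adjoint \<open>T\<close>, where the extension exists and is unique.\<close>

definition sa_extension :: "'n::finite unbounded_op \<Rightarrow> 'n unbounded_op" where
  "sa_extension T = (THE S. T \<subseteq> S \<and> self_adjoint S)"

definition bounded_clinear :: "('n::finite l2 \<Rightarrow> 'n l2) \<Rightarrow> bool" where
  "bounded_clinear T \<longleftrightarrow> bounded_linear T \<and> (\<forall>c f. T (c *\<^sub>C f) = c *\<^sub>C T f)"

definition orthogonal_projection :: "('n::finite l2 \<Rightarrow> 'n l2) \<Rightarrow> bool" where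
  "orthogonal_projection P \<longleftrightarrow>
     bounded_clinear P \<and> P \<circ> P = P \<and> (\<forall>f g. cinner (P f) g = cinner f (P g))"

text \<open>Projection-valued measures on the real line; only the values on Borel sets matter.\<close>

definition projection_valued_measure :: "(real set \<Rightarrow> 'n::finite l2 \<Rightarrow> 'n l2) \<Rightarrow> bool" where
  "projection_valued_measure E \<longleftrightarrow>
     (\<forall>B\<in>sets borel. orthogonal_projection (E B)) \<and>
     E {} = (\<lambda>f. 0) \<and> E UNIV = id \<and>
     (\<forall>B\<in>sets borel. \<forall>C\<in>sets borel. E (B \<inter> C) = E B \<circ> E C) \<and>
     (\<forall>B. range B \<subseteq> sets borel \<longrightarrow> disjoint_family B \<longrightarrow>
        (\<forall>f. (\<lambda>m. E (B m) f) sums E (\<Union>m. B m) f))"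

definition scalar_measure :: "(real set \<Rightarrow> 'n::finite l2 \<Rightarrow> 'n l2) \<Rightarrow> 'n l2 \<Rightarrow> real measure" where
  "scalar_measure E f = measure_of UNIV (sets borel) (\<lambda>B. ennreal ((norm (E B f))\<^sup>2))"

text \<open>The relation \<open>S = \<integral> t dE(t)\<close>.  As \<open>\<langle>f, E B f\<rangle> = \<parallel>E B f\<parallel>\<^sup>2\<close>, the quadratic form of the
  right-hand side at \<open>f\<close> is the integral of \<open>t\<close> against \<open>scalar_measure E f\<close>, and by polarisation
  it determines the operator on its domain.\<close>

definition spectral_measure :: "'n::finite unbounded_op \<Rightarrow> (real set \<Rightarrow> 'n l2 \<Rightarrow> 'n l2) \<Rightarrow> bool" where
  "spectral_measure S E \<longleftrightarrow>
     projection_valued_measure E \<and>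
     Domain S = {f. integrable (scalar_measure E f) (\<lambda>t. t\<^sup>2)} \<and>
     (\<forall>(f, g)\<in>S. cinner f g = of_real (LINT t|scalar_measure E f. t))"

text \<open>The operator \<open>\<phi>(S) = \<integral> \<phi>(t) dE(t)\<close> for a self-adjoint \<open>S\<close> and a bounded Borel
  function \<open>\<phi>\<close>, again described by its quadratic form.\<close>

definition fun_calculus :: "(real \<Rightarrow> complex) \<Rightarrow> 'n::finite unbounded_op \<Rightarrow> 'n l2 \<Rightarrow> 'n l2" where
  "fun_calculus \<phi> S = (THE T. bounded_clinear T \<and>
     (\<exists>E. spectral_measure S E \<and>
        (\<forall>f. cinner f (T f) = (LINT t|scalar_measure E f. \<phi> t))))"


section \<open>The quantum dilogarithm\<close>

definition qdilog_integrand :: "real \<Rightarrow> real \<Rightarrow> complex \<Rightarrow> complex" where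
  "qdilog_integrand h z p =
     exp (- \<i> * p * of_real z) / (sinh (of_real pi * p) * sinh (of_real (pi * h) * p)) / p"

text \<open>The nonzero poles of the integrand closest to the origin are \<open>\<plusminus>\<i>\<close> and \<open>\<plusminus>\<i>/h\<close>, so by
  Cauchy's theorem every radius below \<open>min 1 (1/h)\<close> gives the same integral.\<close>

definition qdilog_radius :: "real \<Rightarrow> real" where
  "qdilog_radius h = min 1 (1 / h) / 2"

definition qdilog_integral :: "real \<Rightarrow> real \<Rightarrow> complex" where
  "qdilog_integral h z =
     (let r = qdilog_radius h in
       (LINT p:{..-r}|lborel. qdilog_integrand h z (of_real p))
     + contour_integral (part_circlepath 0 r pi 0) (qdilog_integrand h z)
     + (LINT p:{r..}|lborel. qdilog_integrand h z (of_real p)))"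

definition qdilog :: "real \<Rightarrow> real \<Rightarrow> complex" where
  "qdilog h z = exp (- (1/4) * qdilog_integral h z)"


section \<open>Operators attached to a seed\<close>

definition gauss_poly :: "(real^'n::finite \<Rightarrow> complex) set" where
  "gauss_poly =
     {\<lambda>a. exp (- (\<Sum>i\<in>UNIV. \<alpha> i * of_real (a $ i)^2 + \<beta> i * of_real (a $ i))) * P a | \<alpha> \<beta> P.
        (\<forall>i. 0 < Re (\<alpha> i)) \<and> polynomial_function P}"

text \<open>The complex linear span of \<open>gauss_poly\<close>, the common core of all the operators below.  It does
  not depend on the seed.\<close>

definition core_functions :: "(real^'n::finite \<Rightarrow> complex) set" where
  "core_functions = {\<lambda>a. \<Sum>m<N. c m * g m a | (N::nat) c g. \<forall>m<N. g m \<in> gauss_poly}"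

definition q_op :: "'n::finite \<Rightarrow> (real^'n \<Rightarrow> complex) \<Rightarrow> real^'n \<Rightarrow> complex" where
  "q_op i f = (\<lambda>a. of_real (a $ i) * f a)"

definition p_op :: "real \<Rightarrow> 'n::finite \<Rightarrow> (real^'n \<Rightarrow> complex) \<Rightarrow> real^'n \<Rightarrow> complex" where
  "p_op hbar i f =
     (\<lambda>a. 2 * of_real pi * \<i> * of_real hbar * vector_derivative (\<lambda>t. f (a + t *\<^sub>R axis i 1)) (at 0))"

definition x_op :: "real \<Rightarrow> 'n::finite seed \<Rightarrow> 'n \<Rightarrow> (real^'n \<Rightarrow> complex) \<Rightarrow> real^'n \<Rightarrow> complex" where
  "x_op hbar \<Gamma> i f =
     (\<lambda>a. 1/2 * inverse (of_nat (symm \<Gamma> i)) * p_op hbar i f a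
          - (\<Sum>j\<in>UNIV. of_int (exch \<Gamma> i j) * q_op j f a))"

definition xt_op :: "real \<Rightarrow> 'n::finite seed \<Rightarrow> 'n \<Rightarrow> (real^'n \<Rightarrow> complex) \<Rightarrow> real^'n \<Rightarrow> complex" where
  "xt_op hbar \<Gamma> i f =
     (\<lambda>a. 1/2 * inverse (of_nat (symm \<Gamma> i)) * p_op hbar i f a
          + (\<Sum>j\<in>UNIV. of_int (exch \<Gamma> i j) * q_op j f a))"

definition core_graph ::
    "((real^'n::finite \<Rightarrow> complex) \<Rightarrow> real^'n \<Rightarrow> complex) \<Rightarrow> 'n unbounded_op" where
  "core_graph A = {(abs_l2 f, abs_l2 (A f)) | f. f \<in> core_functions}"

definition x_hat :: "real \<Rightarrow> 'n::finite seed \<Rightarrow> 'n \<Rightarrow> 'n unbounded_op" where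
  "x_hat hbar \<Gamma> i = sa_extension (core_graph (x_op hbar \<Gamma> i))"

definition xt_hat :: "real \<Rightarrow> 'n::finite seed \<Rightarrow> 'n \<Rightarrow> 'n unbounded_op" where
  "xt_hat hbar \<Gamma> i = sa_extension (core_graph (xt_op hbar \<Gamma> i))"


section \<open>The intertwiner\<close>

definition mutate_coords :: "'n::finite seed \<Rightarrow> 'n \<Rightarrow> real^'n \<Rightarrow> real^'n" where
  "mutate_coords \<Gamma> k a =
     (\<chi> i. if i = k then - (a $ k) + (\<Sum>j\<in>UNIV. of_int (max (- exch \<Gamma> k j) 0) * a $ j) else a $ i)"

text \<open>Composition with \<open>mutate_coords \<Gamma> k\<close>, a linear map of determinant \<open>-1\<close> when \<open>\<Gamma>\<close> is a seed,
  so that the choice of representative is irrelevant.\<close>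

definition K_prime :: "'n::finite seed \<Rightarrow> 'n \<Rightarrow> 'n l2 \<Rightarrow> 'n l2" where
  "K_prime \<Gamma> k f = abs_l2 (rep_l2 f \<circ> mutate_coords \<Gamma> k)"

text \<open>The map from the Hilbert space of \<open>mutate k \<Gamma>\<close> to that of \<open>\<Gamma>\<close>.  The two spaces are both
  the type \<open>'n l2\<close>, and the target seed of the mutation is determined by \<open>\<Gamma>\<close> and \<open>k\<close>.\<close>

definition intertwiner :: "real \<Rightarrow> 'n::finite seed \<Rightarrow> 'n \<Rightarrow> 'n l2 \<Rightarrow> 'n l2" where
  "intertwiner hbar \<Gamma> k =
     (let hbar_k = hbar / of_nat (symm \<Gamma> k) in
       fun_calculus (qdilog hbar_k) (x_hat hbar \<Gamma> k)
       \<circ> inv (fun_calculus (qdilog hbar_k) (xt_hat hbar \<Gamma> k))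
       \<circ> K_prime \<Gamma> k)"

end

theory Submission
  imports Defs "HOL-Probability.Probability"
begin

text \<open>
  The operators attached to an index \<open>k\<close> are built from the self-adjoint operators
  \<open>x_hat\<close> and \<open>xt_hat\<close> and from the linear substitution \<open>K_prime\<close>.  If \<open>exch \<Gamma> i j = exch \<Gamma> j i = 0\<close>,
  then mutation at \<open>i\<close> changes neither row \<open>j\<close> of the exchange matrix nor the skew-symmetrizer, so the
  intertwiner of the mutated seed at \<open>j\<close> is literally the intertwiner of the original seed at \<open>j\<close>
  (\<open>intertwiner_mutate_orthogonal\<close>).  The hypothesis therefore compares the two products of
  \<open>intertwiner hbar \<Gamma>0 i\<close> and \<open>intertwiner hbar \<Gamma>0 j\<close>.  These operators commute
  (\<open>intertwiners_commute\<close>) and are unitary, hence \<open>c\<close> fixes a nonzero vector, and \<open>c = 1\<close>.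

  Why they commute: the operator \<open>x_hat\<close> at \<open>i\<close> is a combination of \<open>\<partial>/\<partial>a\<^sub>i\<close> and of multiplications by
  \<open>a\<^sub>l\<close> with \<open>l \<notin> {i, j}\<close>, and likewise at \<open>j\<close>.  The Fourier transform in the two variables \<open>a\<^sub>i\<close>, \<open>a\<^sub>j\<close>
  turns all four operators \<open>x_hat\<close>, \<open>xt_hat\<close> at \<open>i\<close> and \<open>j\<close> into multiplications by real linear
  functions, so all functions of them commute.  The substitution belonging to \<open>i\<close>
  only alters the coordinate \<open>a\<^sub>i\<close>, by a linear form without \<open>a\<^sub>j\<close>; it preserves the operators at \<open>j\<close>
  and hence commutes with their functions.  The two substitutions commute by inspection.

  To make this rigorous one has to evaluate the definite descriptions behind
  \<open>sa_extension\<close> and \<open>fun_calculus\<close>, that is, to prove existence and uniqueness.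
  Three ingredients carry the argument.

  \<^item> The partial Fourier transform is constructed on the Gaussians
    \<open>exp (\<Sum>k. \<beta>\<^sub>k a\<^sub>k - a\<^sub>k\<^sup>2/2)\<close> with complex \<open>\<beta>\<close>: it maps them to multiples of Gaussians and
    preserves their inner products, and these functions span a dense subspace because the Fourier
    transform of an integrable function determines it (\<open>fourier_uniqueness\<close>,
    \<open>partial_fourier_exists\<close>).

  \<^item> The restriction of a Weyl operator to the Gaussians has a self-adjoint adjoint, namely the
    maximal multiplication operator on the Fourier side (\<open>adjoint_gauss_graph\<close>).
    Integration by parts places every function that decays like a Gaussian together with its
    derivative in the domain of that adjoint, so that it is the only self-adjoint extension of the
    operator on the core (\<open>sa_extension_core_graph\<close>).

  \<^item> A multiplication operator has the obvious spectral measure and no other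
    (\<open>scalar_measure_unique\<close>): on the range of a spectral projection for a bounded interval the
    operator minus the midpoint has norm at most half the length, and the iterates of this bound
    confine the function to the part of space where the symbol lies in the interval.

  Finally the quantum dilogarithm has absolute value one on the real line, since its exponent is
  purely imaginary by the symmetry \<open>p \<mapsto> - cnj p\<close> of the contour (\<open>cmod_qdilog\<close>).
\<close>

\<comment> \<open>From here on the dollar sign denotes the component of a vector only.\<close>
no_notation fps_nth (infixl "$" 75)

section \<open>Calculus in the Hilbert space\<close>

lemma sq_integrable_rep: "sq_integrable (rep_l2 f)"
  using Quotient3_rep_reflp[OF Quotient3_l2, of f] by (simp add: l2_rel_def)

lemma abs_rep_l2 [simp]: "abs_l2 (rep_l2 f) = f"
  by (rule Quotient3_abs_rep[OF Quotient3_l2])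

lemma rep_abs_l2: "sq_integrable f \<Longrightarrow> AE a in lborel. rep_l2 (abs_l2 f) a = f a"
  using Quotient3_rep_abs[OF Quotient3_l2, of f] by (simp add: l2_rel_def)

lemma abs_l2_eq_iff:
  assumes "sq_integrable f" "sq_integrable g"
  shows "abs_l2 f = abs_l2 g \<longleftrightarrow> (AE a in lborel. f a = g a)"
  using Quotient3_rel[OF Quotient3_l2, of f g] assms by (simp add: l2_rel_def)

lemma l2_eq_iff: "f = g \<longleftrightarrow> (AE a in lborel. rep_l2 f a = rep_l2 g a)"
  using abs_l2_eq_iff[OF sq_integrable_rep sq_integrable_rep, of f g] by simp

lemma measurable_rep_l2 [measurable]: "rep_l2 f \<in> borel_measurable lborel"
  by (rule sq_integrable_measurable[OF sq_integrable_rep])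

lemma l2_rel_self: "sq_integrable f \<Longrightarrow> l2_rel f f"
  by (simp add: l2_rel_def)

lemma cinner_abs_l2:
  assumes "sq_integrable f" "sq_integrable g"
  shows "cinner (abs_l2 f) (abs_l2 g) = (LINT a|lborel. cnj (f a) * g a)"
  using assms by (simp add: cinner.abs_eq l2_rel_self)

lemma cinner_rep: "cinner f g = (LINT a|lborel. cnj (rep_l2 f a) * rep_l2 g a)"
  using cinner_abs_l2[OF sq_integrable_rep sq_integrable_rep, of f g] by simp

lemma abs_l2_add:
  assumes "sq_integrable f" "sq_integrable g"
  shows "abs_l2 (\<lambda>a. f a + g a) = abs_l2 f + abs_l2 g"
  using assms by (simp add: plus_l2.abs_eq l2_rel_self)

lemma abs_l2_scale:
  assumes "sq_integrable f"
  shows "abs_l2 (\<lambda>a. c * f a) = c *\<^sub>C abs_l2 f"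
  using assms by (simp add: scaleC.abs_eq l2_rel_self)

lemma abs_l2_zero: "abs_l2 (\<lambda>a. 0) = 0"
  by (simp add: zero_l2_def)

lemma rep_add: "AE a in lborel. rep_l2 (f + g) a = rep_l2 f a + rep_l2 g a"
  using rep_abs_l2[OF sq_integrable_add[OF sq_integrable_rep sq_integrable_rep], of f g]
  by (simp add: abs_l2_add sq_integrable_rep)

lemma rep_scale: "AE a in lborel. rep_l2 (c *\<^sub>C f) a = c * rep_l2 f a"
  using rep_abs_l2[OF sq_integrable_scale[OF sq_integrable_rep], of c f]
  by (simp add: abs_l2_scale sq_integrable_rep)

lemma scaleC_scaleC [simp]: "a *\<^sub>C b *\<^sub>C f = (a * b) *\<^sub>C f"
  by transfer (auto simp: l2_rel_def sq_integrable_scale mult.assoc)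

lemma scaleC_one [simp]: "1 *\<^sub>C f = f"
  by transfer (auto simp: l2_rel_def)

lemma scaleC_add: "c *\<^sub>C (f + g) = c *\<^sub>C f + c *\<^sub>C g"
  by transfer (auto simp: l2_rel_def sq_integrable_add sq_integrable_scale distrib_left)

lemma scaleC_add_left: "(b + c) *\<^sub>C f = b *\<^sub>C f + c *\<^sub>C f"
  by transfer (auto simp: l2_rel_def sq_integrable_add sq_integrable_scale distrib_right
        simp flip: distrib_right)

lemma uminus_scaleC: "- f = (-1) *\<^sub>C f"
  by (rule uminus_l2_def)

lemma scaleR_scaleC: "r *\<^sub>R f = of_real r *\<^sub>C f"
  by (rule scaleR_l2_def)

lemma scaleC_zero_left [simp]: "0 *\<^sub>C f = 0"
  using scaleR_zero_left[of f] by (simp add: scaleR_scaleC)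

lemma scaleC_zero_right [simp]: "c *\<^sub>C 0 = 0"
  using scaleC_scaleC[of c 0 0] by (metis mult_zero_right scaleC_zero_left)

lemma scaleC_diff: "c *\<^sub>C (f - g) = c *\<^sub>C f - c *\<^sub>C g"
  unfolding diff_conv_add_uminus scaleC_add uminus_scaleC by (simp add: mult.commute)

lemma rep_diff: "AE a in lborel. rep_l2 (f - g) a = rep_l2 f a - rep_l2 g a"
proof -
  have eq: "f - g = f + (-1) *\<^sub>C g" by (simp add: uminus_scaleC[symmetric])
  show ?thesis
    unfolding eq using rep_add[of f "(-1) *\<^sub>C g"] rep_scale[of "-1" g]
    by eventually_elim simp
qed

lemma cinner_add_right: "cinner f (g + h) = cinner f g + cinner f h"
proof transfer
  fix f g h :: "real^'n \<Rightarrow> complex"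
  assume "l2_rel f f" "l2_rel g g" "l2_rel h h"
  then show "(LINT a|lborel. cnj (f a) * (g a + h a))
    = (LINT a|lborel. cnj (f a) * g a) + (LINT a|lborel. cnj (f a) * h a)"
    by (simp add: distrib_left Bochner_Integration.integral_add sq_integrable_prod l2_rel_def)
qed

lemma cinner_commute: "cinner g f = cnj (cinner f g)"
proof transfer
  fix f g :: "real^'n \<Rightarrow> complex"
  show "(LINT a|lborel. cnj (f a) * g a) = cnj (LINT a|lborel. cnj (g a) * f a)"
    unfolding Bochner_Integration.integral_cnj[symmetric] by (simp add: mult.commute)
qed

lemma cinner_scale_right [simp]: "cinner f (c *\<^sub>C g) = c * cinner f g"
proof transfer
  fix f g :: "real^'n \<Rightarrow> complex" and c
  show "(LINT a|lborel. cnj (f a) * (c * g a)) = c * (LINT a|lborel. cnj (f a) * g a)"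
    by (simp add: mult.left_commute)
qed

lemma cinner_add_left: "cinner (f + g) h = cinner f h + cinner g h"
  by (metis cinner_add_right cinner_commute complex_cnj_add)

lemma cinner_scale_left [simp]: "cinner (c *\<^sub>C f) g = cnj c * cinner f g"
  by (metis cinner_commute cinner_scale_right complex_cnj_mult)

lemma cinner_zero [simp]: "cinner f 0 = 0" "cinner 0 f = 0"
  using cinner_scale_right[of f 0 0] cinner_scale_left[of 0 0 f] by simp_all

lemma cinner_diff_right: "cinner f (g - h) = cinner f g - cinner f h"
  using cinner_add_right[of f g "- h"] by (simp add: uminus_scaleC) (simp flip: uminus_scaleC)

lemma cinner_diff_left: "cinner (f - g) h = cinner f h - cinner g h"
  by (metis cinner_diff_right cinner_commute complex_cnj_diff)

lemma Re_cinner: "Re (cinner f g) = inner f g"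
  by (simp add: inner_l2_def)

lemma cinner_self: "cinner f f = of_real ((norm f)\<^sup>2)"
proof (rule complex_eqI)
  show "Re (cinner f f) = Re (of_real ((norm f)\<^sup>2))"
    by (simp add: Re_cinner power2_norm_eq_inner)
  have "cinner f f = cnj (cinner f f)" by (rule cinner_commute)
  then show "Im (cinner f f) = Im (of_real ((norm f)\<^sup>2))"
    by (metis Im_complex_of_real Reals_cnj_iff complex_is_Real_iff)
qed

lemma cinner_eq_inner: "cinner f g = Complex (inner f g) (- inner f (\<i> *\<^sub>C g))"
  by (rule complex_eqI) (simp_all add: inner_l2_def)

lemma norm_scaleC: "norm (c *\<^sub>C f) = cmod c * norm f"
proof -
  have "cinner (c *\<^sub>C f) (c *\<^sub>C f) = of_real ((cmod c * norm f)\<^sup>2)"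
    unfolding cinner_scale_left cinner_scale_right cinner_self[of f] power_mult_distrib
      of_real_mult complex_norm_square by (simp add: mult_ac)
  then have "(norm (c *\<^sub>C f))\<^sup>2 = (cmod c * norm f)\<^sup>2"
    unfolding cinner_self of_real_eq_iff .
  then show ?thesis by (rule power2_eq_imp_eq) auto
qed

lemma norm_cinner_le: "cmod (cinner f g) \<le> norm f * norm g"
proof (cases "cinner f g = 0")
  case False
  define c where "c = cnj (cinner f g) / cmod (cinner f g)"
  have "cinner f (c *\<^sub>C g) = of_real (cmod (cinner f g))"
    using False by (simp add: c_def field_simps complex_norm_square[symmetric] power2_eq_square)
  then have "cmod (cinner f g) = inner f (c *\<^sub>C g)" by (simp add: inner_l2_def)
  also have "\<dots> \<le> norm f * norm (c *\<^sub>C g)" by (rule norm_cauchy_schwarz)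
  also have "norm (c *\<^sub>C g) = norm g" using False by (simp add: norm_scaleC c_def norm_divide)
  finally show ?thesis .
qed simp

lemma bounded_linear_cinner: "bounded_linear (cinner f)"
proof (rule bounded_linear_intro[where K = "norm f"])
  show "cinner f (x + y) = cinner f x + cinner f y" for x y by (rule cinner_add_right)
  show "cinner f (r *\<^sub>R x) = r *\<^sub>R cinner f x" for r x
    by (simp add: scaleR_scaleC scaleR_conv_of_real)
  show "norm (cinner f x) \<le> norm x * norm f" for x
    using norm_cinner_le[of f x] by (simp add: mult.commute)
qed

lemma l2_eqI: "(\<And>h. cinner h f = cinner h g) \<Longrightarrow> f = g"
proof -
  assume "\<And>h. cinner h f = cinner h g"
  then have "cinner (f - g) (f - g) = 0" by (simp add: cinner_diff_right)
  then show "f = g" by (simp add: cinner_self)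
qed

lemma norm_abs_l2: "sq_integrable f \<Longrightarrow> (norm (abs_l2 f))\<^sup>2 = (LINT a|lborel. (cmod (f a))\<^sup>2)"
proof -
  assume f: "sq_integrable f"
  have "(norm (abs_l2 f))\<^sup>2 = Re (cinner (abs_l2 f) (abs_l2 f))"
    by (simp add: cinner_self)
  also have "\<dots> = Re (LINT a|lborel. of_real ((cmod (f a))\<^sup>2))"
    unfolding cinner_abs_l2[OF f f] complex_norm_square by (simp add: mult.commute)
  also have "\<dots> = (LINT a|lborel. (cmod (f a))\<^sup>2)" unfolding integral_complex_of_real by simp
  finally show ?thesis .
qed

lemma norm_rep: "(norm f)\<^sup>2 = (LINT a|lborel. (cmod (rep_l2 f a))\<^sup>2)"
  using norm_abs_l2[OF sq_integrable_rep, of f] by simp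

lemma integrable_rep: "integrable lborel (\<lambda>a. (cmod (rep_l2 f a))\<^sup>2)"
  using sq_integrable_rep[of f] by (simp add: sq_integrable_def)

section \<open>Completeness\<close>

text \<open>The Riesz-Fischer argument: the partial sums of the absolute values have bounded norm, so by
  monotone convergence the series converges absolutely almost everywhere, and the square of its
  sum dominates the squared distance to the partial sums.\<close>

lemma l2_series_convergent:
  fixes d :: "nat \<Rightarrow> 'n::finite l2"
  assumes "summable (\<lambda>k. norm (d k))"
  shows "convergent (\<lambda>n. \<Sum>k<n. d k)"
proof -
  define h where "h k = rep_l2 (d k)" for k
  have sqh: "sq_integrable (h k)" for k by (simp add: h_def sq_integrable_rep)
  have [measurable]: "h k \<in> borel_measurable lborel" for k by (simp add: h_def)
  define M where "M = (\<Sum>k. norm (d k))"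
  define A where "A n a = (\<Sum>k<n. cmod (h k a))" for n a
  have A0: "0 \<le> A n a" for n a by (simp add: A_def sum_nonneg)
  have [measurable]: "A n \<in> borel_measurable lborel" for n unfolding A_def by measurable
  have sqhn: "sq_integrable (\<lambda>a. of_real (cmod (h k a)))" for k
    using sqh[of k] by (simp add: sq_integrable_def)
  have A: "sq_integrable (\<lambda>a. of_real (A n a)) \<and>
      abs_l2 (\<lambda>a. of_real (A n a)) = (\<Sum>k<n. abs_l2 (\<lambda>a. of_real (cmod (h k a))))" for n
  proof (induction n)
    case 0
    then show ?case by (simp add: A_def sq_integrable_zero abs_l2_zero)
  next
    case (Suc n)
    have "(\<lambda>a. of_real (A (Suc n) a)) = (\<lambda>a. of_real (A n a) + complex_of_real (cmod (h n a)))"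
      by (simp add: A_def)
    then show ?case using Suc sqhn[of n] by (simp add: sq_integrable_add abs_l2_add)
  qed
  have nh: "norm (abs_l2 (\<lambda>a. of_real (cmod (h k a)))) = norm (d k)" for k
  proof (rule power2_eq_imp_eq)
    show "(norm (abs_l2 (\<lambda>a. of_real (cmod (h k a)))))\<^sup>2 = (norm (d k))\<^sup>2"
      unfolding norm_abs_l2[OF sqhn] norm_rep[of "d k"] by (simp add: h_def)
  qed auto
  have Abound: "(\<integral>\<^sup>+ a. ennreal ((A n a)\<^sup>2) \<partial>lborel) \<le> ennreal (M\<^sup>2)" for n
  proof -
    have "norm (abs_l2 (\<lambda>a. of_real (A n a))) \<le> (\<Sum>k<n. norm (d k))"
      using norm_sum[of "\<lambda>k. abs_l2 (\<lambda>a. of_real (cmod (h k a)))" "{..<n}"] A[of n] nh by simp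
    also have "\<dots> \<le> M" unfolding M_def by (rule sum_le_suminf[OF assms]) auto
    finally have "(norm (abs_l2 (\<lambda>a. of_real (A n a))))\<^sup>2 \<le> M\<^sup>2" by (rule power_mono) simp
    moreover have "(\<integral>\<^sup>+ a. ennreal ((A n a)\<^sup>2) \<partial>lborel) = ennreal (LINT a|lborel. (A n a)\<^sup>2)"
      using A[of n] by (intro nn_integral_eq_integral) (auto simp: sq_integrable_def A0)
    ultimately show ?thesis using norm_abs_l2[of "\<lambda>a. of_real (A n a)"] A[of n] 
      by (simp add: A0 ennreal_leI)
  qed
  have incA: "incseq (\<lambda>n a. ennreal ((A n a)\<^sup>2))"
    by (rule incseq_SucI) (auto simp: le_fun_def A_def sum_nonneg intro!: ennreal_leI power_mono)
  have sup: "(\<integral>\<^sup>+ a. (SUP n. ennreal ((A n a)\<^sup>2)) \<partial>lborel) \<le> ennreal (M\<^sup>2)"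
    by (subst nn_integral_monotone_convergence_SUP[OF incA]) (auto intro!: SUP_least Abound)
  then have "(\<integral>\<^sup>+ a. (SUP n. ennreal ((A n a)\<^sup>2)) \<partial>lborel) \<noteq> \<infinity>"
    by (metis ennreal_less_top infinity_ennreal_def leD top.not_eq_extremum order_le_less_trans)
  then have fin: "AE a in lborel. (SUP n. ennreal ((A n a)\<^sup>2)) \<noteq> \<infinity>"
    by (intro nn_integral_PInf_AE) auto
  have summ: "AE a in lborel. summable (\<lambda>k. cmod (h k a))"
    using fin
  proof eventually_elim
    case (elim a)
    then obtain B where B: "(SUP n. ennreal ((A n a)\<^sup>2)) = ennreal B" "0 \<le> B"
      by (cases "SUP n. ennreal ((A n a)\<^sup>2)") auto
    have "A n a \<le> sqrt B" for n
    proof -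
      have "ennreal ((A n a)\<^sup>2) \<le> ennreal B" unfolding B(1)[symmetric] by (rule SUP_upper) simp
      then show ?thesis using B(2) by (intro real_le_rsqrt) simp
    qed
    then have "sum (\<lambda>k. cmod (h k a)) {..n} \<le> sqrt B" for n
      unfolding A_def by (metis lessThan_Suc_atMost)
    then show ?case by (intro bounded_imp_summable[of _ "sqrt B"]) auto
  qed
  define w where "w a = (\<Sum>k. cmod (h k a))" for a
  define f where "f a = (\<Sum>k. h k a)" for a
  have [measurable]: "w \<in> borel_measurable lborel" "f \<in> borel_measurable lborel"
    unfolding w_def f_def by measurable
  have Aw: "AE a in lborel. (\<forall>n. A n a \<le> w a) \<and> 0 \<le> w a \<and> (SUP n. ennreal ((A n a)\<^sup>2)) = ennreal ((w a)\<^sup>2)"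
    using summ
  proof eventually_elim
    case (elim a)
    have le: "A n a \<le> w a" for n unfolding A_def w_def by (rule sum_le_suminf[OF elim]) auto
    have lim: "(\<lambda>n. A n a) \<longlonglongrightarrow> w a" unfolding A_def w_def by (rule summable_LIMSEQ[OF elim])
    have "(\<lambda>n. ennreal ((A n a)\<^sup>2)) \<longlonglongrightarrow> ennreal ((w a)\<^sup>2)"
      by (intro tendsto_ennrealI tendsto_power lim)
    moreover have "(\<lambda>n. ennreal ((A n a)\<^sup>2)) \<longlonglongrightarrow> (SUP n. ennreal ((A n a)\<^sup>2))"
      using incA by (intro LIMSEQ_SUP) (auto simp: incseq_def le_fun_def)
    ultimately have "(SUP n. ennreal ((A n a)\<^sup>2)) = ennreal ((w a)\<^sup>2)"
      by (metis LIMSEQ_unique)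
    then show ?case using le A0[of 0 a] order_trans[OF A0 le] by simp
  qed
  have w2: "integrable lborel (\<lambda>a. (w a)\<^sup>2)"
  proof (rule integrableI_bounded)
    have "(\<integral>\<^sup>+ a. ennreal (norm ((w a)\<^sup>2)) \<partial>lborel) = (\<integral>\<^sup>+ a. (SUP n. ennreal ((A n a)\<^sup>2)) \<partial>lborel)"
      using Aw by (intro nn_integral_cong_AE) (auto elim: eventually_mono)
    also have "\<dots> \<le> ennreal (M\<^sup>2)" by (rule sup)
    finally show "(\<integral>\<^sup>+ a. ennreal (norm ((w a)\<^sup>2)) \<partial>lborel) < \<infinity>"
      by (metis ennreal_less_top infinity_ennreal_def order_le_less_trans)
  qed measurable
  have tail: "AE a in lborel. \<forall>n. cmod (f a - (\<Sum>k<n. h k a)) \<le> w a \<and> cmod (f a) \<le> w a"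
    using summ
  proof eventually_elim
    case (elim a)
    have s: "summable (\<lambda>k. h k a)" by (rule summable_norm_cancel[OF elim])
    show ?case
    proof (intro allI conjI)
      fix n
      have "f a - (\<Sum>k<n. h k a) = (\<Sum>k. h (k + n) a)"
        unfolding f_def using suminf_minus_initial_segment[OF s] by simp
      also have "cmod \<dots> \<le> (\<Sum>k. cmod (h (k + n) a))"
        by (rule summable_norm) (subst summable_iff_shift, rule elim)
      also have "\<dots> = w a - (\<Sum>k<n. cmod (h k a))"
        unfolding w_def using suminf_minus_initial_segment[OF elim] by simp
      also have "\<dots> \<le> w a" by (simp add: sum_nonneg)
      finally show "cmod (f a - (\<Sum>k<n. h k a)) \<le> w a" .
      show "cmod (f a) \<le> w a" unfolding f_def w_def by (rule summable_norm[OF elim])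
    qed
  qed
  have w0: "AE a in lborel. 0 \<le> w a" using Aw by (auto elim: eventually_mono)
  have sqf: "sq_integrable f"
    unfolding sq_integrable_def
  proof (intro conjI)
    show "integrable lborel (\<lambda>a. (cmod (f a))\<^sup>2)"
      by (rule Bochner_Integration.integrable_bound[OF w2])
        (use tail in \<open>auto intro!: power_mono elim: AE_mp\<close>)
  qed measurable
  have part: "sq_integrable (\<lambda>a. \<Sum>k<n. h k a) \<and> abs_l2 (\<lambda>a. \<Sum>k<n. h k a) = (\<Sum>k<n. d k)" for n
  proof (induction n)
    case 0
    then show ?case by (simp add: sq_integrable_zero abs_l2_zero)
  next
    case (Suc n)
    then show ?case using sqh[of n] by (simp add: sq_integrable_add abs_l2_add) (simp add: h_def)
  qed
  have nd: "(norm (abs_l2 f - (\<Sum>k<n. d k)))\<^sup>2 = (LINT a|lborel. (cmod (f a - (\<Sum>k<n. h k a)))\<^sup>2)" for n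
  proof -
    have p: "sq_integrable (\<lambda>a. (\<Sum>k<n. h k a))" "abs_l2 (\<lambda>a. (\<Sum>k<n. h k a)) = (\<Sum>k<n. d k)"
      using part[of n] by blast+
    have "AE a in lborel. rep_l2 (abs_l2 f - (\<Sum>k<n. d k)) a = f a - (\<Sum>k<n. h k a)"
      using rep_diff[of "abs_l2 f" "\<Sum>k<n. d k"] rep_abs_l2[OF sqf] rep_abs_l2[OF p(1), unfolded p(2)]
      by eventually_elim simp
    then show ?thesis unfolding norm_rep[of "abs_l2 f - (\<Sum>k<n. d k)"]
      by (intro integral_cong_AE) (measurable, auto elim: eventually_mono)
  qed
  have "(\<lambda>n. LINT a|lborel. (cmod (f a - (\<Sum>k<n. h k a)))\<^sup>2) \<longlonglongrightarrow> (LINT a|(lborel :: (real^'n) measure). 0)"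
  proof (rule integral_dominated_convergence[where w = "\<lambda>a. (w a)\<^sup>2"])
    show "AE a in lborel. (\<lambda>n. (cmod (f a - (\<Sum>k<n. h k a)))\<^sup>2) \<longlonglongrightarrow> 0"
      using summ
    proof eventually_elim
      case (elim a)
      have "(\<lambda>n. (cmod (f a - (\<Sum>k<n. h k a)))\<^sup>2) \<longlonglongrightarrow> (cmod (f a - f a))\<^sup>2"
        unfolding f_def by (intro tendsto_intros summable_LIMSEQ summable_norm_cancel[OF elim])
      then show ?case by simp
    qed
    show "AE a in lborel. norm ((cmod (f a - (\<Sum>k<n. h k a)))\<^sup>2) \<le> (w a)\<^sup>2" for n
      by (rule eventually_mono[OF tail], simp add: power_mono)
  qed (use w2 in measurable)
  then have "(\<lambda>n. (norm (abs_l2 f - (\<Sum>k<n. d k)))\<^sup>2) \<longlonglongrightarrow> 0" unfolding nd by simp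
  then have "(\<lambda>n. sqrt ((norm (abs_l2 f - (\<Sum>k<n. d k)))\<^sup>2)) \<longlonglongrightarrow> sqrt 0" by (rule tendsto_real_sqrt)
  then have "(\<lambda>n. norm (abs_l2 f - (\<Sum>k<n. d k))) \<longlonglongrightarrow> 0" by simp
  then have "(\<lambda>n. norm ((\<Sum>k<n. d k) - abs_l2 f)) \<longlonglongrightarrow> 0" by (simp add: norm_minus_commute)
  then have "(\<lambda>n. \<Sum>k<n. d k) \<longlonglongrightarrow> abs_l2 f"
    by (simp add: tendsto_norm_zero_iff LIM_zero_iff)
  then show ?thesis by (auto simp: convergent_def)
qed

instance l2 :: (finite) complete_space
proof
  fix X :: "nat \<Rightarrow> 'a l2"
  assume X: "Cauchy X"
  \<comment> \<open>A subsequence whose increments are bounded by a geometric series.\<close>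
  define N where "N k = (SOME N. \<forall>m\<ge>N. \<forall>n\<ge>N. dist (X m) (X n) < (1/2)^k)" for k
  have N: "dist (X m) (X n) < (1/2)^k" if "m \<ge> N k" "n \<ge> N k" for k m n
  proof -
    have "\<exists>N. \<forall>m\<ge>N. \<forall>n\<ge>N. dist (X m) (X n) < (1/2)^k"
      using X by (rule metric_CauchyD) simp
    from someI_ex[OF this] that show ?thesis unfolding N_def by blast
  qed
  define r where "r = rec_nat (N 0) (\<lambda>k rk. Suc (max rk (N (Suc k))))"
  have r_Suc: "r (Suc k) = Suc (max (r k) (N (Suc k)))" for k by (simp add: r_def)
  have rN: "N k \<le> r k" for k by (cases k) (auto simp: r_def)
  have mono: "strict_mono r" by (auto simp: strict_mono_Suc_iff r_Suc)
  define d where "d k = X (r (Suc k)) - X (r k)" for k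
  have dk: "norm (d k) \<le> (1/2)^k" for k
    using N[where k = k and m = "r (Suc k)" and n = "r k"] rN[of k] mono
    by (auto simp: d_def dist_norm r_Suc intro: less_imp_le)
  have sd: "summable (\<lambda>k. norm (d k))"
  proof (rule summable_comparison_test')
    show "summable (\<lambda>k. (1/2 :: real)^k)" by simp
    show "norm (norm (d k)) \<le> (1/2)^k" if "k \<ge> 0" for k using dk by simp
  qed
  obtain L where L: "(\<lambda>n. \<Sum>k<n. d k) \<longlonglongrightarrow> L"
    using l2_series_convergent[OF sd] unfolding convergent_def by blast
  have "(\<Sum>k<n. d k) = X (r n) - X (r 0)" for n
    unfolding d_def by (rule sum_lessThan_telescope)
  with L have "(\<lambda>n. X (r n) - X (r 0) + X (r 0)) \<longlonglongrightarrow> L + X (r 0)"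
    by (intro tendsto_add tendsto_const) simp
  then have "(X \<circ> r) \<longlonglongrightarrow> L + X (r 0)" by (simp add: o_def)
  then have "X \<longlonglongrightarrow> L + X (r 0)" by (rule Cauchy_converges_subseq[OF X mono])
  then show "convergent X" by (auto simp: convergent_def)
qed

section \<open>Dense subspaces and isometric extension\<close>

text \<open>The projection theorem: a minimizing sequence for the distance from \<open>x\<close> to \<open>V\<close> is Cauchy by the
  parallelogram law, and the difference of \<open>x\<close> and its limit is orthogonal to \<open>V\<close>.\<close>

lemma orthogonal_trivial_imp_dense:
  fixes V :: "'a::{real_inner, complete_space} set"
  assumes V: "subspace V" and triv: "\<And>x. (\<And>v. v \<in> V \<Longrightarrow> inner v x = 0) \<Longrightarrow> x = 0"
  shows "closure V = UNIV"
proof -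
  have "x \<in> closure V" for x
  proof -
    have V0: "V \<noteq> {}" using subspace_0[OF V] by blast
    define d where "d = infdist x V"
    have d0: "0 \<le> d" by (simp add: d_def infdist_nonneg)
    have dle: "d \<le> norm (x - v)" if "v \<in> V" for v
      using infdist_le[OF that, of x] by (simp add: d_def dist_norm)
    have "\<exists>v\<in>V. norm (x - v) < d + 1 / Suc n" for n
    proof -
      have "\<not> (\<forall>v\<in>V. d + 1 / Suc n \<le> norm (x - v))"
      proof
        assume "\<forall>v\<in>V. d + 1 / Suc n \<le> norm (x - v)"
        then have "d + 1 / Suc n \<le> infdist x V"
          unfolding infdist_def using V0 by (auto simp: dist_norm intro!: cINF_greatest)
        then show False by (simp add: d_def)
      qed
      then show ?thesis by (auto simp: not_le)
    qed
    then obtain y where yV: "\<And>n. y n \<in> V" and yd: "\<And>n. norm (x - y n) < d + 1 / Suc n" by metis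
    have lim: "(\<lambda>n. norm (x - y n)) \<longlonglongrightarrow> d"
    proof (rule tendsto_sandwich[of "\<lambda>n. d" _ _ "\<lambda>n. d + inverse (real (Suc n))"])
      show "(\<lambda>n. d + inverse (real (Suc n))) \<longlonglongrightarrow> d"
        using tendsto_add[OF tendsto_const LIMSEQ_inverse_real_of_nat, of d] by simp
      show "\<forall>\<^sub>F n in sequentially. norm (x - y n) \<le> d + inverse (real (Suc n))"
        using yd by (auto intro!: always_eventually less_imp_le simp: inverse_eq_divide)
    qed (use dle yV in \<open>auto intro!: always_eventually\<close>)
    have par: "(norm (y m - y n))\<^sup>2 \<le> 2 * (norm (x - y m))\<^sup>2 + 2 * (norm (x - y n))\<^sup>2 - 4 * d\<^sup>2" for m n
    proof -
      have "(1/2) *\<^sub>R (y m + y n) \<in> V" using V yV by (intro subspace_scale subspace_add) auto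
      then have "d\<^sup>2 \<le> (norm (x - (1/2) *\<^sub>R (y m + y n)))\<^sup>2" by (intro power_mono dle d0)
      moreover have "(norm (y m - y n))\<^sup>2 = 2 * (norm (x - y m))\<^sup>2 + 2 * (norm (x - y n))\<^sup>2
          - 4 * (norm (x - (1/2) *\<^sub>R (y m + y n)))\<^sup>2"
        unfolding power2_norm_eq_inner
        by (simp add: inner_diff_left inner_diff_right inner_add_left inner_add_right inner_commute algebra_simps)
      ultimately show ?thesis by linarith
    qed
    have "Cauchy y"
    proof (rule metric_CauchyI)
      fix e :: real assume e: "0 < e"
      have "(\<lambda>n. 2 * (norm (x - y n))\<^sup>2) \<longlonglongrightarrow> 2 * d\<^sup>2" by (intro tendsto_intros lim)
      then have "\<forall>\<^sub>F n in sequentially. 2 * (norm (x - y n))\<^sup>2 < 2 * d\<^sup>2 + e\<^sup>2 / 2"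
        by (rule order_tendstoD) (use e in simp)
      then obtain N where N: "\<And>n. n \<ge> N \<Longrightarrow> 2 * (norm (x - y n))\<^sup>2 < 2 * d\<^sup>2 + e\<^sup>2 / 2"
        by (auto simp: eventually_sequentially)
      have "dist (y m) (y n) < e" if "m \<ge> N" "n \<ge> N" for m n
      proof -
        have "(norm (y m - y n))\<^sup>2 < e\<^sup>2"
          using par[of m n] N[OF that(1)] N[OF that(2)] by linarith
        then show ?thesis using e power_less_imp_less_base[of "norm (y m - y n)" 2 e]
          by (simp add: dist_norm)
      qed
      then show "\<exists>N. \<forall>m\<ge>N. \<forall>n\<ge>N. dist (y m) (y n) < e" by blast
    qed
    then obtain z where z: "y \<longlonglongrightarrow> z" using Cauchy_convergent_iff convergent_def by metis
    have nz: "norm (x - z) = d"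
      using LIMSEQ_unique[OF tendsto_norm[OF tendsto_diff[OF tendsto_const z]] lim] .
    have zc: "z \<in> closure V" using z yV closure_sequential by blast
    have "closure V \<subseteq> {v. d \<le> norm (x - v)}"
      using dle by (intro closure_minimal closed_Collect_le continuous_intros) auto
    then have dlec: "d \<le> norm (x - v)" if "v \<in> closure V" for v using that by blast
    have "x - z = 0"
    proof (rule triv)
      fix v assume v: "v \<in> V"
      have cl: "z + t *\<^sub>R v \<in> closure V" for t
        unfolding closure_sequential using yV z v
        by (intro exI[of _ "\<lambda>n. y n + t *\<^sub>R v"])
          (auto intro!: tendsto_intros subspace_add[OF V] subspace_scale[OF V])
      \<comment> \<open>Moving from \<open>z\<close> in the direction \<open>v\<close> does not decrease the distance.  The added \<open>1\<close> below
        spares a separate treatment of \<open>v = 0\<close>.\<close>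
      define b where "b = inner v (x - z)"
      have N: "0 < (norm v)\<^sup>2 + 1" by (simp add: add_nonneg_pos)
      have "0 \<le> t\<^sup>2 * (norm v)\<^sup>2 - 2 * t * b" for t
      proof -
        have "d\<^sup>2 \<le> (norm (x - (z + t *\<^sub>R v)))\<^sup>2" by (intro power_mono dlec cl d0)
        also have "\<dots> = d\<^sup>2 + t\<^sup>2 * (norm v)\<^sup>2 - 2 * t * b"
          unfolding nz[symmetric] power2_norm_eq_inner b_def
          by (simp add: inner_diff_left inner_diff_right inner_add_left inner_add_right inner_commute
            algebra_simps power2_eq_square)
        finally show ?thesis by simp
      qed
      from this[of "b / ((norm v)\<^sup>2 + 1)"]
      have "0 \<le> (b / ((norm v)\<^sup>2 + 1))\<^sup>2 * (norm v)\<^sup>2 - 2 * (b / ((norm v)\<^sup>2 + 1)) * b" .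
      moreover have "(b / ((norm v)\<^sup>2 + 1))\<^sup>2 * (norm v)\<^sup>2 \<le> (b / ((norm v)\<^sup>2 + 1))\<^sup>2 * ((norm v)\<^sup>2 + 1)"
        by (intro mult_left_mono) auto
      moreover have "(b / ((norm v)\<^sup>2 + 1))\<^sup>2 * ((norm v)\<^sup>2 + 1) = b\<^sup>2 / ((norm v)\<^sup>2 + 1)"
        using N by (simp add: power2_eq_square)
      moreover have "2 * (b / ((norm v)\<^sup>2 + 1)) * b = 2 * (b\<^sup>2 / ((norm v)\<^sup>2 + 1))"
        by (simp add: power2_eq_square)
      ultimately have "b\<^sup>2 / ((norm v)\<^sup>2 + 1) \<le> 0" by linarith
      then have "b\<^sup>2 \<le> 0" using N by (simp add: pos_divide_le_eq)
      then have "b = 0" by simp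
      then show "inner v (x - z) = 0" by (simp add: b_def)
    qed
    then show ?thesis using zc by simp
  qed
  then show ?thesis by blast
qed

text \<open>Equality of the Gram matrices makes the assignment \<open>G i \<mapsto> H i\<close> well defined and isometric on
  finite linear combinations: a linear relation among the vectors \<open>G i\<close> holds for the \<open>H i\<close> as well,
  since it says that the norm of a combination vanishes.\<close>

lemma isometric_extension:
  fixes G :: "'i \<Rightarrow> 'a::real_inner" and H :: "'i \<Rightarrow> 'b::{real_inner, complete_space}"
  assumes gram: "\<And>i j. inner (G i) (G j) = inner (H i) (H j)"
    and dense: "closure (span (range G)) = UNIV"
  obtains F where "bounded_linear F" "\<And>x y. inner (F x) (F y) = inner x y" "\<And>i. F (G i) = H i"
proof -
  define X where "X = span (range G)"
  define rp where "rp x = (SOME p :: 'i set \<times> ('i \<Rightarrow> real). finite (fst p) \<and> x = (\<Sum>i\<in>fst p. snd p i *\<^sub>R G i))" for x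
  define f where "f x = (\<Sum>i\<in>fst (rp x). snd (rp x) i *\<^sub>R H i)" for x
  have ex: "\<exists>I c. finite I \<and> x = (\<Sum>i\<in>I. c i *\<^sub>R G i)" if "x \<in> X" for x
  proof -
    obtain t r where t: "finite t" "t \<subseteq> range G" "x = (\<Sum>a\<in>t. r a *\<^sub>R a)"
      using \<open>x \<in> X\<close> unfolding X_def span_explicit by blast
    obtain I where I: "inj_on G I" "t = G ` I"
      using t(2) unfolding subset_image_inj by metis
    have "finite I" using t(1) I by (simp add: finite_image_iff)
    moreover have "x = (\<Sum>i\<in>I. r (G i) *\<^sub>R G i)"
      using t(3) I by (simp add: sum.reindex)
    ultimately have "finite I" "x = (\<Sum>i\<in>I. r (G i) *\<^sub>R G i)" .
    then show ?thesis by (intro exI[of _ I] exI[of _ "\<lambda>i. r (G i)"] conjI)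
  qed
  have rp: "finite (fst (rp x))" "x = (\<Sum>i\<in>fst (rp x). snd (rp x) i *\<^sub>R G i)" if "x \<in> X" for x
  proof -
    from ex[OF that] have "\<exists>p :: 'i set \<times> ('i \<Rightarrow> real). finite (fst p) \<and> x = (\<Sum>i\<in>fst p. snd p i *\<^sub>R G i)"
      by auto
    from someI_ex[OF this] show "finite (fst (rp x))" "x = (\<Sum>i\<in>fst (rp x). snd (rp x) i *\<^sub>R G i)"
      unfolding rp_def by blast+
  qed
  have ip: "inner (\<Sum>i\<in>I. c i *\<^sub>R G i) (\<Sum>j\<in>J. d j *\<^sub>R G j) = inner (\<Sum>i\<in>I. c i *\<^sub>R H i) (\<Sum>j\<in>J. d j *\<^sub>R H j)" for I J c d
    by (simp add: inner_sum_left inner_sum_right gram)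
  have fip: "inner (f x) (f y) = inner x y" if "x \<in> X" "y \<in> X" for x y
    unfolding f_def ip[symmetric] using rp(2)[OF that(1)] rp(2)[OF that(2)] by simp
  have sub: "subspace X" by (simp add: X_def)
  have zeroI: "x = y" if "inner x x - 2 * inner x y + inner y y = 0" for x y :: 'b
  proof -
    have "inner (x - y) (x - y) = 0" using that by (simp add: inner_diff_left inner_diff_right inner_commute)
    then show ?thesis by simp
  qed
  have fadd: "f (x + y) = f x + f y" if "x \<in> X" "y \<in> X" for x y
    by (rule zeroI) (use that in \<open>simp add: inner_add_left inner_add_right fip subspace_add[OF sub] inner_commute\<close>)
  have fscale: "f (c *\<^sub>R x) = c *\<^sub>R f x" if "x \<in> X" for x c
    by (rule zeroI) (use that in \<open>simp add: fip subspace_scale[OF sub]\<close>)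
  have GX: "G i \<in> X" for i by (simp add: X_def span_base)
  have fG: "f (G i) = H i" for i
  proof (rule zeroI)
    have "inner (f (G i)) (H i) = inner (G i) (G i)"
    proof -
      have "inner (f (G i)) (H i) = inner (\<Sum>k\<in>fst (rp (G i)). snd (rp (G i)) k *\<^sub>R G k) (G i)"
        unfolding f_def by (simp add: inner_sum_left gram)
      also have "\<dots> = inner (G i) (G i)" using rp(2)[OF GX[of i]] by simp
      finally show ?thesis .
    qed
    then show "inner (f (G i)) (f (G i)) - 2 * inner (f (G i)) (H i) + inner (H i) (H i) = 0"
      by (simp add: fip GX gram)
  qed
  have fdist: "dist (f x) (f y) = dist x y" if "x \<in> X" "y \<in> X" for x y
  proof -
    have "inner (f x - f y) (f x - f y) = inner (x - y) (x - y)"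
      using that by (simp add: inner_diff_left inner_diff_right fip)
    then show ?thesis by (simp add: dist_norm norm_eq_sqrt_inner)
  qed
  have "uniformly_continuous_on X f"
    unfolding uniformly_continuous_on_def using fdist by metis
  then obtain F where F: "uniformly_continuous_on (closure X) F" "\<And>x. x \<in> X \<Longrightarrow> f x = F x"
    using uniformly_continuous_on_extension_on_closure by metis
  have cX: "closure X = UNIV" using dense by (simp add: X_def)
  have cont: "continuous_on UNIV F" using uniformly_continuous_imp_continuous[OF F(1)] cX by simp
  have approx: "\<exists>u. (\<forall>n. u n \<in> X) \<and> u \<longlonglongrightarrow> x" for x
  proof -
    have "x \<in> closure X" by (simp add: cX)
    then show ?thesis unfolding closure_sequential .
  qed
  have lim: "(\<lambda>n. F (u n)) \<longlonglongrightarrow> F x" if "u \<longlonglongrightarrow> x" for u x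
    by (rule continuous_on_tendsto_compose[OF cont that]) auto
  have Fip: "inner (F x) (F y) = inner x y" for x y
  proof -
    obtain u v where u: "\<And>n. u n \<in> X" "u \<longlonglongrightarrow> x" and v: "\<And>n. v n \<in> X" "v \<longlonglongrightarrow> y"
      using approx by metis
    have "(\<lambda>n. inner (F (u n)) (F (v n))) \<longlonglongrightarrow> inner (F x) (F y)"
      by (intro tendsto_inner lim u v)
    moreover have "(\<lambda>n. inner (F (u n)) (F (v n))) \<longlonglongrightarrow> inner x y"
      using fip u v F(2) tendsto_inner[OF u(2) v(2)] by simp
    ultimately show ?thesis by (rule LIMSEQ_unique)
  qed
  have "bounded_linear F"
  proof (rule bounded_linear_intro[where K = 1])
    show "F (x + y) = F x + F y" for x y
      by (rule zeroI) (simp add: inner_add_left inner_add_right Fip inner_commute)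
    show "F (r *\<^sub>R x) = r *\<^sub>R F x" for r x
      by (rule zeroI) (simp add: Fip)
    show "norm (F x) \<le> norm x * 1" for x by (simp add: norm_eq_sqrt_inner Fip)
  qed
  then show thesis using that Fip fG F(2)[OF GX] by simp
qed

section \<open>An integrable function is determined by its Fourier transform\<close>

text \<open>The positive and the negative part of \<open>v\<close>, normalized and pushed forward along \<open>X\<close>, are probability
  distributions with the same characteristic function, so Levy's theorem identifies them.  Equality
  of the normalizing masses is the hypothesis at \<open>t = 0\<close>.\<close>

lemma char_zero_imp_marginal_zero_real:
  fixes v X :: "'a \<Rightarrow> real"
  assumes v: "integrable M v" and [measurable]: "X \<in> borel_measurable M" "B \<in> sets borel"
    and zero: "\<And>t. (CLINT a|M. iexp (t * X a) * of_real (v a)) = 0"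
  shows "(LINT a|M. indicator B (X a) * v a) = 0"
proof -
  have [measurable]: "v \<in> borel_measurable M" using v by simp
  define p where "p a = max 0 (v a)" for a
  define n where "n a = max 0 (- v a)" for a
  have p: "integrable M p" "p \<in> borel_measurable M" and n: "integrable M n" "n \<in> borel_measurable M"
    using v unfolding p_def n_def by auto
  note [measurable] = p(2) n(2)
  have pos: "0 \<le> p a" "0 \<le> n a" for a by (auto simp: p_def n_def)
  have vpn: "v a = p a - n a" for a by (simp add: p_def n_def)
  have intg: "integrable M (\<lambda>a. iexp (t * X a) * of_real (w a))" if "integrable M w" for w t
    by (rule Bochner_Integration.integrable_bound[OF that])
      (use that in \<open>auto simp: norm_mult intro!: borel_measurable_times\<close>)
  have eq: "(CLINT a|M. iexp (t * X a) * of_real (p a)) = (CLINT a|M. iexp (t * X a) * of_real (n a))" for t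
  proof -
    have "(CLINT a|M. iexp (t * X a) * of_real (p a)) - (CLINT a|M. iexp (t * X a) * of_real (n a))
      = (CLINT a|M. iexp (t * X a) * of_real (v a))"
      using Bochner_Integration.integral_diff[OF intg[OF p(1)] intg[OF n(1)], of t t]
      by (simp add: vpn right_diff_distrib)
    then show ?thesis using zero by simp
  qed
  define m where "m = (LINT a|M. p a)"
  have mn: "m = (LINT a|M. n a)"
    using eq[of 0] by (simp add: m_def)
  show ?thesis
  proof (cases "m = 0")
    case True
    have "AE a in M. p a = 0" "AE a in M. n a = 0"
      using True mn integral_nonneg_eq_0_iff_AE[OF p(1)] integral_nonneg_eq_0_iff_AE[OF n(1)] pos
      by (auto simp: m_def)
    then have "AE a in M. indicator B (X a) * v a = 0"
      by eventually_elim (simp add: vpn)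
    then show ?thesis by (rule integral_eq_zero_AE)
  next
    case False
    then have m: "m > 0" using pos by (auto simp: m_def intro!: order_le_neq_trans integral_nonneg)
    define D where "D w = density M (\<lambda>a. ennreal (w a / m))" for w
    have prob: "prob_space (D w)"
      if w: "integrable M w" "\<And>a. 0 \<le> w a" "(LINT a|M. w a) = m" for w
    proof (rule prob_spaceI)
      have "emeasure (D w) (space (D w)) = (\<integral>\<^sup>+ a. ennreal (w a / m) \<partial>M)"
        unfolding D_def using w(1) by (subst emeasure_density) (auto intro!: nn_integral_cong)
      also have "\<dots> = ennreal (LINT a|M. w a / m)"
        using w m by (intro nn_integral_eq_integral) auto
      also have "\<dots> = 1" using w m by simp
      finally show "emeasure (D w) (space (D w)) = 1" .
    qed
    have char: "char (distr (D w) borel X) t = (CLINT a|M. iexp (t * X a) * of_real (w a)) / m"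
      if w: "integrable M w" "\<And>a. 0 \<le> w a" for w t
    proof -
      have [measurable]: "w \<in> borel_measurable M" using w by simp
      have "char (distr (D w) borel X) t = (CLINT a|D w. iexp (t * X a))"
        unfolding char_def by (subst integral_distr) (auto simp: D_def)
      also have "\<dots> = (CLINT a|M. (w a / m) *\<^sub>R iexp (t * X a))"
        unfolding D_def using w m by (subst integral_density) auto
      also have "\<dots> = (CLINT a|M. (iexp (t * X a) * of_real (w a)) / m)"
        by (simp add: scaleR_conv_of_real mult.commute)
      finally show ?thesis by simp
    qed
    have ind: "(LINT x|distr (D w) borel X. indicator B x) = (LINT a|M. indicator B (X a) * w a) / m"
      if w: "integrable M w" "\<And>a. 0 \<le> w a" for w
    proof -
      have [measurable]: "w \<in> borel_measurable M" using w by simp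
      have "(LINT x|distr (D w) borel X. indicator B x) = (LINT a|D w. indicator B (X a) :: real)"
        by (subst integral_distr) (auto simp: D_def)
      also have "\<dots> = (LINT a|M. (w a / m) *\<^sub>R indicator B (X a))"
        unfolding D_def using w m by (subst integral_density) auto
      also have "\<dots> = (LINT a|M. (indicator B (X a) * w a) / m)"
        by (simp add: mult.commute)
      finally show ?thesis by simp
    qed
    interpret P: prob_space "D p" using prob[OF p(1) pos(1)] by (simp add: m_def)
    interpret N: prob_space "D n" using prob[OF n(1) pos(2)] by (simp add: mn)
    have "distr (D p) borel X = distr (D n) borel X"
    proof (rule Levy_uniqueness)
      show "real_distribution (distr (D p) borel X)"
        by (rule P.real_distribution_distr) (simp add: D_def)
      show "real_distribution (distr (D n) borel X)"
        by (rule N.real_distribution_distr) (simp add: D_def)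
      show "char (distr (D p) borel X) = char (distr (D n) borel X)"
        by (rule ext) (simp only: char[OF p(1) pos(1)] char[OF n(1) pos(2)] eq)
    qed
    then have "(LINT a|M. indicator B (X a) * p a) = (LINT a|M. indicator B (X a) * n a)"
      using ind[OF p(1) pos(1)] ind[OF n(1) pos(2)] m by simp
    moreover have "integrable M (\<lambda>a. indicator B (X a) * w a)" if "integrable M w" for w :: "'a \<Rightarrow> real"
      by (rule Bochner_Integration.integrable_bound[OF that])
        (use that in \<open>auto split: split_indicator\<close>)
    ultimately show ?thesis using p n by (simp add: vpn right_diff_distrib)
  qed
qed

lemma char_zero_imp_marginal_zero:
  fixes v :: "'a \<Rightarrow> complex" and X :: "'a \<Rightarrow> real"
  assumes v: "integrable M v" and X[measurable]: "X \<in> borel_measurable M" and B[measurable]: "B \<in> sets borel"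
    and zero: "\<And>t. (CLINT a|M. iexp (t * X a) * v a) = 0"
  shows "(CLINT a|M. indicator B (X a) * v a) = 0"
proof -
  have [measurable]: "v \<in> borel_measurable M" using v by simp
  have intg: "integrable M (\<lambda>a. iexp (t * X a) * w a)" if "integrable M w" for w t
    by (rule Bochner_Integration.integrable_bound[OF that])
      (use that in \<open>auto simp: norm_mult intro!: borel_measurable_times\<close>)
  have cv: "integrable M (\<lambda>a. cnj (v a))" using v by simp
  have zero': "(CLINT a|M. iexp (t * X a) * cnj (v a)) = 0" for t
  proof -
    have "(CLINT a|M. iexp (t * X a) * cnj (v a)) = (CLINT a|M. cnj (iexp ((- t) * X a) * v a))"
      by (simp add: exp_cnj)
    also have "\<dots> = cnj (CLINT a|M. iexp ((- t) * X a) * v a)"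
      by (rule Bochner_Integration.integral_cnj)
    finally show ?thesis using zero[of "-t"] by simp
  qed
  have re: "(CLINT a|M. iexp (t * X a) * of_real (Re (v a))) = 0" for t
  proof -
    have "(CLINT a|M. iexp (t * X a) * of_real (Re (v a)))
       = (CLINT a|M. (iexp (t * X a) * v a + iexp (t * X a) * cnj (v a)) / 2)"
      by (rule Bochner_Integration.integral_cong) (auto simp: complex_add_cnj simp flip: distrib_left)
    also have "\<dots> = 0"
      using Bochner_Integration.integral_add[OF intg[OF v, of t] intg[OF cv, of t]] zero[of t] zero'[of t] by simp
    finally show ?thesis .
  qed
  have im: "(CLINT a|M. iexp (t * X a) * of_real (Im (v a))) = 0" for t
  proof -
    have "(CLINT a|M. iexp (t * X a) * of_real (Im (v a)))
       = (CLINT a|M. (iexp (t * X a) * v a - iexp (t * X a) * cnj (v a)) / (2 * \<i>))"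
    proof (rule Bochner_Integration.integral_cong)
      fix a
      have "of_real (Im (v a)) = (v a - cnj (v a)) / (2 * \<i>)" by (simp add: complex_eq_iff)
      then show "iexp (t * X a) * of_real (Im (v a))
          = (iexp (t * X a) * v a - iexp (t * X a) * cnj (v a)) / (2 * \<i>)"
        by (simp only: times_divide_eq_right right_diff_distrib)
    qed simp
    also have "\<dots> = 0"
      using Bochner_Integration.integral_diff[OF intg[OF v, of t] intg[OF cv, of t]] zero[of t] zero'[of t] by simp
    finally show ?thesis .
  qed
  have 1: "(LINT a|M. indicator B (X a) * Re (v a)) = 0"
    by (rule char_zero_imp_marginal_zero_real[OF _ X B re]) (use v in simp)
  have 2: "(LINT a|M. indicator B (X a) * Im (v a)) = 0"
    by (rule char_zero_imp_marginal_zero_real[OF _ X B im]) (use v in simp)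
  have i: "integrable M (\<lambda>a. indicator B (X a) * v a)"
    by (rule Bochner_Integration.integrable_bound[OF v]) (auto split: split_indicator)
  show ?thesis
  proof (rule complex_eqI)
    have r: "Re (indicator B (X a) * v a) = indicator B (X a) * Re (v a)"
      "Im (indicator B (X a) * v a) = indicator B (X a) * Im (v a)" for a
      by (auto split: split_indicator)
    show "Re (CLINT a|M. indicator B (X a) * v a) = Re 0"
      using 1 unfolding integral_Re[OF i, symmetric] r by simp
    show "Im (CLINT a|M. indicator B (X a) * v a) = Im 0"
      using 2 unfolding integral_Im[OF i, symmetric] r by simp
  qed
qed

text \<open>Boxes form a generator, closed under intersection, of the Borel sets, so the measures with the
  densities \<open>max 0 v\<close> and \<open>max 0 (- v)\<close> agree.\<close>

lemma box_integrals_zero_real: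
  fixes v :: "'a::euclidean_space \<Rightarrow> real"
  assumes v: "integrable lborel v"
    and zero: "\<And>l u. (LINT a|lborel. indicator (box l u) a * v a) = 0"
  shows "AE a in lborel. v a = 0"
proof -
  define p where "p a = max 0 (v a)" for a
  define n where "n a = max 0 (- v a)" for a
  have p: "integrable lborel p" and n: "integrable lborel n"
    using v unfolding p_def n_def by auto
  have [measurable]: "v \<in> borel_measurable borel" "p \<in> borel_measurable borel" "n \<in> borel_measurable borel"
    using v p n by (auto dest: borel_measurable_integrable)
  have pos: "0 \<le> p a" "0 \<le> n a" for a by (auto simp: p_def n_def)
  have vpn: "v a = p a - n a" for a by (simp add: p_def n_def)
  have i: "integrable lborel (\<lambda>a. indicator (box l u) a * w a)" if "integrable lborel w" for w :: "'a \<Rightarrow> real" and l u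
    by (rule Bochner_Integration.integrable_bound[OF that])
      (use that in \<open>auto split: split_indicator dest: borel_measurable_integrable\<close>)
  have em: "emeasure (density lborel (\<lambda>a. ennreal (w a))) (box l u)
      = ennreal (LINT a|lborel. indicator (box l u) a * w a)"
    if w: "integrable lborel w" "\<And>a. 0 \<le> w a" for w :: "'a \<Rightarrow> real" and l u
  proof -
    have "w \<in> borel_measurable borel" using w by (auto dest: borel_measurable_integrable)
    then have "emeasure (density lborel (\<lambda>a. ennreal (w a))) (box l u)
        = (\<integral>\<^sup>+ a. ennreal (indicator (box l u) a * w a) \<partial>lborel)"
      by (subst emeasure_density) (auto intro!: nn_integral_cong split: split_indicator)
    also have "\<dots> = ennreal (LINT a|lborel. indicator (box l u) a * w a)"
      using w by (intro nn_integral_eq_integral i) auto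
    finally show ?thesis .
  qed
  have same: "(LINT a|lborel. indicator (box l u) a * p a) = (LINT a|lborel. indicator (box l u) a * n a)" for l u
    using zero[of l u] i[OF p] i[OF n] by (simp add: vpn right_diff_distrib)
  have "density lborel (\<lambda>a. ennreal (p a)) = density lborel (\<lambda>a. ennreal (n a))"
  proof (rule measure_eqI_generator_eq)
    let ?E = "range (\<lambda>(a, b). box a b::'a set)"
    show "Int_stable ?E"
      by (simp add: Int_stable_def box_Int_box split: prod.splits) blast
    show "?E \<subseteq> Pow UNIV" by auto
    show "sets (density lborel (\<lambda>a. ennreal (p a))) = sigma_sets UNIV ?E"
      "sets (density lborel (\<lambda>a. ennreal (n a))) = sigma_sets UNIV ?E"
      by (simp_all add: borel_eq_box)
    let ?A = "\<lambda>n::nat. box (- (real n *\<^sub>R One)) (real n *\<^sub>R One) :: 'a set"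
    show "range ?A \<subseteq> ?E" "(\<Union>i. ?A i) = UNIV"
      unfolding UN_box_eq_UNIV by auto
    show "emeasure (density lborel (\<lambda>a. ennreal (p a))) (?A i) \<noteq> \<infinity>" for i
      by (simp add: em p pos)
    show "emeasure (density lborel (\<lambda>a. ennreal (p a))) X = emeasure (density lborel (\<lambda>a. ennreal (n a))) X"
      if "X \<in> ?E" for X
      using that by (auto simp: em p n pos same)
  qed
  then have "AE a in lborel. ennreal (p a) = ennreal (n a)"
    by (intro sigma_finite_measure.density_unique[OF sigma_finite_lborel]) auto
  then show ?thesis by eventually_elim (simp add: vpn pos)
qed

text \<open>One coordinate at a time, the exponential factor is traded for the indicator of an arbitrary Borel
  set by the one-dimensional result; when all coordinates are used up, the integrals of \<open>u\<close> over
  boxes vanish.\<close>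

lemma fourier_uniqueness:
  fixes u :: "real^'n::finite \<Rightarrow> complex"
  assumes u: "integrable lborel u"
    and zero: "\<And>s. (CLINT a|lborel. iexp (\<Sum>k\<in>UNIV. s k * a $ k) * u a) = 0"
  shows "AE a in lborel. u a = 0"
proof -
  have [measurable]: "u \<in> borel_measurable borel" using u by (auto dest: borel_measurable_integrable)
  have [measurable]: "(\<lambda>a::real^'n. a $ k) \<in> borel_measurable borel" for k
    by (intro borel_measurable_continuous_onI continuous_intros)
  have slices: "(CLINT a|lborel. (\<Prod>k\<in>K. indicator (B k) (a $ k)) * iexp (\<Sum>k\<in>-K. s k * a $ k) * u a) = 0"
    if "finite K" and B: "\<And>k. B k \<in> sets borel" for K s and B :: "'n \<Rightarrow> real set"
    using that(1)
  proof (induction K arbitrary: s)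
    case empty
    then show ?case using zero[of s] by simp
  next
    case (insert k K)
    define v where "v a = (\<Prod>k\<in>K. indicator (B k) (a $ k)) * iexp (\<Sum>l\<in>-insert k K. s l * a $ l) * u a" for a :: "real^'n"
    note [measurable] = B
    have [measurable]: "v \<in> borel_measurable borel" unfolding v_def by measurable
    have P1: "cmod (\<Prod>k\<in>K. indicator (B k) (a $ k)) \<le> 1" for a :: "real^'n"
      unfolding prod_norm[symmetric] by (rule prod_le_1) (auto split: split_indicator)
    have "integrable lborel v"
      by (rule Bochner_Integration.integrable_bound[OF u])
        (auto simp: v_def norm_mult intro!: mult_left_le_one_le P1)
    moreover have "(CLINT a|lborel. iexp (t * a $ k) * v a) = 0" for t
    proof -
      have "(\<Sum>l\<in>-K. (s(k := t)) l * a $ l) = t * a $ k + (\<Sum>l\<in>-insert k K. s l * a $ l)" for a :: "real^'n"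
      proof -
        have "(\<Sum>l\<in>-K. (s(k := t)) l * a $ l) = t * a $ k + (\<Sum>l\<in>-K - {k}. (s(k := t)) l * a $ l)"
          using insert.hyps by (subst sum.remove[of _ k]) auto
        also have "(\<Sum>l\<in>-K - {k}. (s(k := t)) l * a $ l) = (\<Sum>l\<in>-insert k K. s l * a $ l)"
          by (rule sum.cong) auto
        finally show ?thesis .
      qed
      then have "iexp (t * a $ k) * v a
          = (\<Prod>k\<in>K. indicator (B k) (a $ k)) * iexp (\<Sum>l\<in>-K. (s(k := t)) l * a $ l) * u a" for a :: "real^'n"
        by (simp add: v_def exp_add distrib_left mult_ac)
      then show ?thesis using insert.IH[of "s(k := t)"] by simp
    qed
    ultimately have "(CLINT a|lborel. indicator (B k) (a $ k) * v a) = 0"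
      using B by (intro char_zero_imp_marginal_zero) auto
    then show ?case using insert.hyps by (simp add: v_def mult_ac)
  qed
  have box: "(CLINT a|lborel. indicator (box l r) a * u a) = 0" for l r :: "real^'n"
  proof -
    have "indicator (box l r) a = (\<Prod>k\<in>UNIV. indicator {l $ k<..<r $ k} (a $ k) :: complex)" for a :: "real^'n"
      by (auto simp: mem_box_cart split: split_indicator)
    then show ?thesis using slices[of UNIV "\<lambda>k. {l $ k<..<r $ k}"] by simp
  qed
  have i: "integrable lborel (\<lambda>a. indicator (box l r) a * u a)" for l r
    by (rule Bochner_Integration.integrable_bound[OF u]) (auto split: split_indicator)
  have r: "Re (indicator (box l r) a * u a) = indicator (box l r) a * Re (u a)"
      "Im (indicator (box l r) a * u a) = indicator (box l r) a * Im (u a)" for a l r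
      by (auto split: split_indicator)
  have "AE a in lborel. Re (u a) = 0"
    using integral_Re[OF i] u unfolding r box by (intro box_integrals_zero_real) simp_all
  moreover have "AE a in lborel. Im (u a) = 0"
    using integral_Im[OF i] u unfolding r box by (intro box_integrals_zero_real) simp_all
  ultimately show ?thesis by eventually_elim (simp add: complex_eq_iff)
qed

section \<open>Unitary operators\<close>

definition unitary_op :: "('n::finite l2 \<Rightarrow> 'n l2) \<Rightarrow> bool" where
  "unitary_op W \<longleftrightarrow> (\<forall>f g. cinner (W f) (W g) = cinner f g) \<and> surj W"

lemma unitary_cinner: "unitary_op W \<Longrightarrow> cinner (W f) (W g) = cinner f g"
  by (simp add: unitary_op_def)

text \<open>Used to derive linearity of an operator from the preservation of inner products.\<close>

lemma l2_eq_of_cinner: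
  assumes "cinner x x = cinner x y" "cinner y x = cinner y y"
  shows "x = (y :: 'n::finite l2)"
proof -
  have "cinner (x - y) (x - y) = 0"
    using assms by (simp add: cinner_diff_left cinner_diff_right)
  then show ?thesis by (simp add: cinner_self)
qed

lemma unitary_add: "unitary_op W \<Longrightarrow> W (f + g) = W f + W g"
  by (rule l2_eq_of_cinner) (simp_all add: unitary_cinner cinner_add_left cinner_add_right)

lemma unitary_scaleC: "unitary_op W \<Longrightarrow> W (c *\<^sub>C f) = c *\<^sub>C W f"
  by (rule l2_eq_of_cinner) (simp_all add: unitary_cinner)

lemma unitary_diff: "unitary_op W \<Longrightarrow> W (f - g) = W f - W g"
  by (rule l2_eq_of_cinner) (simp_all add: unitary_cinner cinner_diff_left cinner_diff_right)

lemma unitary_norm: "unitary_op W \<Longrightarrow> norm (W f) = norm f"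
  using unitary_cinner[of W f f] by (simp add: norm_eq_sqrt_inner flip: Re_cinner)

lemma unitary_bij: "unitary_op W \<Longrightarrow> bij W"
proof -
  assume W: "unitary_op W"
  have "inj W"
  proof (rule injI)
    fix f g assume "W f = W g"
    then have "norm (W (f - g)) = 0" by (simp add: unitary_diff[OF W])
    then show "f = g" by (simp add: unitary_norm[OF W])
  qed
  with W show ?thesis by (simp add: bij_def unitary_op_def)
qed

lemma unitary_inv_right: "unitary_op W \<Longrightarrow> W (inv W f) = f"
  by (simp add: unitary_bij bij_is_surj surj_f_inv_f)

lemma unitary_inv_left: "unitary_op W \<Longrightarrow> inv W (W f) = f"
  by (simp add: unitary_bij bij_is_inj)

lemma unitary_inv: "unitary_op W \<Longrightarrow> unitary_op (inv W)"
  unfolding unitary_op_def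
  by (metis bij_imp_bij_inv bij_is_surj unitary_bij unitary_inv_right unitary_op_def)

lemma unitary_bounded_linear: "unitary_op W \<Longrightarrow> bounded_linear W"
  by (rule bounded_linear_intro[where K = 1])
    (simp_all add: unitary_add unitary_scaleC unitary_norm scaleR_scaleC)

lemma unitary_comp: "unitary_op V \<Longrightarrow> unitary_op W \<Longrightarrow> unitary_op (V \<circ> W)"
  using comp_surj[of W V] by (simp add: unitary_op_def)

section \<open>Multiplication operators\<close>

definition mult_l2 :: "(real^'n::finite \<Rightarrow> complex) \<Rightarrow> 'n l2 \<Rightarrow> 'n l2" where
  "mult_l2 m f = abs_l2 (\<lambda>a. m a * rep_l2 f a)"

text \<open>The bound one suffices for all symbols below, and it makes multiplication a contraction.\<close>

definition contraction_symbol :: "(real^'n::finite \<Rightarrow> complex) \<Rightarrow> bool" where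
  "contraction_symbol m \<longleftrightarrow> m \<in> borel_measurable borel \<and> (\<forall>a. cmod (m a) \<le> 1)"

lemma contraction_symbolD:
  assumes "contraction_symbol m"
  shows "m \<in> borel_measurable borel" "cmod (m a) \<le> 1"
  using assms by (auto simp: contraction_symbol_def)

lemma sq_integrable_dominated:
  assumes "sq_integrable f" "g \<in> borel_measurable lborel" "AE a in lborel. cmod (g a) \<le> cmod (f a)"
  shows "sq_integrable g"
  unfolding sq_integrable_def
proof
  have "integrable lborel (\<lambda>a. (cmod (f a))\<^sup>2)" using assms by (simp add: sq_integrable_def)
  then show "integrable lborel (\<lambda>a. (cmod (g a))\<^sup>2)"
  proof (rule Bochner_Integration.integrable_bound)
    show "AE a in lborel. norm ((cmod (g a))\<^sup>2) \<le> norm ((cmod (f a))\<^sup>2)"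
      using assms(3) by eventually_elim (simp add: power_mono)
  qed (use assms(2) in measurable)
qed (rule assms(2))

lemma sq_integrable_mult:
  assumes m: "contraction_symbol m"
  shows "sq_integrable (\<lambda>a. m a * rep_l2 f a)"
  by (rule sq_integrable_dominated[OF sq_integrable_rep[of f]])
    (use contraction_symbolD[OF m] measurable_rep_l2[of f] in
      \<open>auto simp: norm_mult intro!: mult_left_le_one_le borel_measurable_times\<close>)

lemma rep_mult_l2:
  "contraction_symbol m \<Longrightarrow> AE a in lborel. rep_l2 (mult_l2 m f) a = m a * rep_l2 f a"
  unfolding mult_l2_def by (rule rep_abs_l2[OF sq_integrable_mult])

lemma mult_l2_eqI:
  assumes m: "contraction_symbol m" and eq: "AE a in lborel. rep_l2 g a = m a * rep_l2 f a"
  shows "mult_l2 m f = g"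
  unfolding l2_eq_iff using rep_mult_l2[OF m, of f] eq by eventually_elim simp


lemma mult_l2_add:
  assumes m: "contraction_symbol m"
  shows "mult_l2 m (f + g) = mult_l2 m f + mult_l2 m g"
proof (rule mult_l2_eqI[OF m])
  show "AE a in lborel. rep_l2 (mult_l2 m f + mult_l2 m g) a = m a * rep_l2 (f + g) a"
    using rep_mult_l2[OF m, of f] rep_mult_l2[OF m, of g]
      rep_add[of "mult_l2 m f" "mult_l2 m g"] rep_add[of f g]
    by eventually_elim (simp add: distrib_left)
qed

lemma mult_l2_scaleC:
  assumes m: "contraction_symbol m"
  shows "mult_l2 m (c *\<^sub>C f) = c *\<^sub>C mult_l2 m f"
proof (rule mult_l2_eqI[OF m])
  show "AE a in lborel. rep_l2 (c *\<^sub>C mult_l2 m f) a = m a * rep_l2 (c *\<^sub>C f) a"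
    using rep_mult_l2[OF m, of f] rep_scale[of c "mult_l2 m f"] rep_scale[of c f]
    by eventually_elim simp
qed

lemma norm_mono_AE:
  assumes "AE a in lborel. cmod (rep_l2 f a) \<le> R * cmod (rep_l2 g a)" "0 \<le> R"
  shows "norm f \<le> R * norm g"
proof (rule power2_le_imp_le)
  have "(LINT a|lborel. (cmod (rep_l2 f a))\<^sup>2) \<le> (LINT a|lborel. R\<^sup>2 * (cmod (rep_l2 g a))\<^sup>2)"
  proof (rule integral_mono_AE)
    show "AE a in lborel. (cmod (rep_l2 f a))\<^sup>2 \<le> R\<^sup>2 * (cmod (rep_l2 g a))\<^sup>2"
      using assms(1)
    proof eventually_elim
      case (elim a)
      then show ?case using power_mono[OF elim, of 2] by (simp add: power_mult_distrib)
    qed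
  qed (simp_all add: integrable_rep)
  then show "(norm f)\<^sup>2 \<le> (R * norm g)\<^sup>2"
    unfolding norm_rep[of f] power_mult_distrib norm_rep[of g] by simp
qed (simp add: assms(2))

lemma norm_mult_l2: "contraction_symbol m \<Longrightarrow> norm (mult_l2 m f) \<le> norm f"
proof -
  assume m: "contraction_symbol m"
  have "AE a in lborel. cmod (rep_l2 (mult_l2 m f) a) \<le> 1 * cmod (rep_l2 f a)"
    using rep_mult_l2[OF m, of f] by eventually_elim (simp add: contraction_symbolD(2)[OF m] norm_mult mult_left_le_one_le)
  from norm_mono_AE[OF this] show ?thesis by simp
qed

lemma bounded_linear_mult_l2: "contraction_symbol m \<Longrightarrow> bounded_linear (mult_l2 m)"
  by (rule bounded_linear_intro[where K = 1])
    (simp_all add: mult_l2_add mult_l2_scaleC norm_mult_l2 scaleR_scaleC)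

lemma contraction_symbol_times: "contraction_symbol m \<Longrightarrow> contraction_symbol k \<Longrightarrow> contraction_symbol (\<lambda>a. m a * k a)"
  unfolding contraction_symbol_def norm_mult by (metis borel_measurable_times mult_le_one norm_ge_zero)

lemma mult_l2_mult_l2:
  assumes m: "contraction_symbol m" and k: "contraction_symbol k"
  shows "mult_l2 m (mult_l2 k f) = mult_l2 (\<lambda>a. m a * k a) f"
proof (rule mult_l2_eqI[OF m])
  show "AE a in lborel. rep_l2 (mult_l2 (\<lambda>a. m a * k a) f) a = m a * rep_l2 (mult_l2 k f) a"
    using rep_mult_l2[OF k, of f] rep_mult_l2[OF contraction_symbol_times[OF m k], of f]
    by eventually_elim simp
qed

lemma cinner_mult_l2:
  assumes m: "contraction_symbol m"
  shows "cinner f (mult_l2 m g) = (CLINT a|lborel. m a * (cnj (rep_l2 f a) * rep_l2 g a))"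
  unfolding cinner_rep
proof (rule integral_cong_AE)
  show "AE a in lborel. cnj (rep_l2 f a) * rep_l2 (mult_l2 m g) a = m a * (cnj (rep_l2 f a) * rep_l2 g a)"
    using rep_mult_l2[OF m, of g] by eventually_elim simp
next
  show "(\<lambda>a. cnj (rep_l2 f a) * rep_l2 (mult_l2 m g) a) \<in> borel_measurable lborel"
    by (intro borel_measurable_cnj_mult measurable_rep_l2)
  show "(\<lambda>a. m a * (cnj (rep_l2 f a) * rep_l2 g a)) \<in> borel_measurable lborel"
    by (intro borel_measurable_times[OF _ borel_measurable_cnj_mult] measurable_rep_l2)
      (simp add: contraction_symbolD(1)[OF m])
qed

text \<open>The symbol of the spectral projection for \<open>B\<close> of multiplication by \<open>g\<close>.\<close>

definition spectral_symbol :: "(real^'n::finite \<Rightarrow> real) \<Rightarrow> real set \<Rightarrow> real^'n \<Rightarrow> complex" where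
  "spectral_symbol g B = (\<lambda>a. indicator B (g a))"

lemma contraction_spectral_symbol:
  assumes "g \<in> borel_measurable borel" "B \<in> sets borel"
  shows "contraction_symbol (spectral_symbol g B)"
  using assms unfolding contraction_symbol_def spectral_symbol_def
  by (auto split: split_indicator)

text \<open>Multiplication by \<open>g\<close>, on its maximal domain, transported by the unitary \<open>W\<close>.\<close>

definition mult_graph :: "('n::finite l2 \<Rightarrow> 'n l2) \<Rightarrow> (real^'n \<Rightarrow> real) \<Rightarrow> 'n unbounded_op" where
  "mult_graph W g = {(u, v). AE a in lborel. rep_l2 (W v) a = of_real (g a) * rep_l2 (W u) a}"

text \<open>The scalar spectral measure of \<open>mult_graph W g\<close> at \<open>f\<close>.\<close>

definition spectral_weight :: "('n::finite l2 \<Rightarrow> 'n l2) \<Rightarrow> (real^'n \<Rightarrow> real) \<Rightarrow> 'n l2 \<Rightarrow> real measure" where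
  "spectral_weight W g f = distr (density lborel (\<lambda>a. ennreal ((cmod (rep_l2 (W f) a))\<^sup>2))) borel g"

definition mult_pvm :: "('n::finite l2 \<Rightarrow> 'n l2) \<Rightarrow> (real^'n \<Rightarrow> real) \<Rightarrow> real set \<Rightarrow> 'n l2 \<Rightarrow> 'n l2" where
  "mult_pvm W g B f = inv W (mult_l2 (spectral_symbol g B) (W f))"

lemma sets_spectral_weight [simp]: "sets (spectral_weight W g f) = sets borel"
  by (simp add: spectral_weight_def)

lemma space_spectral_weight [simp]: "space (spectral_weight W g f) = UNIV"
  by (simp add: spectral_weight_def)

lemma emeasure_spectral_weight:
  assumes [measurable]: "g \<in> borel_measurable borel" "B \<in> sets borel"
  shows "emeasure (spectral_weight W g f) B = ennreal ((norm (mult_l2 (spectral_symbol g B) (W f)))\<^sup>2)"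
proof -
  note m = contraction_spectral_symbol[OF assms]
  have [measurable]: "rep_l2 (W f) \<in> borel_measurable borel" using measurable_rep_l2 by simp
  have "emeasure (spectral_weight W g f) B
      = (\<integral>\<^sup>+ a. ennreal ((cmod (spectral_symbol g B a * rep_l2 (W f) a))\<^sup>2) \<partial>lborel)"
    unfolding spectral_weight_def
    by (subst emeasure_distr; (subst emeasure_density)?)
      (auto intro!: nn_integral_cong split: split_indicator simp: spectral_symbol_def measurable_sets_borel[OF assms])
  also have "\<dots> = ennreal (LINT a|lborel. (cmod (spectral_symbol g B a * rep_l2 (W f) a))\<^sup>2)"
    using sq_integrable_mult[OF m, of "W f"] by (intro nn_integral_eq_integral) (auto simp: sq_integrable_def)
  also have "(LINT a|lborel. (cmod (spectral_symbol g B a * rep_l2 (W f) a))\<^sup>2)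
     = (norm (mult_l2 (spectral_symbol g B) (W f)))\<^sup>2"
    unfolding mult_l2_def by (rule norm_abs_l2[OF sq_integrable_mult[OF m], symmetric])
  finally show ?thesis .
qed

lemma mult_l2_one: "mult_l2 (\<lambda>a. 1) f = f"
  by (simp add: mult_l2_def eta_contract_eq)

lemma finite_measure_spectral_weight:
  assumes "g \<in> borel_measurable borel"
  shows "finite_measure (spectral_weight W g f)"
  by (rule finite_measureI) (simp add: emeasure_spectral_weight assms)

section \<open>Projection-valued measures\<close>

lemma pvm_projection:
  assumes "projection_valued_measure E" "B \<in> sets borel"
  shows "E B (E B f) = E B f" "cinner (E B f) g = cinner f (E B g)" "bounded_linear (E B)"
    "E B (c *\<^sub>C f) = c *\<^sub>C E B f" "E B (f + g) = E B f + E B g" "E B (f - g) = E B f - E B g" "E B 0 = 0"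
proof -
  have o: "orthogonal_projection (E B)" using assms by (simp add: projection_valued_measure_def)
  show "E B (E B f) = E B f" using o by (metis comp_apply orthogonal_projection_def)
  show "cinner (E B f) g = cinner f (E B g)" using o by (simp add: orthogonal_projection_def)
  show bl: "bounded_linear (E B)" using o by (simp add: orthogonal_projection_def bounded_clinear_def)
  show "E B (c *\<^sub>C f) = c *\<^sub>C E B f" using o by (simp add: orthogonal_projection_def bounded_clinear_def)
  interpret bounded_linear "E B" by (rule bl)
  show "E B (f + g) = E B f + E B g" "E B (f - g) = E B f - E B g" "E B 0 = 0" by (simp_all add: add diff)
qed

lemma pvm_Int:
  assumes "projection_valued_measure E" "B \<in> sets borel" "C \<in> sets borel"
  shows "E B (E C f) = E (B \<inter> C) f"
  using assms by (simp add: projection_valued_measure_def)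

lemma pvm_empty: "projection_valued_measure E \<Longrightarrow> E {} f = 0"
  by (simp add: projection_valued_measure_def)

lemma pvm_UNIV: "projection_valued_measure E \<Longrightarrow> E UNIV f = f"
  by (simp add: projection_valued_measure_def)

lemma pvm_sums:
  assumes "projection_valued_measure E" "range B \<subseteq> sets borel" "disjoint_family B"
  shows "(\<lambda>m. E (B m) f) sums E (\<Union>m. B m) f"
  using assms by (simp add: projection_valued_measure_def)

lemma pvm_compl:
  assumes E: "projection_valued_measure E" and B: "B \<in> sets borel"
  shows "E B f + E (- B) f = f"
proof -
  define C where "C m = (if m = 0 then B else if m = 1 then - B else {})" for m :: nat
  have "(\<lambda>m. E (C m) f) sums E (\<Union>m. C m) f"
    using B by (intro pvm_sums[OF E]) (auto simp: C_def disjoint_family_on_def)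
  moreover have "(\<Union>m. C m) = UNIV"
  proof -
    have "B \<union> - B \<subseteq> (\<Union>m. C m)" using UN_upper[of 0 UNIV C] UN_upper[of 1 UNIV C] by (auto simp: C_def)
    then show ?thesis by auto
  qed
  moreover have "(\<lambda>m. E (C m) f) sums (\<Sum>m\<in>{0, 1}. E (C m) f)"
    by (rule sums_finite) (auto simp: C_def pvm_empty[OF E])
  ultimately have "E UNIV f = (\<Sum>m\<in>{0, 1}. E (C m) f)" using sums_unique2 by metis
  then show ?thesis by (simp add: C_def pvm_UNIV[OF E])
qed

text \<open>Countable additivity holds because \<open>(norm (E B f))\<^sup>2 = cinner f (E B f)\<close> depends continuously and
  linearly on \<open>E B f\<close>.\<close>

lemma pvm_scalar:
  assumes E: "projection_valued_measure E"
  shows "sets (scalar_measure E f) = sets borel" "space (scalar_measure E f) = UNIV"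
    and "B \<in> sets borel \<Longrightarrow> emeasure (scalar_measure E f) B = ennreal ((norm (E B f))\<^sup>2)"
proof -
  show s: "sets (scalar_measure E f) = sets borel"
    by (simp add: scalar_measure_def)
      (metis sets.sigma_sets_eq space_borel)
  show "space (scalar_measure E f) = UNIV" by (simp add: scalar_measure_def space_measure_of_conv)
  assume B: "B \<in> sets borel"
  have re: "(norm (E C f))\<^sup>2 = Re (cinner f (E C f))" if "C \<in> sets borel" for C
  proof -
    have "cinner (E C f) (E C f) = cinner f (E C f)"
      using pvm_projection(1,2)[OF E that] by simp
    then show ?thesis unfolding cinner_self by (metis Re_complex_of_real)
  qed
  have "countably_additive (sets borel) (\<lambda>B. ennreal ((norm (E B f))\<^sup>2))"
  proof (rule countably_additiveI)
    fix C :: "nat \<Rightarrow> real set"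
    assume C: "range C \<subseteq> sets borel" "disjoint_family C" "(\<Union>i. C i) \<in> sets borel"
    have "(\<lambda>m. Re (cinner f (E (C m) f))) sums Re (cinner f (E (\<Union>m. C m) f))"
      by (rule bounded_linear.sums[OF bounded_linear_Re
            bounded_linear.sums[OF bounded_linear_cinner pvm_sums[OF E C(1,2)]]])
    then have "(\<lambda>m. (norm (E (C m) f))\<^sup>2) sums (norm (E (\<Union>m. C m) f))\<^sup>2"
      using C by (simp add: re image_subset_iff)
    then show "(\<Sum>i. ennreal ((norm (E (C i) f))\<^sup>2)) = ennreal ((norm (E (\<Union>i. C i) f))\<^sup>2)"
      by (simp add: suminf_ennreal2 sums_summable sums_unique[symmetric])
  qed
  then show "emeasure (scalar_measure E f) B = ennreal ((norm (E B f))\<^sup>2)"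
    using B unfolding scalar_measure_def
    by (intro emeasure_measure_of_sigma)
      (auto simp: positive_def pvm_empty[OF E] sets.sigma_algebra_axioms[of borel, simplified])
qed

lemma pvm_finite_measure:
  assumes E: "projection_valued_measure E"
  shows "finite_measure (scalar_measure E f)"
  by (rule finite_measureI) (simp add: pvm_scalar[OF E])

text \<open>Restricting a vector by a spectral projection restricts its scalar measure; this is how integrals
  against different scalar measures are compared.\<close>

lemma scalar_measure_restrict:
  assumes E: "projection_valued_measure E" and A: "A \<in> sets borel"
  shows "scalar_measure E (E A f) = density (scalar_measure E f) (\<lambda>t. ennreal (indicator A t))"
proof (rule measure_eqI)
  show "sets (scalar_measure E (E A f)) = sets (density (scalar_measure E f) (\<lambda>t. ennreal (indicator A t)))"
    by (simp add: pvm_scalar[OF E])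
  fix B assume "B \<in> sets (scalar_measure E (E A f))"
  then have B: "B \<in> sets borel" by (simp add: pvm_scalar[OF E])
  have [measurable_cong]: "sets (scalar_measure E f) = sets borel" by (rule pvm_scalar[OF E])
  have "emeasure (density (scalar_measure E f) (\<lambda>t. ennreal (indicator A t))) B
     = (\<integral>\<^sup>+ t. ennreal (indicator A t) * indicator B t \<partial>scalar_measure E f)"
    using A B by (intro emeasure_density) (auto simp: pvm_scalar[OF E])
  also have "\<dots> = (\<integral>\<^sup>+ t. indicator (B \<inter> A) t \<partial>scalar_measure E f)"
    by (intro nn_integral_cong) (auto split: split_indicator)
  also have "\<dots> = emeasure (scalar_measure E f) (B \<inter> A)"
    using A B by (intro nn_integral_indicator) (auto simp: pvm_scalar[OF E])
  finally show "emeasure (scalar_measure E (E A f)) B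
      = emeasure (density (scalar_measure E f) (\<lambda>t. ennreal (indicator A t))) B"
    using A B by (simp add: pvm_scalar[OF E] pvm_Int[OF E])
qed

lemma AE_scalar_measure:
  assumes E: "projection_valued_measure E" and A: "A \<in> sets borel" and f: "E A f = f"
  shows "AE t in scalar_measure E f. t \<in> A"
proof (rule AE_I')
  have "E (- A) f = 0" using pvm_compl[OF E A, of f] f by simp
  then show "- A \<in> null_sets (scalar_measure E f)"
    using A by (simp add: null_sets_def pvm_scalar[OF E])
qed (auto simp: pvm_scalar[OF E])

lemma integrable_bounded_support:
  assumes E: "projection_valued_measure E" and A: "A \<in> sets borel" and f: "E A f = f"
    and bound: "\<And>t :: real. t \<in> A \<Longrightarrow> \<bar>\<phi> t :: real\<bar> \<le> K" and [measurable]: "\<phi> \<in> borel_measurable borel"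
  shows "integrable (scalar_measure E f) \<phi>"
proof -
  interpret finite_measure "scalar_measure E f" by (rule pvm_finite_measure[OF E])
  have [measurable_cong]: "sets (scalar_measure E f) = sets borel" by (rule pvm_scalar[OF E])
  show ?thesis
    by (rule integrable_const_bound[of _ K])
      (use AE_scalar_measure[OF E A f] bound in \<open>auto elim!: eventually_mono\<close>)
qed

section \<open>Uniqueness of the spectral measure of a multiplication operator\<close>

lemma mult_graphD: "(u, v) \<in> mult_graph W g \<Longrightarrow> AE a in lborel. rep_l2 (W v) a = of_real (g a) * rep_l2 (W u) a"
  by (simp add: mult_graph_def)

lemma mult_graph_add:
  assumes W: "unitary_op W" and "(u, v) \<in> mult_graph W g" "(u', v') \<in> mult_graph W g"
  shows "(u + u', v + v') \<in> mult_graph W g"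
proof -
  have "AE a in lborel. rep_l2 (W v + W v') a = of_real (g a) * rep_l2 (W u + W u') a"
    using mult_graphD[OF assms(2)] mult_graphD[OF assms(3)] rep_add[of "W v" "W v'"] rep_add[of "W u" "W u'"]
    by eventually_elim (simp add: distrib_left)
  then show ?thesis by (simp add: mult_graph_def unitary_add[OF W])
qed

lemma mult_graph_scaleC:
  assumes W: "unitary_op W" and "(u, v) \<in> mult_graph W g"
  shows "(c *\<^sub>C u, c *\<^sub>C v) \<in> mult_graph W g"
proof -
  have "AE a in lborel. rep_l2 (c *\<^sub>C W v) a = of_real (g a) * rep_l2 (c *\<^sub>C W u) a"
    using mult_graphD[OF assms(2)] rep_scale[of c "W v"] rep_scale[of c "W u"]
    by eventually_elim simp
  then show ?thesis by (simp add: mult_graph_def unitary_scaleC[OF W])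
qed

lemma mult_graph_diff:
  assumes W: "unitary_op W" and "(u, v) \<in> mult_graph W g" "(u', v') \<in> mult_graph W g"
  shows "(u - u', v - v') \<in> mult_graph W g"
  using mult_graph_add[OF W assms(2) mult_graph_scaleC[OF W assms(3), of "-1"]]
  by (simp flip: uminus_scaleC)

lemma mult_graph_symmetric:
  assumes W: "unitary_op W" and "(u, v) \<in> mult_graph W g" "(u', v') \<in> mult_graph W g"
  shows "cinner u v' = cinner v u'"
proof -
  have "cinner (W u) (W v') = cinner (W v) (W u')"
    unfolding cinner_rep
  proof (rule integral_cong_AE)
    show "AE a in lborel. cnj (rep_l2 (W u) a) * rep_l2 (W v') a = cnj (rep_l2 (W v) a) * rep_l2 (W u') a"
      using mult_graphD[OF assms(2)] mult_graphD[OF assms(3)] by eventually_elim simp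
  qed (intro borel_measurable_cnj_mult measurable_rep_l2)+
  then show ?thesis by (simp add: unitary_cinner[OF W])
qed

text \<open>Here \<open>E\<close> is an arbitrary spectral measure of the multiplication operator.  The definition of
  \<open>spectral_measure\<close> only speaks of quadratic forms, so the facts that \<open>E\<close> commutes with the
  operator and bounds it on spectral subspaces have to be recovered by polarization.\<close>

context
  fixes W :: "'n::finite l2 \<Rightarrow> 'n l2" and g :: "real^'n \<Rightarrow> real" and E
  assumes W: "unitary_op W" and g [measurable]: "g \<in> borel_measurable borel"
    and S: "spectral_measure (mult_graph W g) E"
begin

private lemma E: "projection_valued_measure E"
  using S by (simp add: spectral_measure_def)

private lemma dom: "(\<exists>v. (u, v) \<in> mult_graph W g) \<longleftrightarrow> integrable (scalar_measure E u) (\<lambda>t. t\<^sup>2)"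
  using S unfolding spectral_measure_def by blast

private lemma form: "(u, v) \<in> mult_graph W g \<Longrightarrow> cinner u v = of_real (LINT t|scalar_measure E u. t)"
  using S unfolding spectral_measure_def by blast

private lemma integrable_id:
  assumes "(u, v) \<in> mult_graph W g"
  shows "integrable (scalar_measure E u) (\<lambda>t. t)"
proof -
  interpret finite_measure "scalar_measure E u" by (rule pvm_finite_measure[OF E])
  have [measurable_cong]: "sets (scalar_measure E u) = sets borel" by (rule pvm_scalar[OF E])
  have "integrable (scalar_measure E u) (\<lambda>t. t\<^sup>2)" using assms dom by blast
  then have "integrable (scalar_measure E u) (\<lambda>t. 1 + t\<^sup>2)"
    by (intro Bochner_Integration.integrable_add) auto
  then show ?thesis
  proof (rule Bochner_Integration.integrable_bound)
    have "\<bar>t\<bar> \<le> 1 + t\<^sup>2" for t :: real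
      using zero_le_power2[of "\<bar>t\<bar> - 1"] unfolding power2_diff by (simp add: algebra_simps)
    then show "AE t in scalar_measure E u. norm t \<le> norm (1 + t\<^sup>2)" by simp
  qed measurable
qed

private lemma domain_of_bounded:
  assumes A: "A \<in> sets borel" "A \<subseteq> {lo..hi}" and f: "E A f = f"
  obtains w where "(f, w) \<in> mult_graph W g"
proof -
  have "integrable (scalar_measure E f) (\<lambda>t. t\<^sup>2)"
  proof (rule integrable_bounded_support[OF E A(1) f])
    fix t assume "t \<in> A"
    then have "\<bar>t\<bar> \<le> \<bar>lo\<bar> + \<bar>hi\<bar>" using A(2) by force
    then show "\<bar>t\<^sup>2\<bar> \<le> (\<bar>lo\<bar> + \<bar>hi\<bar>)\<^sup>2" by (metis abs_ge_zero abs_power2 power2_abs power_mono)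
  qed measurable
  then show thesis using dom that by blast
qed

text \<open>A partition of the line into countably many bounded sets; it decomposes every vector into vectors
  of the domain.\<close>

private definition slab :: "nat \<Rightarrow> real set" where "slab m = {t. nat \<lfloor>\<bar>t\<bar>\<rfloor> = m}"

private lemma slab: "slab m \<in> sets borel" "slab m \<subseteq> {- (real m + 1)..real m + 1}"
  "disjoint_family slab" "(\<Union>m. slab m) = UNIV"
proof -
  show "slab m \<in> sets borel" unfolding slab_def by measurable
  show "slab m \<subseteq> {- (real m + 1)..real m + 1}"
  proof
    fix t assume "t \<in> slab m"
    then have "real m = of_int \<lfloor>\<bar>t\<bar>\<rfloor>" by (auto simp: slab_def)
    then have "\<bar>t\<bar> \<le> real m + 1" by linarith
    then show "t \<in> {- (real m + 1)..real m + 1}" by auto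
  qed
  show "disjoint_family slab" by (auto simp: slab_def disjoint_family_on_def)
  show "(\<Union>m. slab m) = UNIV" by (auto simp: slab_def)
qed

private lemma slab_sums: "(\<lambda>m. E (slab m) f) sums f"
proof -
  have "(\<lambda>m. E (slab m) f) sums E (\<Union>m. slab m) f"
    using slab by (intro pvm_sums[OF E]) auto
  then show ?thesis by (simp add: slab pvm_UNIV[OF E])
qed

text \<open>The quadratic form is additive on \<open>f + h\<close>, because the scalar measure of \<open>f + h\<close> splits into its
  restrictions to \<open>A\<close> and to the complement.  Hence the mixed terms cancel; replacing \<open>h\<close> by \<open>\<i> h\<close>
  catches the imaginary part.\<close>

private lemma off_diagonal_zero:
  assumes A: "A \<in> sets borel" and f: "E A f = f" "(f, w) \<in> mult_graph W g"
    and h: "E A h = 0" "(h, k) \<in> mult_graph W g"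
  shows "cinner h w = 0"
proof -
  have key: "Re (cinner h w) = 0" if h: "E A h = 0" "(h, k) \<in> mult_graph W g" for h k
  proof -
    have gr: "(f + h, w + k) \<in> mult_graph W g" by (rule mult_graph_add[OF W f(2) h(2)])
    have EA: "E A (f + h) = f" by (simp add: pvm_projection[OF E A] f h)
    have EAc: "E (- A) (f + h) = h" using pvm_compl[OF E A, of "f + h"] EA by simp
    have Ac: "- A \<in> sets borel" using A by simp
    have [measurable_cong]: "sets (scalar_measure E (f + h)) = sets borel" by (rule pvm_scalar[OF E])
    have restrict: "(LINT t|scalar_measure E (E B (f + h)). t) = (LINT t|scalar_measure E (f + h). indicator B t * t)"
      if "B \<in> sets borel" for B
      unfolding scalar_measure_restrict[OF E that]
      by (subst integral_density) (use that in auto)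
    have ii: "integrable (scalar_measure E (f + h)) (\<lambda>t. indicator B t * t)" if "B \<in> sets borel" for B
      by (rule Bochner_Integration.integrable_bound[OF integrable_id[OF gr]])
        (use that in \<open>auto split: split_indicator\<close>)
    have "(LINT t|scalar_measure E (f + h). t)
       = (LINT t|scalar_measure E (f + h). indicator A t * t + indicator (- A) t * t)"
      by (rule Bochner_Integration.integral_cong) (auto split: split_indicator)
    also have "\<dots> = (LINT t|scalar_measure E f. t) + (LINT t|scalar_measure E h. t)"
      using restrict[OF A] restrict[OF Ac] EA EAc ii[OF A] ii[OF Ac] by simp
    finally have "cinner (f + h) (w + k) = cinner f w + cinner h k"
      using form[OF gr] form[OF f(2)] form[OF h(2)] by simp
    then have "cinner f k + cinner h w = 0" by (simp add: cinner_add_left cinner_add_right algebra_simps)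
    moreover have "cinner f k = cnj (cinner h w)"
      using mult_graph_symmetric[OF W f(2) h(2)] cinner_commute[of w h] by simp
    ultimately have "Re (cnj (cinner h w) + cinner h w) = 0" by simp
    then show ?thesis by simp
  qed
  show ?thesis
  proof (rule complex_eqI)
    show "Re (cinner h w) = Re 0" using key[OF h] by simp
    have "E A (\<i> *\<^sub>C h) = 0" by (simp add: pvm_projection[OF E A] h)
    from key[OF this mult_graph_scaleC[OF W h(2)]]
    show "Im (cinner h w) = Im 0" by simp
  qed
qed

private lemma invariant:
  assumes A: "A \<in> sets borel" and f: "E A f = f" "(f, w) \<in> mult_graph W g"
  shows "E A w = w"
proof -
  define x where "x = w - E A w"
  have Ax: "E A x = 0" by (simp add: x_def pvm_projection[OF E A])
  have "cinner w (E (slab m) x) = 0" for m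
  proof -
    have "E (slab m) (E (slab m) x) = E (slab m) x" by (rule pvm_projection[OF E slab(1)])
    then obtain k where k: "(E (slab m) x, k) \<in> mult_graph W g"
      using domain_of_bounded[OF slab(1,2)] by blast
    have "E A (E (slab m) x) = E (slab m) (E A x)"
      using A slab(1) by (simp add: pvm_Int[OF E] Int_commute)
    then have "E A (E (slab m) x) = 0" by (simp add: Ax pvm_projection[OF E slab(1)])
    from off_diagonal_zero[OF A f this k] show ?thesis
      using cinner_commute[of "E (slab m) x" w] by simp
  qed
  then have "(\<lambda>m. 0) sums cinner w x"
    using bounded_linear.sums[OF bounded_linear_cinner slab_sums, of w x] by simp
  then have "cinner w x = 0" using sums_unique2 sums_zero by blast
  moreover have "cinner (E A w) x = 0" by (simp add: pvm_projection(2)[OF E A] Ax)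
  ultimately have "cinner x x = 0" by (simp add: x_def cinner_diff_left)
  then have "x = 0" by (simp add: cinner_self)
  then show ?thesis by (simp add: x_def)
qed

private lemma form_bound:
  assumes A: "A \<in> sets borel" "A \<subseteq> {lo..hi}" and u: "E A u = u" "(u, v) \<in> mult_graph W g"
  shows "\<bar>Re (cinner u (v - of_real ((lo + hi) / 2) *\<^sub>C u))\<bar> \<le> (hi - lo) / 2 * (norm u)\<^sup>2"
proof -
  interpret finite_measure "scalar_measure E u" by (rule pvm_finite_measure[OF E])
  let ?m = "(lo + hi) / 2"
  have mass: "measure (scalar_measure E u) UNIV = (norm u)\<^sup>2"
    unfolding measure_def by (simp add: pvm_scalar[OF E] pvm_UNIV[OF E])
  have sp: "space (scalar_measure E u) = UNIV" by (rule pvm_scalar[OF E])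
  have i: "integrable (scalar_measure E u) (\<lambda>t. t)" by (rule integrable_id[OF u(2)])
  have "Re (cinner u (v - of_real ?m *\<^sub>C u)) = (LINT t|scalar_measure E u. t) - ?m * (norm u)\<^sup>2"
    by (simp add: cinner_diff_right form[OF u(2)] cinner_self flip: of_real_power of_real_mult)
  also have "\<dots> = (LINT t|scalar_measure E u. t - ?m)"
    using i mass sp by simp
  also have "\<bar>\<dots>\<bar> \<le> (LINT t|scalar_measure E u. \<bar>t - ?m\<bar>)" by (rule integral_abs_bound)
  also have "\<dots> \<le> (LINT t|scalar_measure E u. (hi - lo) / 2)"
  proof (rule integral_mono_AE)
    show "AE t in scalar_measure E u. \<bar>t - ?m\<bar> \<le> (hi - lo) / 2"
      using AE_scalar_measure[OF E A(1) u(1)]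
    proof eventually_elim
      case (elim t)
      then have "lo \<le> t" "t \<le> hi" using A(2) by auto
      then show ?case by (simp add: abs_le_iff field_simps)
    qed
  next
    show "integrable (scalar_measure E u) (\<lambda>t. \<bar>t - ?m\<bar>)"
      by (intro integrable_abs Bochner_Integration.integrable_diff i) auto
  qed simp
  also have "\<dots> = (hi - lo) / 2 * (norm u)\<^sup>2" using mass sp by simp
  finally show ?thesis .
qed

text \<open>The norm of a symmetric operator is the bound of its quadratic form.  The test vector \<open>h\<close> is
  the image vector \<open>x\<close> rescaled to the norm of \<open>f\<close>, for which polarization and the parallelogram law
  give \<open>norm f * norm x \<le> r * (norm f)\<^sup>2\<close>.\<close>

private lemma norm_bound:
  assumes A: "A \<in> sets borel" "A \<subseteq> {lo..hi}" and f: "E A f = f" "(f, w) \<in> mult_graph W g"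
  shows "norm (w - of_real ((lo + hi) / 2) *\<^sub>C f) \<le> (hi - lo) / 2 * norm f"
proof -
  define m where "m = (lo + hi) / 2"
  define r where "r = (hi - lo) / 2"
  define x where "x = w - of_real m *\<^sub>C f"
  have Aw: "E A w = w" by (rule invariant[OF A(1) f])
  have Ax: "E A x = x" by (simp add: x_def pvm_projection[OF E A(1)] f Aw)
  show ?thesis
  proof (cases "x = 0 \<or> f = 0")
    case True
    have "x = 0" if "f = 0"
    proof -
      have "AE a in lborel. rep_l2 (W w) a = rep_l2 0 a"
        using mult_graphD[OF f(2)] rep_scale[of 0 "0 :: 'n l2"] that
          unitary_scaleC[OF W, of 0 0] by (auto elim: eventually_elim2)
      then have "W w = 0" by (simp add: l2_eq_iff)
      then have "norm w = 0" using unitary_norm[OF W, of w] by simp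
      then show ?thesis by (simp add: x_def that)
    qed
    with True have "x = 0" by blast
    moreover have "0 \<le> r * (norm f)\<^sup>2"
      using form_bound[OF A f] unfolding r_def by (meson abs_ge_zero order_trans)
    then have "0 \<le> r * norm f" by (cases "f = 0") (auto simp: zero_le_mult_iff)
    ultimately show ?thesis by (simp add: x_def m_def r_def)
  next
    case False
    then have pos: "0 < norm x" "0 < norm f" by auto
    define s where "s = norm f / norm x"
    define h where "h = of_real s *\<^sub>C x"
    have nh: "norm h = norm f" using pos by (simp add: h_def s_def norm_scaleC norm_divide)
    have Ah: "E A h = h" by (simp add: h_def pvm_projection[OF E A(1)] Ax)
    obtain k where k: "(h, k) \<in> mult_graph W g" using domain_of_bounded[OF A Ah] by blast
    have p: "Re (cinner (f + h) (w + k - of_real m *\<^sub>C (f + h))) \<le> r * (norm (f + h))\<^sup>2"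
      using form_bound[OF A _ mult_graph_add[OF W f(2) k]] unfolding r_def m_def
      by (simp add: pvm_projection[OF E A(1)] f Ah)
    have q: "- Re (cinner (f - h) (w - k - of_real m *\<^sub>C (f - h))) \<le> r * (norm (f - h))\<^sup>2"
      using form_bound[OF A _ mult_graph_diff[OF W f(2) k]] unfolding r_def m_def
      by (simp add: pvm_projection[OF E A(1)] f Ah abs_le_iff)
    have sym: "cinner f k = cnj (cinner h w)"
      using mult_graph_symmetric[OF W f(2) k] cinner_commute[of w h] by simp
    have fh: "Re (cinner f h) = Re (cinner h f)"
      using cinner_commute[of f h] by simp
    have hx: "cinner h x = of_real (norm f * norm x)"
      using pos by (simp add: h_def s_def cinner_self power2_eq_square)
    have "Re (cinner (f + h) (w + k - of_real m *\<^sub>C (f + h))) - Re (cinner (f - h) (w - k - of_real m *\<^sub>C (f - h)))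
       = 2 * Re (cinner f k) + 2 * Re (cinner h w) - 2 * m * (Re (cinner f h) + Re (cinner h f))"
      by (simp add: cinner_diff_left cinner_diff_right cinner_add_left cinner_add_right algebra_simps)
    also have "\<dots> = 4 * Re (cinner h w - of_real m * cinner h f)"
      using fh by (simp add: sym algebra_simps)
    also have "\<dots> = 4 * Re (cinner h x)" by (simp add: x_def cinner_diff_right)
    finally have "4 * (norm f * norm x) \<le> r * (norm (f + h))\<^sup>2 + r * (norm (f - h))\<^sup>2"
      using p q hx by simp
    also have "\<dots> = 4 * (norm f * (r * norm f))"
    proof -
      have "(norm (f + h))\<^sup>2 + (norm (f - h))\<^sup>2 = 2 * (norm f)\<^sup>2 + 2 * (norm h)\<^sup>2"
        unfolding power2_norm_eq_inner
        by (simp add: inner_add_left inner_add_right inner_diff_left inner_diff_right)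
      then have "(norm (f + h))\<^sup>2 + (norm (f - h))\<^sup>2 = 4 * (norm f)\<^sup>2" by (simp add: nh)
      then show ?thesis unfolding distrib_left[symmetric] by (simp add: power2_eq_square)
    qed
    finally have "norm x \<le> r * norm f" using pos by simp
    then show ?thesis by (simp add: x_def m_def r_def)
  qed
qed

text \<open>Where the symbol is farther than \<open>R > r\<close> from the midpoint \<open>m\<close>, each application of the operator minus
  \<open>m\<close> enlarges the function by the factor \<open>R\<close>, while its norm grows at most by the factor \<open>r\<close>.  After \<open>k\<close>
  steps this leaves at most \<open>(r/R)\<^sup>k\<close> of the function there.\<close>

private lemma localized:
  assumes A: "A \<in> sets borel" "A \<subseteq> {lo..hi}" and lh: "lo \<le> hi" and f: "E A f = f"
  shows "mult_l2 (spectral_symbol g (- {lo..hi})) (W f) = 0"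
proof -
  define m where "m = (lo + hi) / 2"
  define r where "r = (hi - lo) / 2"
  have r0: "0 \<le> r" using lh by (simp add: r_def)
  have far: "mult_l2 (spectral_symbol g {t. R \<le> \<bar>t - m\<bar>}) (W f) = 0" if R: "r < R" for R
  proof -
    define C where "C = {t. R \<le> \<bar>t - m\<bar>}"
    have C: "C \<in> sets borel" unfolding C_def by measurable
    note M = contraction_spectral_symbol[OF g C]
    have pow: "R ^ k * norm (mult_l2 (spectral_symbol g C) (W f)) \<le> r ^ k * norm f" if "E A f = f" for k f
      using that
    proof (induction k arbitrary: f)
      case 0
      then show ?case using norm_mult_l2[OF M, of "W f"] unitary_norm[OF W] by simp
    next
      case (Suc k)
      obtain w where w: "(f, w) \<in> mult_graph W g" using domain_of_bounded[OF A Suc.prems] by blast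
      define x where "x = w - of_real m *\<^sub>C f"
      have Ax: "E A x = x"
        by (simp add: x_def pvm_projection[OF E A(1)] Suc.prems invariant[OF A(1) Suc.prems w])
      have Wx: "W x = W w - of_real m *\<^sub>C W f" by (simp add: x_def unitary_diff[OF W] unitary_scaleC[OF W])
      have "norm (mult_l2 (spectral_symbol g C) (W f)) \<le> (1 / R) * norm (mult_l2 (spectral_symbol g C) (W x))"
      proof (rule norm_mono_AE)
        show "AE a in lborel. cmod (rep_l2 (mult_l2 (spectral_symbol g C) (W f)) a)
            \<le> 1 / R * cmod (rep_l2 (mult_l2 (spectral_symbol g C) (W x)) a)"
          using rep_mult_l2[OF M, of "W f"] rep_mult_l2[OF M, of "W x"] mult_graphD[OF w]
            rep_diff[of "W w" "of_real m *\<^sub>C W f"] rep_scale[of "of_real m" "W f"]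
          unfolding Wx[symmetric]
        proof eventually_elim
          case (elim a)
          have "rep_l2 (W x) a = of_real (g a - m) * rep_l2 (W f) a"
            using elim by (simp add: algebra_simps)
          then have "cmod (rep_l2 (W x) a) = \<bar>g a - m\<bar> * cmod (rep_l2 (W f) a)"
            by (simp only: norm_mult norm_of_real)
          moreover have "R * cmod (rep_l2 (W f) a) \<le> \<bar>g a - m\<bar> * cmod (rep_l2 (W f) a)" if "g a \<in> C"
            using that by (intro mult_right_mono) (auto simp: C_def)
          ultimately have "R * cmod (rep_l2 (W f) a) \<le> cmod (rep_l2 (W x) a)" if "g a \<in> C"
            using that by simp
          then show ?case
            unfolding elim(1) elim(2) norm_mult using R r0
            by (cases "g a \<in> C") (simp_all add: spectral_symbol_def field_simps)
        qed
      qed (use R r0 in simp)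
      then have "R ^ Suc k * norm (mult_l2 (spectral_symbol g C) (W f))
          \<le> R ^ k * norm (mult_l2 (spectral_symbol g C) (W x))"
        using R r0 by (simp add: field_simps)
      also have "\<dots> \<le> r ^ k * norm x" by (rule Suc.IH[OF Ax])
      also have "\<dots> \<le> r ^ k * (r * norm f)"
        using norm_bound[OF A Suc.prems w] r0 by (intro mult_left_mono) (auto simp: x_def m_def r_def)
      finally show ?case by (simp add: mult_ac)
    qed
    have Rp: "0 < R" using R r0 by simp
    have "norm (mult_l2 (spectral_symbol g C) (W f)) \<le> (r / R) ^ k * norm f" for k
      using pow[OF f, of k] Rp by (simp add: field_simps power_divide)
    moreover have "(\<lambda>k. (r / R) ^ k * norm f) \<longlonglongrightarrow> 0 * norm f"
      using R Rp r0 by (intro tendsto_mult tendsto_const LIMSEQ_realpow_zero) auto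
    ultimately have "norm (mult_l2 (spectral_symbol g C) (W f)) \<le> 0"
      by (intro LIMSEQ_le_const[of "\<lambda>k. (r / R) ^ k * norm f" 0]) auto
    then show ?thesis by (simp add: C_def)
  qed
  have Rn: "r < r + 1 / (real n + 1)" for n by simp
  have meas: "{t. r + 1 / (real n + 1) \<le> \<bar>t - m\<bar>} \<in> sets borel" for n by measurable
  have "AE a in lborel. rep_l2 0 a = spectral_symbol g {t. r + 1 / (real n + 1) \<le> \<bar>t - m\<bar>} a * rep_l2 (W f) a" for n
    using rep_mult_l2[OF contraction_spectral_symbol[OF g meas[of n]], of "W f"] far[OF Rn[of n]] by simp
  then have "AE a in lborel. \<forall>n. rep_l2 0 a = spectral_symbol g {t. r + 1 / (real n + 1) \<le> \<bar>t - m\<bar>} a * rep_l2 (W f) a"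
    by (simp add: AE_all_countable)
  moreover have "AE a in lborel. rep_l2 (0 :: 'n l2) a = 0"
    using rep_scale[of 0 "0 :: 'n l2"] by simp
  ultimately have "AE a in lborel. rep_l2 0 a = spectral_symbol g (- {lo..hi}) a * rep_l2 (W f) a"
  proof eventually_elim
    case (elim a)
    show ?case
    proof (cases "g a \<in> {lo..hi}")
      case False
      then have "0 < \<bar>g a - m\<bar> - r" by (auto simp: m_def r_def abs_if field_simps)
      then obtain n where "inverse (real (Suc n)) < \<bar>g a - m\<bar> - r" using reals_Archimedean by blast
      then have "r + 1 / (real n + 1) \<le> \<bar>g a - m\<bar>" by (simp add: inverse_eq_divide add.commute)
      with elim have "rep_l2 (W f) a = 0" by (auto simp: spectral_symbol_def dest: spec[of _ n])
      with elim(2) show ?thesis by simp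
    qed (use elim(2) in \<open>simp add: spectral_symbol_def\<close>)
  qed
  then show ?thesis by (intro mult_l2_eqI contraction_spectral_symbol g) auto
qed

text \<open>Unbounded sets are exhausted by the slabs, on each of which \<open>localized\<close> applies.\<close>

private lemma localized_half_line:
  assumes J: "J \<in> sets borel" and T: "T \<in> sets borel"
    and ex: "\<And>m. \<exists>lo hi. lo \<le> hi \<and> J \<inter> slab m \<subseteq> {lo..hi} \<and> {lo..hi} \<subseteq> T"
    and f: "E J f = f"
  shows "mult_l2 (spectral_symbol g T) (W f) = W f"
proof -
  have "mult_l2 (spectral_symbol g T) (W (E (slab m) f)) = W (E (slab m) f)" for m
  proof -
    obtain lo hi where lh: "lo \<le> hi" "J \<inter> slab m \<subseteq> {lo..hi}" "{lo..hi} \<subseteq> T" using ex by blast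
    have "E (J \<inter> slab m) (E (slab m) f) = E (slab m) (E J f)"
      using J slab(1) by (simp add: pvm_Int[OF E] Int_ac)
    then have "E (J \<inter> slab m) (E (slab m) f) = E (slab m) f" by (simp add: f)
    from localized[OF _ lh(2,1) this]
    have z: "mult_l2 (spectral_symbol g (- {lo..hi})) (W (E (slab m) f)) = 0" using J slab(1) by simp
    let ?F = "W (E (slab m) f)"
    have "AE a in lborel. rep_l2 (0 :: 'n l2) a = 0"
      using rep_scale[of 0 "0 :: 'n l2"] by simp
    moreover have "AE a in lborel. rep_l2 0 a = spectral_symbol g (- {lo..hi}) a * rep_l2 ?F a"
      using rep_mult_l2[OF contraction_spectral_symbol[OF g, of "- {lo..hi}"], of ?F] z by simp
    ultimately have "AE a in lborel. rep_l2 ?F a = spectral_symbol g T a * rep_l2 ?F a"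
    proof eventually_elim
      case (elim a)
      then show ?case using lh(3) by (auto simp: spectral_symbol_def split: split_indicator_asm split_indicator)
    qed
    then show ?thesis by (rule mult_l2_eqI[OF contraction_spectral_symbol[OF g T]])
  qed
  then have "(\<lambda>m. W (E (slab m) f)) sums mult_l2 (spectral_symbol g T) (W f)"
    using bounded_linear.sums[OF bounded_linear_mult_l2[OF contraction_spectral_symbol[OF g T]]
        bounded_linear.sums[OF unitary_bounded_linear[OF W] slab_sums[of f]]] by simp
  moreover have "(\<lambda>m. W (E (slab m) f)) sums W f"
    by (rule bounded_linear.sums[OF unitary_bounded_linear[OF W] slab_sums])
  ultimately show ?thesis by (rule sums_unique2)
qed

private lemma localized_atMost:
  assumes "E {..c} f = f"
  shows "mult_l2 (spectral_symbol g {..c}) (W f) = W f"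
proof (rule localized_half_line[OF _ _ _ assms])
  fix m
  show "\<exists>lo hi. lo \<le> hi \<and> {..c} \<inter> slab m \<subseteq> {lo..hi} \<and> {lo..hi} \<subseteq> {..c}"
  proof (intro exI conjI)
    show "min (- (real m + 1)) c \<le> c" by simp
    show "{..c} \<inter> slab m \<subseteq> {min (- (real m + 1)) c..c}"
      using slab(2)[of m] by (auto simp: min_le_iff_disj)
  qed auto
qed auto

private lemma localized_greaterThan:
  assumes "E {c<..} f = f"
  shows "mult_l2 (spectral_symbol g {c..}) (W f) = W f"
proof (rule localized_half_line[OF _ _ _ assms])
  fix m
  show "\<exists>lo hi. lo \<le> hi \<and> {c<..} \<inter> slab m \<subseteq> {lo..hi} \<and> {lo..hi} \<subseteq> {c..}"
  proof (intro exI conjI)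
    show "c \<le> max (real m + 1) c" by simp
    show "{c<..} \<inter> slab m \<subseteq> {c..max (real m + 1) c}"
      using slab(2)[of m] by (auto simp: le_max_iff_disj)
  qed auto
qed auto

text \<open>It suffices to compare distribution functions.  As \<open>localized_greaterThan\<close> yields a closed half line,
  an atom at \<open>c\<close> could be attributed to either side.  Therefore the distribution function of
  \<open>spectral_weight\<close> at \<open>c\<close> is squeezed between the one of \<open>E\<close> at \<open>c\<close> and at \<open>d > c\<close>, and right
  continuity closes the gap.\<close>

theorem scalar_measure_unique: "scalar_measure E f = spectral_weight W g f"
proof -
  interpret M: finite_borel_measure "scalar_measure E f"
    by (intro finite_borel_measure.intro finite_borel_measure_axioms.intro
        pvm_finite_measure[OF E] pvm_scalar(1)[OF E])
  interpret N: finite_borel_measure "spectral_weight W g f"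
    by (intro finite_borel_measure.intro finite_borel_measure_axioms.intro
        finite_measure_spectral_weight[OF g] sets_spectral_weight)
  define Q where "Q c h = mult_l2 (spectral_symbol g {..c}) (W h)" for c h
  have M1: "measure (scalar_measure E f) {..c} = (norm (E {..c} f))\<^sup>2" for c
    by (rule measure_eq_emeasure_eq_ennreal) (simp_all add: pvm_scalar(3)[OF E])
  have N1: "measure (spectral_weight W g f) {..c} = (norm (Q c f))\<^sup>2" for c
    unfolding Q_def by (rule measure_eq_emeasure_eq_ennreal) (simp_all add: emeasure_spectral_weight)
  define f1 where "f1 c = E {..c} f" for c
  define f2 where "f2 c = E (- {..c}) f" for c
  have f12: "f = f1 c + f2 c" for c using pvm_compl[OF E, of "{..c}" f] by (simp add: f1_def f2_def)
  have f1: "E {..c} (f1 c) = f1 c" for c by (simp add: f1_def pvm_projection[OF E])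
  have f2: "E {c<..} (f2 c) = f2 c" for c
  proof -
    have "- {..c} = {c<..}" by auto
    then show ?thesis by (simp add: f2_def pvm_projection[OF E])
  qed
  have sm: "contraction_symbol (spectral_symbol g {..c})" for c
    by (rule contraction_spectral_symbol[OF g]) simp
  have Qadd: "Q c (h + k) = Q c h + Q c k" for c h k
    by (simp add: Q_def unitary_add[OF W] mult_l2_add[OF sm])
  have Q1: "Q c (f1 c) = W (f1 c)" for c unfolding Q_def by (rule localized_atMost[OF f1])
  have lower: "(norm (E {..c} f))\<^sup>2 \<le> (norm (Q c f))\<^sup>2" for c
  proof -
    have "cinner (W (f1 c)) (Q c (f2 c)) = cinner (Q c (f1 c)) (W (f2 c))"
      unfolding Q_def cinner_mult_l2[OF sm] 
      unfolding cinner_commute[of "mult_l2 (spectral_symbol g {..c}) (W (f1 c))"] cinner_mult_l2[OF sm]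
        Bochner_Integration.integral_cnj[symmetric]
      by (rule Bochner_Integration.integral_cong)
        (auto simp: spectral_symbol_def mult_ac split: split_indicator)
    also have "\<dots> = cinner (f1 c) (f2 c)" by (simp add: Q1 unitary_cinner[OF W])
    also have "\<dots> = cinner f (E {..c} (E (- {..c}) f))"
      unfolding f1_def f2_def by (rule pvm_projection[OF E]) simp
    also have "\<dots> = 0"
      using pvm_Int[OF E, of "{..c}" "- {..c}" f] by (simp add: pvm_empty[OF E] del: Compl_atMost)
    finally have o: "inner (W (f1 c)) (Q c (f2 c)) = 0" by (simp flip: Re_cinner)
    have "Q c f = W (f1 c) + Q c (f2 c)" using Qadd[of c "f1 c" "f2 c"] by (simp add: Q1 flip: f12)
    then have "(norm (Q c f))\<^sup>2 = (norm (W (f1 c)))\<^sup>2 + (norm (Q c (f2 c)))\<^sup>2"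
      using o by (simp add: power2_norm_eq_inner inner_add_left inner_add_right inner_commute)
    then show ?thesis by (simp add: unitary_norm[OF W] f1_def)
  qed
  have upper: "(norm (Q c f))\<^sup>2 \<le> (norm (E {..d} f))\<^sup>2" if "c < d" for c d
  proof -
    have sd: "contraction_symbol (spectral_symbol g {d..})"
      by (rule contraction_spectral_symbol[OF g]) simp
    have "Q c (f2 d) = mult_l2 (spectral_symbol g {..c}) (mult_l2 (spectral_symbol g {d..}) (W (f2 d)))"
      by (simp add: Q_def localized_greaterThan[OF f2])
    also have "\<dots> = mult_l2 (\<lambda>a. 0) (W (f2 d))"
      unfolding mult_l2_mult_l2[OF sm sd] using that
      by (intro arg_cong2[where f = mult_l2] ext) (auto simp: spectral_symbol_def split: split_indicator)
    also have "\<dots> = 0" by (simp add: mult_l2_def abs_l2_zero)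
    finally have "Q c f = Q c (f1 d)" using Qadd[of c "f1 d" "f2 d"] by (simp flip: f12)
    then have "norm (Q c f) \<le> norm (f1 d)"
      using norm_mult_l2[OF sm, of c "W (f1 d)"] by (simp add: Q_def unitary_norm[OF W])
    then show ?thesis by (simp add: f1_def power_mono)
  qed
  have "measure (spectral_weight W g f) {..c} = measure (scalar_measure E f) {..c}" for c
  proof (rule antisym)
    have "((\<lambda>d. cdf (scalar_measure E f) d) \<longlongrightarrow> cdf (scalar_measure E f) c) (at_right c)"
      using M.cdf_is_right_cont[of c] by (simp add: continuous_within)
    moreover have "\<forall>\<^sub>F d in at_right c. (norm (Q c f))\<^sup>2 \<le> cdf (scalar_measure E f) d"
      unfolding cdf_def M1 using upper by (auto simp: eventually_at_right_less intro: eventually_at_right_less[THEN eventually_mono])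
    ultimately have "(norm (Q c f))\<^sup>2 \<le> cdf (scalar_measure E f) c"
      by (intro tendsto_lowerbound[where F = "at_right c"]) auto
    then show "measure (spectral_weight W g f) {..c} \<le> measure (scalar_measure E f) {..c}"
      by (simp add: N1 cdf_def)
  qed (use lower in \<open>simp add: M1 N1\<close>)
  then have "cdf (scalar_measure E f) = cdf (spectral_weight W g f)" by (auto simp: cdf_def)
  then show ?thesis by (intro cdf_unique' M.finite_borel_measure_axioms N.finite_borel_measure_axioms)
qed

end

section \<open>Self-adjointness and functional calculus of multiplication operators\<close>

lemma cinner_mult_l2_swap:
  assumes m: "contraction_symbol m" and r: "\<And>a. cnj (m a) = m a"
  shows "cinner (mult_l2 m f) h = cinner f (mult_l2 m h)"
proof -
  have "cinner (mult_l2 m f) h = cnj (cinner h (mult_l2 m f))" by (rule cinner_commute)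
  also have "\<dots> = cinner f (mult_l2 m h)"
    unfolding cinner_mult_l2[OF m] Bochner_Integration.integral_cnj[symmetric]
    by (rule Bochner_Integration.integral_cong) (simp_all add: r mult_ac)
  finally show ?thesis .
qed

context
  fixes W :: "'n::finite l2 \<Rightarrow> 'n l2" and g :: "real^'n \<Rightarrow> real"
  assumes W: "unitary_op W" and g [measurable]: "g \<in> borel_measurable borel"
begin

private lemma sym: "B \<in> sets borel \<Longrightarrow> contraction_symbol (spectral_symbol g B)"
  by (rule contraction_spectral_symbol[OF g])

private lemma W_pvm: "W (mult_pvm W g B f) = mult_l2 (spectral_symbol g B) (W f)"
  by (simp add: mult_pvm_def unitary_inv_right[OF W])

private lemma pvm_eqI: "W x = W y \<Longrightarrow> x = y"
  using unitary_bij[OF W] by (meson bij_is_inj injD)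

private lemma norm_pvm:
  assumes "B \<in> sets borel"
  shows "(norm (mult_pvm W g B f))\<^sup>2 = measure (spectral_weight W g f) B"
    "emeasure (spectral_weight W g f) B = ennreal ((norm (mult_pvm W g B f))\<^sup>2)"
proof -
  have n: "norm (mult_pvm W g B f) = norm (mult_l2 (spectral_symbol g B) (W f))"
    unfolding mult_pvm_def by (rule unitary_norm[OF unitary_inv[OF W]])
  show "emeasure (spectral_weight W g f) B = ennreal ((norm (mult_pvm W g B f))\<^sup>2)"
    unfolding n by (rule emeasure_spectral_weight[OF g assms])
  then show "(norm (mult_pvm W g B f))\<^sup>2 = measure (spectral_weight W g f) B"
    by (intro measure_eq_emeasure_eq_ennreal[symmetric]) simp_all
qed

private lemma pvm_Un:
  assumes B: "B \<in> sets borel" "C \<in> sets borel" "B \<inter> C = {}"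
  shows "mult_pvm W g (B \<union> C) f = mult_pvm W g B f + mult_pvm W g C f"
proof (rule pvm_eqI)
  have BC: "B \<union> C \<in> sets borel" using B by simp
  have "AE a in lborel. rep_l2 (mult_l2 (spectral_symbol g B) (W f) + mult_l2 (spectral_symbol g C) (W f)) a
      = spectral_symbol g (B \<union> C) a * rep_l2 (W f) a"
    using rep_mult_l2[OF sym[OF B(1)], of "W f"] rep_mult_l2[OF sym[OF B(2)], of "W f"]
      rep_add[of "mult_l2 (spectral_symbol g B) (W f)" "mult_l2 (spectral_symbol g C) (W f)"]
  proof eventually_elim
    case (elim a)
    show ?case unfolding elim using B(3)
      by (auto simp: spectral_symbol_def split: split_indicator)
  qed
  from mult_l2_eqI[OF sym[OF BC] this]
  show "W (mult_pvm W g (B \<union> C) f) = W (mult_pvm W g B f + mult_pvm W g C f)"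
    by (simp add: W_pvm unitary_add[OF W])
qed

lemma projection_valued_mult_pvm: "projection_valued_measure (mult_pvm W g)"
  unfolding projection_valued_measure_def
proof (intro conjI ballI allI impI)
  fix B :: "real set" assume B: "B \<in> sets borel"
  have idem: "mult_pvm W g B (mult_pvm W g C f) = mult_pvm W g (B \<inter> C) f" if "C \<in> sets borel" for C f
  proof (rule pvm_eqI)
    have "(\<lambda>a. spectral_symbol g B a * spectral_symbol g C a) = spectral_symbol g (B \<inter> C)"
      by (auto simp: spectral_symbol_def fun_eq_iff split: split_indicator)
    then show "W (mult_pvm W g B (mult_pvm W g C f)) = W (mult_pvm W g (B \<inter> C) f)"
      using mult_l2_mult_l2[OF sym[OF B] sym[OF that], of "W f"] by (simp add: W_pvm)
  qed
  show "mult_pvm W g (B \<inter> C) = mult_pvm W g B \<circ> mult_pvm W g C" if "C \<in> sets borel" for C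
    using idem[OF that] by (auto simp: fun_eq_iff)
  have "bounded_linear (\<lambda>f. inv W (mult_l2 (spectral_symbol g B) (W f)))"
    by (rule bounded_linear_compose[OF unitary_bounded_linear[OF unitary_inv[OF W]]
          bounded_linear_compose[OF bounded_linear_mult_l2[OF sym[OF B]] unitary_bounded_linear[OF W]]])
  then have bl: "bounded_linear (mult_pvm W g B)" by (simp add: mult_pvm_def[abs_def])
  have sc: "mult_pvm W g B (c *\<^sub>C f) = c *\<^sub>C mult_pvm W g B f" for c f
    by (simp add: mult_pvm_def unitary_scaleC[OF W] mult_l2_scaleC[OF sym[OF B]] unitary_scaleC[OF unitary_inv[OF W]])
  have sa: "cinner (mult_pvm W g B f) h = cinner f (mult_pvm W g B h)" for f h
  proof -
    have "cinner (W (mult_pvm W g B f)) (W h) = cinner (W f) (W (mult_pvm W g B h))"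
      unfolding W_pvm by (rule cinner_mult_l2_swap[OF sym[OF B]]) (simp add: spectral_symbol_def split: split_indicator)
    then show ?thesis by (simp add: unitary_cinner[OF W])
  qed
  show "orthogonal_projection (mult_pvm W g B)"
    unfolding orthogonal_projection_def bounded_clinear_def
    using bl sc sa idem[OF B] by (auto simp: fun_eq_iff)
next
  show "mult_pvm W g {} = (\<lambda>f. 0)"
  proof (rule ext, rule pvm_eqI)
    fix f
    have "W (mult_pvm W g {} f) = 0"
      unfolding W_pvm by (simp add: mult_l2_def spectral_symbol_def abs_l2_zero)
    then show "W (mult_pvm W g {} f) = W 0" using unitary_scaleC[OF W, of 0 0] by simp
  qed
  show "mult_pvm W g UNIV = id"
    by (rule ext, rule pvm_eqI) (simp add: W_pvm spectral_symbol_def mult_l2_one)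
next
  fix B :: "nat \<Rightarrow> real set" and f
  assume B: "range B \<subseteq> sets borel" "disjoint_family B"
  define R where "R N = (\<Union>m\<in>{N..}. B m)" for N
  have Rm: "R N \<in> sets borel" for N unfolding R_def using B(1) by auto
  have R_Suc: "R N = B N \<union> R (Suc N)" "B N \<inter> R (Suc N) = {}" for N
  proof -
    have "{N..} = insert N {Suc N..}" by auto
    then show "R N = B N \<union> R (Suc N)" by (simp add: R_def)
    have "B N \<inter> B m = {}" if "m \<ge> Suc N" for m
      using B(2) that by (auto simp: disjoint_family_on_def)
    then show "B N \<inter> R (Suc N) = {}" by (auto simp: R_def)
  qed
  have split: "mult_pvm W g (\<Union>m. B m) f = (\<Sum>m<N. mult_pvm W g (B m) f) + mult_pvm W g (R N) f" for N
  proof (induction N)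
    case 0
    then show ?case by (simp add: R_def)
  next
    case (Suc N)
    have "mult_pvm W g (R N) f = mult_pvm W g (B N) f + mult_pvm W g (R (Suc N)) f"
      using pvm_Un[OF _ Rm R_Suc(2), of N f] B(1) R_Suc(1)[of N] by auto
    then show ?case using Suc by (simp add: add.assoc)
  qed
  interpret finite_measure "spectral_weight W g f" by (rule finite_measure_spectral_weight[OF g])
  have "(\<lambda>N. measure (spectral_weight W g f) (R N)) \<longlonglongrightarrow> measure (spectral_weight W g f) (\<Inter>N. R N)"
  proof (rule finite_Lim_measure_decseq)
    show "range R \<subseteq> sets (spectral_weight W g f)" using Rm by auto
    show "decseq R" unfolding R_def by (intro decseq_SucI UN_mono) auto
  qed
  moreover have "(\<Inter>N. R N) = {}"
  proof -
    have "x \<notin> (\<Inter>N. R N)" for x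
    proof
      assume x: "x \<in> (\<Inter>N. R N)"
      then obtain m where m: "x \<in> B m" by (auto simp: R_def)
      from x have "x \<in> R (Suc m)" by blast
      with m R_Suc(2)[of m] show False by blast
    qed
    then show ?thesis by blast
  qed
  ultimately have "(\<lambda>N. (norm (mult_pvm W g (R N) f))\<^sup>2) \<longlonglongrightarrow> 0"
    by (simp add: norm_pvm(1)[OF Rm])
  then have "(\<lambda>N. sqrt ((norm (mult_pvm W g (R N) f))\<^sup>2)) \<longlonglongrightarrow> sqrt 0" by (rule tendsto_real_sqrt)
  then have "(\<lambda>N. mult_pvm W g (R N) f) \<longlonglongrightarrow> 0" by (simp add: tendsto_norm_zero_iff)
  then have "(\<lambda>N. mult_pvm W g (\<Union>m. B m) f - mult_pvm W g (R N) f) \<longlonglongrightarrow> mult_pvm W g (\<Union>m. B m) f - 0"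
    by (intro tendsto_diff tendsto_const)
  moreover have "mult_pvm W g (\<Union>m. B m) f - mult_pvm W g (R N) f = (\<Sum>m<N. mult_pvm W g (B m) f)" for N
    using split[of N] by simp
  ultimately show "(\<lambda>m. mult_pvm W g (B m) f) sums mult_pvm W g (\<Union>m. B m) f"
    by (simp add: sums_def)
qed

lemma scalar_measure_mult_pvm: "scalar_measure (mult_pvm W g) f = spectral_weight W g f"
proof (rule measure_eqI)
  fix B assume "B \<in> sets (scalar_measure (mult_pvm W g) f)"
  then have "B \<in> sets borel" by (simp add: pvm_scalar(1)[OF projection_valued_mult_pvm])
  then show "emeasure (scalar_measure (mult_pvm W g) f) B = emeasure (spectral_weight W g f) B"
    by (simp add: pvm_scalar(3)[OF projection_valued_mult_pvm] norm_pvm(2))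
qed (simp add: pvm_scalar(1)[OF projection_valued_mult_pvm])

private lemma weight_measurable [measurable]: "(\<lambda>a. (cmod (rep_l2 f a))\<^sup>2) \<in> borel_measurable borel"
  using borel_measurable_integrable[OF integrable_rep[of f]] by simp

private lemma integrable_weight:
  fixes \<phi> :: "real \<Rightarrow> 'b::{banach, second_countable_topology}"
  assumes [measurable]: "\<phi> \<in> borel_measurable borel"
  shows "integrable (spectral_weight W g f) \<phi>
      \<longleftrightarrow> integrable lborel (\<lambda>a. (cmod (rep_l2 (W f) a))\<^sup>2 *\<^sub>R \<phi> (g a))"
  unfolding spectral_weight_def
  by (subst integrable_distr_eq; (subst integrable_density)?) auto

private lemma integral_weight:
  fixes \<phi> :: "real \<Rightarrow> 'b::{banach, second_countable_topology}"
  assumes [measurable]: "\<phi> \<in> borel_measurable borel"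
  shows "(LINT t|spectral_weight W g f. \<phi> t)
      = (LINT a|lborel. (cmod (rep_l2 (W f) a))\<^sup>2 *\<^sub>R \<phi> (g a))"
  unfolding spectral_weight_def
  by (subst integral_distr; (subst integral_density)?) auto

private lemma domain_iff:
  "(\<exists>v. (u, v) \<in> mult_graph W g) \<longleftrightarrow> integrable (spectral_weight W g u) (\<lambda>t. t\<^sup>2)"
proof -
  have [measurable]: "rep_l2 (W u) \<in> borel_measurable borel" using measurable_rep_l2[of "W u"] by simp
  have eq: "(cmod (rep_l2 (W u) a))\<^sup>2 *\<^sub>R (g a)\<^sup>2 = (cmod (of_real (g a) * rep_l2 (W u) a))\<^sup>2" for a
    by (simp add: norm_mult power_mult_distrib mult.commute)
  have "integrable (spectral_weight W g u) (\<lambda>t. t\<^sup>2) \<longleftrightarrow> sq_integrable (\<lambda>a. of_real (g a) * rep_l2 (W u) a)"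
  proof -
    have "integrable (spectral_weight W g u) (\<lambda>t. t\<^sup>2)
        \<longleftrightarrow> integrable lborel (\<lambda>a. (cmod (rep_l2 (W u) a))\<^sup>2 *\<^sub>R (g a)\<^sup>2)"
      by (rule integrable_weight) measurable
    moreover have "(\<lambda>a. of_real (g a) * rep_l2 (W u) a) \<in> borel_measurable lborel" by measurable
    ultimately show ?thesis unfolding eq sq_integrable_def by blast
  qed
  also have "\<dots> \<longleftrightarrow> (\<exists>v. (u, v) \<in> mult_graph W g)"
  proof
    assume sq: "sq_integrable (\<lambda>a. of_real (g a) * rep_l2 (W u) a)"
    have "(u, inv W (abs_l2 (\<lambda>a. of_real (g a) * rep_l2 (W u) a))) \<in> mult_graph W g"
      using rep_abs_l2[OF sq] by (simp add: mult_graph_def unitary_inv_right[OF W])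
    then show "\<exists>v. (u, v) \<in> mult_graph W g" by blast
  next
    assume "\<exists>v. (u, v) \<in> mult_graph W g"
    then obtain v where v: "AE a in lborel. rep_l2 (W v) a = of_real (g a) * rep_l2 (W u) a"
      by (auto simp: mult_graph_def)
    show "sq_integrable (\<lambda>a. of_real (g a) * rep_l2 (W u) a)"
      by (rule sq_integrable_dominated[OF sq_integrable_rep[of "W v"]]) (use v in auto)
  qed
  finally show ?thesis by blast
qed

lemma spectral_measure_mult_pvm: "spectral_measure (mult_graph W g) (mult_pvm W g)"
  unfolding spectral_measure_def scalar_measure_mult_pvm
proof (intro conjI)
  show "Domain (mult_graph W g) = {f. integrable (spectral_weight W g f) (\<lambda>t. t\<^sup>2)}"
    unfolding domain_iff[symmetric] by blast
  show "\<forall>(f, v)\<in>mult_graph W g. cinner f v = of_real (LINT t|spectral_weight W g f. t)"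
  proof safe
    fix f v assume gr: "(f, v) \<in> mult_graph W g"
    have "cinner f v = cinner (W f) (W v)" by (simp add: unitary_cinner[OF W])
    also have "\<dots> = (CLINT a|lborel. of_real ((cmod (rep_l2 (W f) a))\<^sup>2 *\<^sub>R g a))"
      unfolding cinner_rep
    proof (rule integral_cong_AE)
      show "AE a in lborel. cnj (rep_l2 (W f) a) * rep_l2 (W v) a = of_real ((cmod (rep_l2 (W f) a))\<^sup>2 *\<^sub>R g a)"
        using mult_graphD[OF gr] by eventually_elim (simp add: complex_norm_square mult_ac del: of_real_power)
    qed (auto intro!: borel_measurable_cnj_mult[where M = lborel, simplified] measurable_rep_l2[simplified])
    also have "\<dots> = of_real (LINT t|spectral_weight W g f. t)"
    proof -
      have "(LINT t|spectral_weight W g f. t) = (LINT a|lborel. (cmod (rep_l2 (W f) a))\<^sup>2 *\<^sub>R g a)"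
        by (rule integral_weight) simp
      then show ?thesis by (simp only: integral_complex_of_real)
    qed
    finally show "cinner f v = of_real (LINT t|spectral_weight W g f. t)" .
  qed
qed (rule projection_valued_mult_pvm)

text \<open>The truncated multipliers \<open>k n\<close> cut off the region where \<open>g\<close> is large; dividing by \<open>n + 1\<close> makes both
  \<open>k n\<close> and \<open>g * k n\<close> bounded by one.  Testing with the vectors that they produce gives the
  density of the domain and identifies the adjoint pointwise almost everywhere.\<close>

lemma self_adjoint_mult_graph: "self_adjoint (mult_graph W g)"
  unfolding self_adjoint_def
proof
  define k where "k n a = (indicator {- real n..real n} (g a) / (real n + 1) :: real)" for n a
  have [measurable]: "k n \<in> borel_measurable borel" for n unfolding k_def by measurable
  have k1: "contraction_symbol (\<lambda>a. of_real (k n a))" for n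
  proof -
    have "\<bar>k n a\<bar> \<le> 1" for a by (auto simp: k_def split: split_indicator)
    then show ?thesis unfolding contraction_symbol_def by simp
  qed
  have k2: "contraction_symbol (\<lambda>a. of_real (g a * k n a))" for n
  proof -
    have "\<bar>g a * k n a\<bar> \<le> 1" for a by (auto simp: k_def abs_le_iff split: split_indicator)
    then have "cmod (of_real (g a * k n a)) \<le> 1" for a unfolding norm_of_real .
    then show ?thesis unfolding contraction_symbol_def by (auto intro!: measurable_compose[OF _ borel_measurable_of_real])
  qed
  have gr: "(inv W (mult_l2 (\<lambda>a. of_real (k n a)) x), inv W (mult_l2 (\<lambda>a. of_real (g a * k n a)) x)) \<in> mult_graph W g" for n x
  proof -
    have "AE a in lborel. rep_l2 (mult_l2 (\<lambda>a. of_real (g a * k n a)) x) a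
       = of_real (g a) * rep_l2 (mult_l2 (\<lambda>a. of_real (k n a)) x) a"
      using rep_mult_l2[OF k1, of n x] rep_mult_l2[OF k2, of n x] by eventually_elim simp
    then show ?thesis by (simp add: mult_graph_def unitary_inv_right[OF W])
  qed
  have sub: "subspace (Domain (mult_graph W g))"
    unfolding subspace_def
  proof (intro conjI ballI allI)
    show "0 \<in> Domain (mult_graph W g)"
      using mult_graph_scaleC[OF W gr[of 0 0], of 0] by auto
    show "x + y \<in> Domain (mult_graph W g)" if "x \<in> Domain (mult_graph W g)" "y \<in> Domain (mult_graph W g)" for x y
      using that mult_graph_add[OF W] by blast
    show "c *\<^sub>R x \<in> Domain (mult_graph W g)" if "x \<in> Domain (mult_graph W g)" for c x
      using that mult_graph_scaleC[OF W] unfolding scaleR_scaleC by blast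
  qed
  show "closure (Domain (mult_graph W g)) = UNIV"
  proof (rule orthogonal_trivial_imp_dense[OF sub])
    fix x assume x: "\<And>v. v \<in> Domain (mult_graph W g) \<Longrightarrow> inner v x = 0"
    have "AE a in lborel. k n a * (cmod (rep_l2 (W x) a))\<^sup>2 = 0" for n
    proof -
      have k0: "0 \<le> k n a" for a by (simp add: k_def)
      have i: "integrable lborel (\<lambda>a. k n a * (cmod (rep_l2 (W x) a))\<^sup>2)"
      proof (rule Bochner_Integration.integrable_bound[OF integrable_rep[of "W x"]])
        show "AE a in lborel. norm (k n a * (cmod (rep_l2 (W x) a))\<^sup>2) \<le> norm ((cmod (rep_l2 (W x) a))\<^sup>2)"
        proof (rule AE_I2)
          fix a
          have "\<bar>k n a\<bar> \<le> 1" by (auto simp: k_def split: split_indicator)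
          then show "norm (k n a * (cmod (rep_l2 (W x) a))\<^sup>2) \<le> norm ((cmod (rep_l2 (W x) a))\<^sup>2)"
            by (simp add: abs_mult mult_left_le_one_le)
        qed
      qed measurable
      let ?v = "inv W (mult_l2 (\<lambda>a. of_real (k n a)) (W x))"
      have "cinner x ?v = cinner (W x) (W ?v)" by (rule unitary_cinner[OF W, symmetric])
      also have "\<dots> = (CLINT a|lborel. of_real (k n a * (cmod (rep_l2 (W x) a))\<^sup>2))"
        unfolding unitary_inv_right[OF W] cinner_mult_l2[OF k1]
        by (rule Bochner_Integration.integral_cong)
          (simp_all add: complex_norm_square mult_ac del: of_real_power)
      finally have "Re (cinner x ?v) = (LINT a|lborel. k n a * (cmod (rep_l2 (W x) a))\<^sup>2)"
        by (simp only: integral_complex_of_real Re_complex_of_real)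
      moreover have "Re (cinner x ?v) = 0"
        using x[OF DomainI[OF gr]] by (simp add: Re_cinner inner_commute)
      ultimately show ?thesis
        using integral_nonneg_eq_0_iff_AE[OF i] k0 by auto
    qed
    then have "AE a in lborel. \<forall>n. k n a * (cmod (rep_l2 (W x) a))\<^sup>2 = 0" by (intro AE_all_countable[THEN iffD2] allI)
    then have "AE a in lborel. (cmod (rep_l2 (W x) a))\<^sup>2 = 0"
    proof eventually_elim
      case (elim a)
      obtain n where n: "\<bar>g a\<bar> \<le> real n" using real_arch_simple by blast
      then have "k n a \<noteq> 0" by (auto simp: k_def split: split_indicator)
      with elim show ?case by (metis mult_eq_0_iff)
    qed
    then have "(norm (W x))\<^sup>2 = 0" unfolding norm_rep by (rule integral_eq_zero_AE)
    then show "x = 0" by (simp add: unitary_norm[OF W])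
  qed
  show "adjoint_op (mult_graph W g) = mult_graph W g"
  proof (rule subset_antisym; rule subrelI)
    fix u v assume "(u, v) \<in> mult_graph W g"
    then show "(u, v) \<in> adjoint_op (mult_graph W g)"
      using mult_graph_symmetric[OF W] by (auto simp: adjoint_op_def)
  next
    fix u v assume uv: "(u, v) \<in> adjoint_op (mult_graph W g)"
    have "AE a in lborel. of_real (g a * k n a) * rep_l2 (W u) a = of_real (k n a) * rep_l2 (W v) a" for n
    proof -
      have "mult_l2 (\<lambda>a. of_real (g a * k n a)) (W u) = mult_l2 (\<lambda>a. of_real (k n a)) (W v)"
      proof (rule l2_eqI)
        fix h
        have "cinner u (inv W (mult_l2 (\<lambda>a. of_real (g a * k n a)) h))
            = cinner v (inv W (mult_l2 (\<lambda>a. of_real (k n a)) h))"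
          using uv gr[of n h] by (auto simp: adjoint_op_def)
        then have "cinner (W u) (mult_l2 (\<lambda>a. of_real (g a * k n a)) h)
            = cinner (W v) (mult_l2 (\<lambda>a. of_real (k n a)) h)"
          using unitary_cinner[OF unitary_inv[OF W]] unitary_inv_left[OF W] by metis
        then have "cinner (mult_l2 (\<lambda>a. of_real (g a * k n a)) (W u)) h
            = cinner (mult_l2 (\<lambda>a. of_real (k n a)) (W v)) h"
          using cinner_mult_l2_swap[OF k2, of n "W u" h] cinner_mult_l2_swap[OF k1, of n "W v" h] by simp
        then show "cinner h (mult_l2 (\<lambda>a. of_real (g a * k n a)) (W u))
            = cinner h (mult_l2 (\<lambda>a. of_real (k n a)) (W v))"
          using cinner_commute by metis
      qed
      then show ?thesis
        using rep_mult_l2[OF k2, of n "W u"] rep_mult_l2[OF k1, of n "W v"]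
        by (auto elim: eventually_elim2)
    qed
    then have "AE a in lborel. \<forall>n. of_real (g a * k n a) * rep_l2 (W u) a = of_real (k n a) * rep_l2 (W v) a"
      by (intro AE_all_countable[THEN iffD2] allI)
    then have "AE a in lborel. rep_l2 (W v) a = of_real (g a) * rep_l2 (W u) a"
    proof eventually_elim
      case (elim a)
      obtain n where n: "\<bar>g a\<bar> \<le> real n" using real_arch_simple by blast
      then have "k n a \<noteq> 0" by (auto simp: k_def split: split_indicator)
      moreover have "of_real (k n a) * (of_real (g a) * rep_l2 (W u) a) = of_real (k n a) * rep_l2 (W v) a"
        using elim[rule_format, of n] by (simp add: mult_ac)
      ultimately show ?case by (metis mult_cancel_left of_real_eq_0_iff)
    qed
    then show "(u, v) \<in> mult_graph W g" by (simp add: mult_graph_def)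
  qed
qed

text \<open>The quadratic form of a candidate is determined by \<open>scalar_measure_unique\<close>, and a complex linear
  operator is determined by its quadratic form.\<close>

lemma fun_calculus_mult_graph:
  assumes \<phi> [measurable]: "\<phi> \<in> borel_measurable borel" and bound: "\<And>t. cmod (\<phi> t) \<le> 1"
  shows "fun_calculus \<phi> (mult_graph W g) = (\<lambda>f. inv W (mult_l2 (\<lambda>a. \<phi> (g a)) (W f)))"
  unfolding fun_calculus_def
proof (rule the_equality)
  let ?T = "\<lambda>f. inv W (mult_l2 (\<lambda>a. \<phi> (g a)) (W f))"
  have m: "contraction_symbol (\<lambda>a. \<phi> (g a))" using bound by (simp add: contraction_symbol_def)
  have bc: "bounded_clinear ?T"
    unfolding bounded_clinear_def
  proof (intro conjI allI)
    show "bounded_linear ?T"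
      by (rule bounded_linear_compose[OF unitary_bounded_linear[OF unitary_inv[OF W]]
          bounded_linear_compose[OF bounded_linear_mult_l2[OF m] unitary_bounded_linear[OF W]]])
    show "?T (c *\<^sub>C f) = c *\<^sub>C ?T f" for c f
      by (simp add: unitary_scaleC[OF W] mult_l2_scaleC[OF m] unitary_scaleC[OF unitary_inv[OF W]])
  qed
  have form: "cinner f (?T f) = (LINT t|spectral_weight W g f. \<phi> t)" for f
  proof -
    have "cinner f (?T f) = cinner (W f) (W (?T f))" by (rule unitary_cinner[OF W, symmetric])
    also have "\<dots> = (LINT t|spectral_weight W g f. \<phi> t)"
      unfolding unitary_inv_right[OF W] cinner_mult_l2[OF m] integral_weight[OF \<phi>]
      by (rule Bochner_Integration.integral_cong)
        (simp_all add: scaleR_conv_of_real complex_norm_square mult_ac del: of_real_power)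
    finally show ?thesis .
  qed
  show "bounded_clinear ?T \<and> (\<exists>E. spectral_measure (mult_graph W g) E \<and>
      (\<forall>f. cinner f (?T f) = (LINT t|scalar_measure E f. \<phi> t)))"
    using bc spectral_measure_mult_pvm form by (auto simp: scalar_measure_mult_pvm intro!: exI[of _ "mult_pvm W g"])
  fix T
  assume T: "bounded_clinear T \<and> (\<exists>E. spectral_measure (mult_graph W g) E \<and>
      (\<forall>f. cinner f (T f) = (LINT t|scalar_measure E f. \<phi> t)))"
  then have same: "cinner f (T f) = cinner f (?T f)" for f
    using scalar_measure_unique[OF W g] form by metis
  define D where "D f = T f - ?T f" for f
  have Dl: "bounded_linear D" unfolding D_def using T bc
    by (intro bounded_linear_sub) (auto simp: bounded_clinear_def)
  have Dadd: "D (f + h) = D f + D h" for f h by (rule linear_add[OF bounded_linear.linear[OF Dl]])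
  have Dc: "D (c *\<^sub>C f) = c *\<^sub>C D f" for c f
    using T bc by (simp add: D_def bounded_clinear_def scaleC_diff)
  have D0: "cinner f (D f) = 0" for f using same[of f] by (simp add: D_def cinner_diff_right)
  show "T = ?T"
  proof (rule ext)
    fix f
    have "D f = 0"
    proof (rule l2_eqI)
      fix h
      have 1: "cinner f (D h) + cinner h (D f) = 0"
        using D0[of "f + h"] by (simp add: Dadd cinner_add_left cinner_add_right D0 add.commute)
      have "\<i> * cinner f (D h) - \<i> * cinner h (D f) = 0"
        using D0[of "f + \<i> *\<^sub>C h"] by (simp add: Dadd Dc cinner_add_left cinner_add_right D0)
      then have "cinner f (D h) = cinner h (D f)" by simp
      with 1 show "cinner h (D f) = cinner h 0" by simp
    qed
    then show "T f = ?T f" by (simp add: D_def)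
  qed
qed

end

section \<open>Gaussian integrals\<close>

text \<open>Completing the square in the real part of \<open>w\<close> and rescaling reduces the integral to the
  characteristic function of the standard normal distribution.\<close>

lemma gaussian_integral_complex:
  fixes w :: complex
  shows "integrable lborel (\<lambda>x::real. exp (w * of_real x - of_real (x\<^sup>2)))" (is ?I)
    and "(CLINT x|lborel. exp (w * of_real x - of_real (x\<^sup>2))) = of_real (sqrt pi) * exp (w\<^sup>2 / 4)" (is ?E)
proof -
  define p where "p = Re w"
  define q where "q = Im w"
  have w: "w = of_real p + \<i> * of_real q" by (simp add: p_def q_def complex_eq)
  have s2: "sqrt 2 * sqrt 2 = (2::real)" by simp
  define N where "N y = of_real (std_normal_density y) * iexp (q / sqrt 2 * y)" for y
  have iN: "integrable lborel N"
  proof (rule Bochner_Integration.integrable_bound[OF integrable_normal_moment[of 1 0 0]])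
    show "AE y in lborel. norm (N y) \<le> norm (std_normal_density y * (y - 0) ^ 0)"
      by (simp add: N_def norm_mult)
  qed (simp_all add: N_def[abs_def])
  have intN: "(CLINT y|lborel. N y) = exp (- of_real (q\<^sup>2) / 4)"
  proof -
    have "exp (- of_real (q\<^sup>2) / 4) = char std_normal_distribution (q / sqrt 2)"
      unfolding char_std_normal_distribution by (simp add: power_divide exp_of_real[symmetric])
    also have "\<dots> = (CLINT y|lborel. N y)"
      unfolding char_def N_def
      by (subst integral_density) (auto simp: scaleR_conv_of_real normal_density_nonneg)
    finally show ?thesis by simp
  qed
  define C where "C = of_real (sqrt (2 * pi)) * exp (of_real (p\<^sup>2 / 4) + \<i> * of_real (q * p / 2))"
  have split: "w * of_real x - of_real (x\<^sup>2) = of_real (p * x - x\<^sup>2) + \<i> * of_real (q * x)" for x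
    by (simp add: w algebra_simps)
  have sub: "exp (w * of_real (p / 2 + (1 / sqrt 2) * y) - of_real ((p / 2 + (1 / sqrt 2) * y)\<^sup>2)) = C * N y" for y
  proof -
    have "w * of_real (p / 2 + (1 / sqrt 2) * y) - of_real ((p / 2 + (1 / sqrt 2) * y)\<^sup>2)
       = of_real (p * (p / 2 + (1 / sqrt 2) * y) - (p / 2 + (1 / sqrt 2) * y)\<^sup>2) + \<i> * of_real (q * (p / 2 + (1 / sqrt 2) * y))"
      by (rule split)
    also have "p * (p / 2 + (1 / sqrt 2) * y) - (p / 2 + (1 / sqrt 2) * y)\<^sup>2 = p\<^sup>2 / 4 - y\<^sup>2 / 2"
      by (simp add: power2_eq_square field_simps)
    also have "q * (p / 2 + (1 / sqrt 2) * y) = q * p / 2 + q / sqrt 2 * y"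
      by (simp add: field_simps)
    finally have "exp (w * of_real (p / 2 + (1 / sqrt 2) * y) - of_real ((p / 2 + (1 / sqrt 2) * y)\<^sup>2))
       = exp (of_real (p\<^sup>2 / 4 - y\<^sup>2 / 2)) * iexp (q * p / 2) * iexp (q / sqrt 2 * y)"
      by (simp only: exp_add of_real_add distrib_left mult.assoc)
    also have "exp (of_real (p\<^sup>2 / 4 - y\<^sup>2 / 2)) = exp (of_real (p\<^sup>2 / 4)) * of_real (exp (- y\<^sup>2 / 2))"
      unfolding exp_of_real of_real_mult[symmetric] mult_exp_exp by simp
    also have "of_real (exp (- y\<^sup>2 / 2)) = of_real (sqrt (2 * pi)) * of_real (std_normal_density y)"
      unfolding std_normal_density_def by (simp flip: of_real_mult)
    finally show ?thesis by (simp add: C_def N_def exp_add mult_ac)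
  qed
  show ?I
    using iN lborel_integrable_real_affine_iff[of "1 / sqrt 2" "\<lambda>x. exp (w * of_real x - of_real (x\<^sup>2))" "p / 2"]
    unfolding sub by simp
  have "(CLINT x|lborel. exp (w * of_real x - of_real (x\<^sup>2))) = (1 / sqrt 2) *\<^sub>R (CLINT y|lborel. C * N y)"
    using lborel_integral_real_affine[of "1 / sqrt 2" "\<lambda>x. exp (w * of_real x - of_real (x\<^sup>2))" "p / 2"]
    unfolding sub by simp
  also have "\<dots> = of_real (1 / sqrt 2 * sqrt (2 * pi)) * (exp (of_real (p\<^sup>2 / 4) + \<i> * of_real (q * p / 2)) * exp (- of_real (q\<^sup>2) / 4))"
    by (simp add: intN C_def scaleR_conv_of_real)
  also have "1 / sqrt 2 * sqrt (2 * pi) = sqrt pi" by (simp add: real_sqrt_mult)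
  also have "exp (of_real (p\<^sup>2 / 4) + \<i> * of_real (q * p / 2)) * exp (- of_real (q\<^sup>2) / 4) = exp (w\<^sup>2 / 4)"
    unfolding exp_add[symmetric] by (rule arg_cong[where f = exp]) (simp add: w power2_eq_square algebra_simps add_divide_distrib)
  finally show ?E .
qed

text \<open>Lebesgue measure on \<open>real^'n\<close> is the image of the product measure over the basis vectors, which are
  indexed by the coordinates.\<close>

lemma integral_prod_cart:
  fixes f :: "'n::finite \<Rightarrow> real \<Rightarrow> complex"
  assumes f: "\<And>k. integrable lborel (f k)"
  shows "integrable lborel (\<lambda>a :: real^'n. \<Prod>k\<in>UNIV. f k (a $ k))"
    and "(CLINT a|(lborel :: (real^'n) measure). \<Prod>k\<in>UNIV. f k (a $ k)) = (\<Prod>k\<in>UNIV. CLINT x|lborel. f k x)"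
proof -
  interpret product_sigma_finite "\<lambda>_. lborel :: real measure"
    by standard
  have [measurable]: "f k \<in> borel_measurable borel" for k using f[of k] by (auto dest: borel_measurable_integrable)
  have [measurable]: "(\<lambda>a::real^'n. a $ k) \<in> borel_measurable borel" for k
    by (intro borel_measurable_continuous_onI continuous_intros)
  have basis: "(Basis :: (real^'n) set) = range (\<lambda>k. axis k 1)" by (auto simp: Basis_vec_def)
  have inj: "inj (\<lambda>k. axis k 1 :: real^'n)" by (auto simp: inj_def axis_eq_axis)
  have comp: "(\<Sum>b\<in>Basis. x b *\<^sub>R b) $ k = x (axis k 1)" for x :: "real^'n \<Rightarrow> real" and k
  proof -
    have "(\<Sum>b\<in>Basis. x b *\<^sub>R b) $ k = (\<Sum>b\<in>Basis. x b *\<^sub>R b) \<bullet> axis k 1"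
      by (simp add: cart_eq_inner_axis)
    also have "\<dots> = x (axis k 1)" by (rule inner_sum_left_Basis) simp
    finally show ?thesis .
  qed
  have prod: "(\<Prod>k\<in>UNIV. f k ((\<Sum>b\<in>Basis. x b *\<^sub>R b) $ k)) = (\<Prod>b\<in>Basis. f (axis_index b) (x b))"
    for x :: "real^'n \<Rightarrow> real"
    unfolding comp unfolding basis by (subst prod.reindex[OF inj]) simp
  have m: "(\<lambda>x. \<Sum>b\<in>Basis. x b *\<^sub>R b) \<in> measurable (\<Pi>\<^sub>M b\<in>(Basis :: (real^'n) set). lborel) borel"
    by measurable
  have M: "(\<lambda>a :: real^'n. \<Prod>k\<in>UNIV. f k (a $ k)) \<in> borel_measurable borel" by measurable
  show "integrable lborel (\<lambda>a :: real^'n. \<Prod>k\<in>UNIV. f k (a $ k))"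
    unfolding lborel_eq[where 'a = "real^'n"] integrable_distr_eq[OF m M] prod
    by (rule product_integrable_prod) (auto intro: f)
  have "(CLINT a|(lborel :: (real^'n) measure). \<Prod>k\<in>UNIV. f k (a $ k))
      = (\<Prod>b\<in>(Basis :: (real^'n) set). CLINT x|lborel. f (axis_index b) x)"
    unfolding lborel_eq[where 'a = "real^'n"] integral_distr[OF m M] prod
    by (rule product_integral_prod) (auto intro: f)
  also have "\<dots> = (\<Prod>k\<in>UNIV. CLINT x|lborel. f k x)"
    unfolding basis by (subst prod.reindex[OF inj]) simp
  finally show "(CLINT a|(lborel :: (real^'n) measure). \<Prod>k\<in>UNIV. f k (a $ k)) = (\<Prod>k\<in>UNIV. CLINT x|lborel. f k x)" .
qed

lemma gaussian_integral_cart: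
  fixes w :: "'n::finite \<Rightarrow> complex"
  shows "integrable lborel (\<lambda>a :: real^'n. exp (\<Sum>k\<in>UNIV. w k * of_real (a $ k) - of_real ((a $ k)\<^sup>2)))"
    and "(CLINT a|(lborel :: (real^'n) measure). exp (\<Sum>k\<in>UNIV. w k * of_real (a $ k) - of_real ((a $ k)\<^sup>2)))
      = of_real (sqrt pi ^ CARD('n)) * exp (\<Sum>k\<in>UNIV. (w k)\<^sup>2 / 4)"
  unfolding exp_sum[OF finite]
  using integral_prod_cart[where f = "\<lambda>k x. exp (w k * of_real x - of_real (x\<^sup>2))", OF gaussian_integral_complex(1)]
  by (simp_all add: gaussian_integral_complex(2) prod.distrib del: of_real_power) simp

section \<open>Functions with Gaussian decay\<close>

text \<open>A class that contains the core and is invariant under invertible linear substitutions, which the core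
  is not: its exponents are diagonal quadratic forms.\<close>

definition gauss_dominated :: "(real^'n::finite \<Rightarrow> complex) \<Rightarrow> bool" where
  "gauss_dominated f \<longleftrightarrow> continuous_on UNIV f \<and>
     (\<exists>C \<delta>. 0 < \<delta> \<and> (\<forall>a. cmod (f a) \<le> C * exp (- \<delta> * (norm a)\<^sup>2)))"

lemma gauss_dominatedI:
  assumes "continuous_on UNIV f" "0 < \<delta>" "\<And>a. cmod (f a) \<le> C * exp (- \<delta> * (norm a)\<^sup>2)"
  shows "gauss_dominated f"
  using assms unfolding gauss_dominated_def by blast

lemma gauss_dominatedE:
  assumes "gauss_dominated f"
  obtains C \<delta> where "continuous_on UNIV f" "0 < \<delta>" "0 \<le> C" "\<And>a. cmod (f a) \<le> C * exp (- \<delta> * (norm a)\<^sup>2)"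
proof -
  obtain C \<delta> where *: "continuous_on UNIV f" "0 < \<delta>" "\<And>a. cmod (f a) \<le> C * exp (- \<delta> * (norm a)\<^sup>2)"
    using assms unfolding gauss_dominated_def by blast
  have "0 \<le> C" using order_trans[OF norm_ge_zero *(3)[of 0]] by simp
  with * that show thesis by blast
qed

lemma integrable_gaussian_decay:
  assumes "0 < \<delta>"
  shows "integrable lborel (\<lambda>a :: real^'n::finite. exp (- \<delta> * (norm a)\<^sup>2))"
proof -
  have "integrable lborel (\<lambda>x::real. exp (0 * of_real x - of_real (x\<^sup>2)) :: complex)"
    by (rule gaussian_integral_complex)
  then have "integrable lborel (\<lambda>x::real. exp (0 * of_real (0 + sqrt \<delta> * x) - of_real ((0 + sqrt \<delta> * x)\<^sup>2)) :: complex)"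
    using assms by (intro lborel_integrable_real_affine[where f = "\<lambda>x. exp (0 * of_real x - of_real (x\<^sup>2))"]) auto
  then have 1: "integrable lborel (\<lambda>x::real. of_real (exp (- \<delta> * x\<^sup>2)) :: complex)"
    using assms by (simp add: power_mult_distrib exp_of_real[symmetric])
  have eq: "(\<Prod>k\<in>UNIV. of_real (exp (- \<delta> * (a $ k)\<^sup>2))) = (of_real (exp (- \<delta> * (norm a)\<^sup>2)) :: complex)" for a :: "real^'n"
  proof -
    have "(\<Prod>k\<in>UNIV. of_real (exp (- \<delta> * (a $ k)\<^sup>2))) = (of_real (exp (\<Sum>k\<in>UNIV. - \<delta> * (a $ k)\<^sup>2)) :: complex)"
      by (simp add: exp_sum)
    also have "(\<Sum>k\<in>UNIV. - \<delta> * (a $ k)\<^sup>2) = - \<delta> * (norm a)\<^sup>2"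
      unfolding power2_norm_eq_inner inner_vec_def by (simp add: sum_distrib_left sum_negf power2_eq_square)
    finally show ?thesis .
  qed
  from integral_prod_cart(1)[where f = "\<lambda>k::'n. \<lambda>x. of_real (exp (- \<delta> * x\<^sup>2))", OF 1]
  have "integrable lborel (\<lambda>a :: real^'n. of_real (exp (- \<delta> * (norm a)\<^sup>2)) :: complex)" unfolding eq .
  from integrable_Re[OF this] show ?thesis by simp
qed

lemma gauss_dominated_measurable: "gauss_dominated f \<Longrightarrow> f \<in> borel_measurable borel"
  by (auto simp: gauss_dominated_def intro: borel_measurable_continuous_onI)

lemma gauss_dominated_integrable:
  assumes "gauss_dominated (f :: real^'n::finite \<Rightarrow> complex)"
  shows "integrable lborel f"
proof -
  obtain \<delta> C where *: "continuous_on UNIV f" "0 < \<delta>" "0 \<le> C" "\<And>a. cmod (f a) \<le> C * exp (- \<delta> * (norm a)\<^sup>2)"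
    by (rule gauss_dominatedE[OF assms]) blast
  have "integrable lborel (\<lambda>a :: real^'n. C * exp (- \<delta> * (norm a)\<^sup>2))"
    using integrable_gaussian_decay[OF *(2)] by (intro integrable_mult_right)
  then show ?thesis
    by (rule Bochner_Integration.integrable_bound)
      (use *(3,4) gauss_dominated_measurable[OF assms] in auto)
qed

lemma gauss_dominated_mult_bounded_growth:
  assumes f: "gauss_dominated (f :: real^'n::finite \<Rightarrow> complex)" and p: "continuous_on UNIV p"
    and growth: "\<And>\<epsilon>. 0 < \<epsilon> \<Longrightarrow> \<exists>K. \<forall>a. cmod (p a) \<le> K * exp (\<epsilon> * (norm a)\<^sup>2)"
  shows "gauss_dominated (\<lambda>a. p a * f a)"
proof -
  obtain \<delta> C where *: "continuous_on UNIV f" "0 < \<delta>" "0 \<le> C" "\<And>a. cmod (f a) \<le> C * exp (- \<delta> * (norm a)\<^sup>2)"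
    by (rule gauss_dominatedE[OF f]) blast
  obtain K where K: "\<And>a. cmod (p a) \<le> K * exp (\<delta> / 2 * (norm a)\<^sup>2)" using growth[of "\<delta> / 2"] *(2) by auto
  show ?thesis
  proof (rule gauss_dominatedI)
    fix a
    have "cmod (p a * f a) \<le> (K * exp (\<delta> / 2 * (norm a)\<^sup>2)) * (C * exp (- \<delta> * (norm a)\<^sup>2))"
      unfolding norm_mult using K *(4) order_trans[OF norm_ge_zero K[of a]] by (intro mult_mono) auto
    also have "\<dots> = K * C * exp (- (\<delta> / 2) * (norm a)\<^sup>2)"
      by (simp add: mult_exp_exp algebra_simps)
    finally show "cmod (p a * f a) \<le> K * C * exp (- (\<delta> / 2) * (norm a)\<^sup>2)" .
  qed (use * p in \<open>auto intro: continuous_on_mult\<close>)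
qed

lemma gauss_dominated_mult:
  assumes f: "gauss_dominated (f :: real^'n::finite \<Rightarrow> complex)" and g: "gauss_dominated g"
  shows "gauss_dominated (\<lambda>a. g a * f a)"
proof (rule gauss_dominated_mult_bounded_growth[OF f])
  obtain \<delta> C where *: "continuous_on UNIV g" "0 < \<delta>" "0 \<le> C" "\<And>a. cmod (g a) \<le> C * exp (- \<delta> * (norm a)\<^sup>2)"
    by (rule gauss_dominatedE[OF g]) blast
  show "continuous_on UNIV g" by (rule *)
  fix \<epsilon> :: real assume e: "0 < \<epsilon>"
  have "cmod (g a) \<le> C * exp (\<epsilon> * (norm a)\<^sup>2)" for a
  proof -
    have "- \<delta> * (norm a)\<^sup>2 \<le> \<epsilon> * (norm a)\<^sup>2" using e *(2) by (intro mult_right_mono) auto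
    then have "C * exp (- \<delta> * (norm a)\<^sup>2) \<le> C * exp (\<epsilon> * (norm a)\<^sup>2)"
      using *(3) by (intro mult_left_mono) auto
    then show ?thesis using *(4)[of a] by simp
  qed
  then show "\<exists>K. \<forall>a. cmod (g a) \<le> K * exp (\<epsilon> * (norm a)\<^sup>2)" by blast
qed

text \<open>Linear growth, in the form in which it combines with Gaussian decay.\<close>

lemma exp_growth_linear:
  fixes c x \<epsilon> :: real
  assumes "0 < \<epsilon>" "0 \<le> c" "0 \<le> x"
  shows "c * x \<le> (1 + c\<^sup>2 / \<epsilon>) * exp (\<epsilon> * x\<^sup>2)"
proof -
  have "2 * (c * x) \<le> c\<^sup>2 / \<epsilon> + \<epsilon> * x\<^sup>2"
  proof -
    have "0 \<le> (c / sqrt \<epsilon> - sqrt \<epsilon> * x)\<^sup>2" by simp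
    also have "\<dots> = c\<^sup>2 / \<epsilon> + \<epsilon> * x\<^sup>2 - 2 * (c * x)"
      using assms by (simp add: power2_diff power_divide power_mult_distrib)
    finally show ?thesis by simp
  qed
  also have "\<dots> \<le> c\<^sup>2 / \<epsilon> * exp (\<epsilon> * x\<^sup>2) + exp (\<epsilon> * x\<^sup>2)"
  proof (rule add_mono)
    have "1 \<le> exp (\<epsilon> * x\<^sup>2)" using assms by simp
    then show "c\<^sup>2 / \<epsilon> \<le> c\<^sup>2 / \<epsilon> * exp (\<epsilon> * x\<^sup>2)"
      using assms mult_left_mono[of 1 "exp (\<epsilon> * x\<^sup>2)" "c\<^sup>2 / \<epsilon>"] by simp
    show "\<epsilon> * x\<^sup>2 \<le> exp (\<epsilon> * x\<^sup>2)"
      using exp_ge_add_one_self[of "\<epsilon> * x\<^sup>2"] by linarith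
  qed
  also have "\<dots> = (1 + c\<^sup>2 / \<epsilon>) * exp (\<epsilon> * x\<^sup>2)" by (simp add: algebra_simps)
  finally have "2 * (c * x) \<le> (1 + c\<^sup>2 / \<epsilon>) * exp (\<epsilon> * x\<^sup>2)" .
  moreover have "0 \<le> c * x" using assms by simp
  ultimately show ?thesis by linarith
qed

lemma gauss_dominated_coord:
  assumes f: "gauss_dominated (f :: real^'n::finite \<Rightarrow> complex)"
  shows "gauss_dominated (\<lambda>a. of_real (a $ k) * f a)"
proof (rule gauss_dominated_mult_bounded_growth[OF f])
  fix \<epsilon> :: real assume e: "0 < \<epsilon>"
  have "cmod (of_real (a $ k)) \<le> (1 + 1\<^sup>2 / \<epsilon>) * exp (\<epsilon> * (norm a)\<^sup>2)" for a :: "real^'n"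
    using exp_growth_linear[OF e, of 1 "norm a"] component_le_norm_cart[of a k] by simp
  then show "\<exists>K. \<forall>a::real^'n. cmod (of_real (a $ k)) \<le> K * exp (\<epsilon> * (norm a)\<^sup>2)" by blast
qed (intro continuous_intros)

lemma gauss_dominated_const_mult:
  assumes f: "gauss_dominated (f :: real^'n::finite \<Rightarrow> complex)"
  shows "gauss_dominated (\<lambda>a. c * f a)"
proof -
  obtain \<delta> C where *: "continuous_on UNIV f" "0 < \<delta>" "0 \<le> C" "\<And>a. cmod (f a) \<le> C * exp (- \<delta> * (norm a)\<^sup>2)"
    by (rule gauss_dominatedE[OF f]) blast
  show ?thesis
    by (rule gauss_dominatedI[OF _ *(2), where C = "cmod c * C"])
      (use * in \<open>auto simp: norm_mult mult.assoc intro!: mult_left_mono continuous_intros\<close>)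
qed

lemma gauss_dominated_add:
  assumes f: "gauss_dominated (f :: real^'n::finite \<Rightarrow> complex)" and g: "gauss_dominated g"
  shows "gauss_dominated (\<lambda>a. f a + g a)"
proof -
  obtain \<delta> C where *: "continuous_on UNIV f" "0 < \<delta>" "0 \<le> C" "\<And>a. cmod (f a) \<le> C * exp (- \<delta> * (norm a)\<^sup>2)"
    by (rule gauss_dominatedE[OF f]) blast
  obtain \<eta> D where **: "continuous_on UNIV g" "0 < \<eta>" "0 \<le> D" "\<And>a. cmod (g a) \<le> D * exp (- \<eta> * (norm a)\<^sup>2)"
    by (rule gauss_dominatedE[OF g]) blast
  show ?thesis
  proof (rule gauss_dominatedI)
    show "0 < min \<delta> \<eta>" using * ** by simp
    fix a
    have "cmod (f a + g a) \<le> C * exp (- \<delta> * (norm a)\<^sup>2) + D * exp (- \<eta> * (norm a)\<^sup>2)"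
      using norm_triangle_ineq[of "f a" "g a"] *(4)[of a] **(4)[of a] by linarith
    also have "\<dots> \<le> C * exp (- min \<delta> \<eta> * (norm a)\<^sup>2) + D * exp (- min \<delta> \<eta> * (norm a)\<^sup>2)"
      using *(3) **(3) by (intro add_mono mult_left_mono) (auto intro!: mult_right_mono)
    finally show "cmod (f a + g a) \<le> (C + D) * exp (- min \<delta> \<eta> * (norm a)\<^sup>2)" by (simp add: algebra_simps)
  qed (use * ** in \<open>auto intro: continuous_on_add\<close>)
qed

lemma gauss_dominated_zero: "gauss_dominated (\<lambda>a. 0)"
  by (rule gauss_dominatedI[where \<delta> = 1 and C = 0]) auto

lemma gauss_dominated_sum:
  "(\<And>k. k \<in> K \<Longrightarrow> gauss_dominated (f k)) \<Longrightarrow> gauss_dominated (\<lambda>a. \<Sum>k\<in>K. f k a)"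
  by (induction K rule: infinite_finite_induct) (auto intro: gauss_dominated_zero gauss_dominated_add)

lemma gauss_dominated_cnj: "gauss_dominated f \<Longrightarrow> gauss_dominated (\<lambda>a. cnj (f a))"
  unfolding gauss_dominated_def by (auto intro: continuous_on_cnj)

lemma gauss_dominated_sq_integrable:
  assumes f: "gauss_dominated (f :: real^'n::finite \<Rightarrow> complex)"
  shows "sq_integrable f"
  unfolding sq_integrable_def
proof
  show "f \<in> borel_measurable lborel" using gauss_dominated_measurable[OF f] by simp
  have "integrable lborel (\<lambda>a. cnj (f a) * f a)"
    by (intro gauss_dominated_integrable gauss_dominated_mult gauss_dominated_cnj f)
  then have "integrable lborel (\<lambda>a. of_real ((cmod (f a))\<^sup>2) :: complex)"
    by (simp add: complex_norm_square mult.commute del: of_real_power)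
  from integrable_Re[OF this] show "integrable lborel (\<lambda>a. (cmod (f a))\<^sup>2)" by simp
qed

lemma gauss_dominated_linear_change:
  assumes f: "gauss_dominated (f :: real^'n::finite \<Rightarrow> complex)"
    and m: "linear m" "\<And>a. m (m a) = a"
  shows "gauss_dominated (f \<circ> m)"
proof -
  obtain \<delta> C where *: "continuous_on UNIV f" "0 < \<delta>" "0 \<le> C" "\<And>a. cmod (f a) \<le> C * exp (- \<delta> * (norm a)\<^sup>2)"
    by (rule gauss_dominatedE[OF f]) blast
  have bl: "bounded_linear m" using m(1) by (simp add: linear_conv_bounded_linear)
  then obtain K where K: "0 < K" "\<And>a. norm (m a) \<le> norm a * K"
    using bounded_linear.pos_bounded by blast
  show ?thesis
  proof (rule gauss_dominatedI)
    show "0 < \<delta> / K\<^sup>2" using * K by simp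
    show "continuous_on UNIV (f \<circ> m)"
      using *(1) linear_continuous_on[OF bl] by (intro continuous_on_compose) (auto intro: continuous_on_subset)
    fix a
    have "norm a / K \<le> norm (m a)" using K(1) K(2)[of "m a"] by (simp add: m(2) field_simps)
    then have "(norm a / K)\<^sup>2 \<le> (norm (m a))\<^sup>2" using K(1) by (intro power_mono) auto
    then have "\<delta> / K\<^sup>2 * (norm a)\<^sup>2 \<le> \<delta> * (norm (m a))\<^sup>2"
      using *(2) mult_left_mono[of "(norm a / K)\<^sup>2" "(norm (m a))\<^sup>2" \<delta>] by (simp add: power_divide)
    then have "C * exp (- \<delta> * (norm (m a))\<^sup>2) \<le> C * exp (- (\<delta> / K\<^sup>2) * (norm a)\<^sup>2)"
      using *(3) by (intro mult_left_mono) auto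
    then show "cmod ((f \<circ> m) a) \<le> C * exp (- (\<delta> / K\<^sup>2) * (norm a)\<^sup>2)"
      using *(4)[of "m a"] by simp
  qed
qed

section \<open>Integration by parts\<close>

text \<open>The relation at parameter zero for every base point; by translation it gives the derivative along
  the whole line.\<close>

definition partial_derivative :: "'n \<Rightarrow> (real^'n::finite \<Rightarrow> complex) \<Rightarrow> (real^'n \<Rightarrow> complex) \<Rightarrow> bool" where
  "partial_derivative i f f' \<longleftrightarrow>
     (\<forall>a. ((\<lambda>t. f (a + t *\<^sub>R axis i 1)) has_vector_derivative f' a) (at 0))"

lemma partial_derivative_along_line:
  assumes "partial_derivative i f f'"
  shows "((\<lambda>t. f (a + t *\<^sub>R axis i 1)) has_vector_derivative f' (a + t *\<^sub>R axis i 1)) (at t)"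
proof -
  have "((\<lambda>s. f ((a + t *\<^sub>R axis i 1) + s *\<^sub>R axis i 1)) has_vector_derivative f' (a + t *\<^sub>R axis i 1)) (at 0)"
    using assms unfolding partial_derivative_def by blast
  then have "((\<lambda>s. f ((a + t *\<^sub>R axis i 1) + s *\<^sub>R axis i 1)) \<circ> (\<lambda>u. u - t) has_vector_derivative
      1 *\<^sub>R f' (a + t *\<^sub>R axis i 1)) (at t)"
    by (intro vector_diff_chain_at) (auto intro!: derivative_eq_intros)
  then show ?thesis by (simp add: o_def algebra_simps flip: scaleR_add_left)
qed

lemma lborel_translate:
  fixes f :: "real^'n::finite \<Rightarrow> complex"
  assumes "integrable lborel f"
  shows "integrable lborel (\<lambda>a. f (a + c))" "(CLINT a|lborel. f (a + c)) = (CLINT a|lborel. f a)"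
proof -
  have [measurable]: "f \<in> borel_measurable borel" using assms by (auto dest: borel_measurable_integrable)
  have "integrable (distr lborel borel ((+) c)) f" unfolding lborel_distr_plus by (rule assms)
  then show "integrable lborel (\<lambda>a. f (a + c))"
    by (subst (asm) integrable_distr_eq) (auto simp: add.commute)
  have "(CLINT a|lborel. f a) = (CLINT a|distr lborel borel ((+) c). f a)" by (simp add: lborel_distr_plus)
  also have "\<dots> = (CLINT a|lborel. f (a + c))"
    by (subst integral_distr) (auto simp: add.commute)
  finally show "(CLINT a|lborel. f (a + c)) = (CLINT a|lborel. f a)" by simp
qed

text \<open>By the fundamental theorem of calculus the integral of \<open>h'\<close> over the segment from \<open>a\<close> to \<open>a + e\<^sub>i\<close> is
  \<open>h (a + e\<^sub>i) - h a\<close>.  Integrating over \<open>a\<close> and exchanging the integrals, translation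
  invariance gives the integral of \<open>h'\<close> on one side and zero on the other.\<close>

lemma integral_partial_derivative_zero:
  fixes h h' :: "real^'n::finite \<Rightarrow> complex"
  assumes d: "partial_derivative i h h'" and h: "integrable lborel h"
    and h': "integrable lborel h'" "continuous_on UNIV h'"
  shows "(CLINT a|lborel. h' a) = 0"
proof -
  let ?e = "axis i 1 :: real^'n"
  define F where "F t a = indicator {0..1::real} t *\<^sub>R h' (a + t *\<^sub>R ?e)" for t a
  have [measurable]: "h' \<in> borel_measurable borel" using h' by (auto dest: borel_measurable_integrable)
  have m: "case_prod F \<in> borel_measurable (lborel \<Otimes>\<^sub>M lborel)"
  proof -
    have "(\<lambda>x :: real \<times> (real^'n). h' (snd x + fst x *\<^sub>R ?e)) \<in> borel_measurable borel"
      by (intro borel_measurable_continuous_onI continuous_on_compose2[OF h'(2)] continuous_intros) auto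
    then have "(\<lambda>x :: real \<times> (real^'n). h' (snd x + fst x *\<^sub>R ?e)) \<in> borel_measurable (lborel \<Otimes>\<^sub>M lborel)"
      by (simp add: lborel_prod)
    moreover have "(\<lambda>x :: real \<times> (real^'n). indicator {0..1::real} (fst x) :: real) \<in> borel_measurable (lborel \<Otimes>\<^sub>M lborel)"
      by measurable
    ultimately show ?thesis unfolding F_def[abs_def] case_prod_beta by (intro borel_measurable_scaleR)
  qed
  have "integrable (lborel \<Otimes>\<^sub>M lborel) (case_prod F)"
  proof (rule lborel_pair.Fubini_integrable[OF m])
    have "(\<integral>a. norm (case_prod F (t, a)) \<partial>lborel) = indicator {0..1} t * (\<integral>a. norm (h' a) \<partial>lborel)" for t
    proof -
      have "(\<integral>a. norm (h' (a + t *\<^sub>R ?e)) \<partial>lborel) = (\<integral>a. norm (h' a) \<partial>lborel)"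
        using lborel_translate(2)[of "\<lambda>a. complex_of_real (norm (h' a))" "t *\<^sub>R ?e"] h'(1)
        by (simp only: integral_complex_of_real of_real_eq_iff) auto
      then show ?thesis by (simp add: F_def)
    qed
    then show "integrable lborel (\<lambda>t. \<integral>a. norm (case_prod F (t, a)) \<partial>lborel)"
      by (simp add: integrable_mult_left)
    show "AE t in lborel. integrable lborel (\<lambda>a. case_prod F (t, a))"
      unfolding F_def[abs_def] case_prod_conv
      by (intro AE_I2 integrable_scaleR_right lborel_translate(1)[OF h'(1)])
  qed
  from lborel_pair.Fubini_integral[OF this]
  have "(CLINT a|lborel. (CLINT t|lborel. F t a)) = (CLINT t|lborel. (CLINT a|lborel. F t a))" .
  moreover have "(CLINT t|lborel. F t a) = h (a + ?e) - h a" for a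
  proof -
    have "(CLINT t|lborel. F t a) = h (a + 1 *\<^sub>R ?e) - h (a + 0 *\<^sub>R ?e)"
      unfolding F_def
      by (rule integral_FTC_atLeastAtMost[where F = "\<lambda>t. h (a + t *\<^sub>R ?e)"])
        (auto intro!: has_vector_derivative_at_within partial_derivative_along_line[OF d]
          continuous_on_compose2[OF h'(2)] continuous_intros)
    then show ?thesis by simp
  qed
  moreover have "(CLINT a|lborel. h (a + ?e) - h a) = 0"
    using lborel_translate[OF h, of ?e] h by simp
  moreover have "(CLINT a|lborel. F t a) = indicator {0..1} t *\<^sub>R (CLINT a|lborel. h' a)" for t
    unfolding F_def using lborel_translate(2)[OF h'(1), of "t *\<^sub>R ?e"] by simp
  ultimately show ?thesis by simp
qed

section \<open>Gaussian vectors\<close>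

text \<open>The quadratic part is fixed; only the linear part varies.  The family is stable under partial Fourier
  transforms, and complex \<open>\<beta>\<close> includes the plane waves needed for totality.\<close>

definition gauss :: "('n::finite \<Rightarrow> complex) \<Rightarrow> real^'n \<Rightarrow> complex" where
  "gauss \<beta> a = exp (\<Sum>k\<in>UNIV. \<beta> k * of_real (a $ k) - of_real ((a $ k)\<^sup>2) / 2)"

definition gaussian :: "('n::finite \<Rightarrow> complex) \<Rightarrow> 'n l2" where
  "gaussian \<beta> = abs_l2 (gauss \<beta>)"

lemma has_vector_derivative_coord: "((\<lambda>t. of_real ((a + t *\<^sub>R axis i 1) $ k) :: complex)
    has_vector_derivative (if k = i then 1 else 0)) (at t)"
  by (auto simp: axis_def intro!: derivative_eq_intros has_vector_derivative_of_real)

lemma polynomial_exponent_derivative: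
  fixes \<alpha> \<beta> :: "'n::finite \<Rightarrow> complex" and a :: "real^'n"
  shows "((\<lambda>t. \<Sum>k\<in>UNIV. \<beta> k * of_real ((a + t *\<^sub>R axis i 1) $ k) - \<alpha> k * (of_real ((a + t *\<^sub>R axis i 1) $ k))\<^sup>2)
    has_vector_derivative (\<beta> i - 2 * \<alpha> i * of_real (a $ i))) (at 0)"
proof -
  have "((\<lambda>t. \<Sum>k\<in>UNIV. \<beta> k * of_real ((a + t *\<^sub>R axis i 1) $ k) - \<alpha> k * (of_real ((a + t *\<^sub>R axis i 1) $ k))\<^sup>2)
    has_vector_derivative (\<Sum>k\<in>UNIV. if k = i then \<beta> i - 2 * \<alpha> i * of_real (a $ i) else 0)) (at 0)"
  proof (rule has_vector_derivative_sum)
    fix k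
    have c: "((\<lambda>t. of_real ((a + t *\<^sub>R axis i 1) $ k) :: complex) has_vector_derivative (if k = i then 1 else 0)) (at 0)"
      by (rule has_vector_derivative_coord)
    have c2: "((\<lambda>t. of_real ((a + t *\<^sub>R axis i 1) $ k) * of_real ((a + t *\<^sub>R axis i 1) $ k) :: complex)
        has_vector_derivative (of_real (a $ k) * (if k = i then 1 else 0) + (if k = i then 1 else 0) * of_real (a $ k))) (at 0)"
      using has_vector_derivative_mult[OF c c] by simp
    show "((\<lambda>t. \<beta> k * of_real ((a + t *\<^sub>R axis i 1) $ k) - \<alpha> k * (of_real ((a + t *\<^sub>R axis i 1) $ k))\<^sup>2)
       has_vector_derivative (if k = i then \<beta> i - 2 * \<alpha> i * of_real (a $ i) else 0)) (at 0)"
      using has_vector_derivative_diff[OF has_vector_derivative_mult_right[OF c, of "\<beta> k"]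
          has_vector_derivative_mult_right[OF c2, of "\<alpha> k"]]
      by (cases "k = i") (simp_all add: power2_eq_square mult_ac)
  qed
  then show ?thesis by simp
qed

lemma has_vector_derivative_exp_compose:
  fixes f :: "real \<Rightarrow> complex"
  assumes "(f has_vector_derivative f') (at t)"
  shows "((\<lambda>t. exp (f t)) has_vector_derivative (f' * exp (f t))) (at t)"
  using field_vector_diff_chain_at[OF assms DERIV_exp] by (simp add: o_def)

lemma partial_derivative_exp_quadratic:
  "partial_derivative i (\<lambda>a. exp (\<Sum>k\<in>UNIV. \<beta> k * of_real (a $ k) - \<alpha> k * (of_real (a $ k))\<^sup>2))
     (\<lambda>a. (\<beta> i - 2 * \<alpha> i * of_real (a $ i)) * exp (\<Sum>k\<in>UNIV. \<beta> k * of_real (a $ k) - \<alpha> k * (of_real (a $ k))\<^sup>2))"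
  unfolding partial_derivative_def
  using has_vector_derivative_exp_compose[OF polynomial_exponent_derivative, of \<beta> _ i \<alpha>] by simp

lemma gauss_dominated_exp_quadratic:
  fixes \<alpha> \<beta> :: "'n::finite \<Rightarrow> complex"
  assumes \<alpha>: "\<And>k. 0 < Re (\<alpha> k)"
  shows "gauss_dominated (\<lambda>a :: real^'n. exp (\<Sum>k\<in>UNIV. \<beta> k * of_real (a $ k) - \<alpha> k * (of_real (a $ k))\<^sup>2))"
proof -
  define \<delta> where "\<delta> = Min (range (\<lambda>k. Re (\<alpha> k)))"
  have d: "0 < \<delta>" "\<delta> \<le> Re (\<alpha> k)" for k using \<alpha> by (auto simp: \<delta>_def)
  define C where "C = (\<Sum>k\<in>UNIV. (Re (\<beta> k))\<^sup>2 / (2 * \<delta>))"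
  show ?thesis
  proof (rule gauss_dominatedI)
    show "0 < \<delta> / 2" using d by simp
    show "continuous_on UNIV (\<lambda>a :: real^'n. exp (\<Sum>k\<in>UNIV. \<beta> k * of_real (a $ k) - \<alpha> k * (of_real (a $ k))\<^sup>2))"
      by (intro continuous_intros)
    fix a :: "real^'n"
    have bnd: "Re (\<beta> k * of_real (a $ k) - \<alpha> k * (of_real (a $ k))\<^sup>2) \<le> (Re (\<beta> k))\<^sup>2 / (2 * \<delta>) - \<delta> / 2 * (a $ k)\<^sup>2" for k
    proof -
      have "0 \<le> (Re (\<beta> k) / sqrt (2 * \<delta>) - sqrt (2 * \<delta>) / 2 * (a $ k))\<^sup>2" by simp
      also have "\<dots> = (Re (\<beta> k))\<^sup>2 / (2 * \<delta>) + \<delta> / 2 * (a $ k)\<^sup>2 - Re (\<beta> k) * (a $ k)"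
        using d(1) by (simp add: power2_diff power_divide power_mult_distrib field_simps)
          (simp add: power2_eq_square)
      finally have "Re (\<beta> k) * (a $ k) \<le> (Re (\<beta> k))\<^sup>2 / (2 * \<delta>) + \<delta> / 2 * (a $ k)\<^sup>2" by simp
      moreover have "\<delta> * (a $ k)\<^sup>2 \<le> Re (\<alpha> k) * (a $ k)\<^sup>2" using d(2) by (intro mult_right_mono) auto
      moreover have "Re (\<beta> k * of_real (a $ k) - \<alpha> k * (of_real (a $ k))\<^sup>2) = Re (\<beta> k) * (a $ k) - Re (\<alpha> k) * (a $ k)\<^sup>2"
        by (simp flip: of_real_power)
      ultimately show ?thesis by (simp add: field_simps)
    qed
    have n2: "(norm a)\<^sup>2 = (\<Sum>k\<in>UNIV. (a $ k)\<^sup>2)"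
      unfolding power2_norm_eq_inner inner_vec_def by (simp add: power2_eq_square)
    have "Re (\<Sum>k\<in>UNIV. \<beta> k * of_real (a $ k) - \<alpha> k * (of_real (a $ k))\<^sup>2) \<le> (\<Sum>k\<in>UNIV. (Re (\<beta> k))\<^sup>2 / (2 * \<delta>) - \<delta> / 2 * (a $ k)\<^sup>2)"
      unfolding Re_sum by (rule sum_mono) (rule bnd)
    also have "\<dots> = C - \<delta> / 2 * (norm a)\<^sup>2"
      by (simp add: C_def n2 sum_subtractf sum_distrib_left)
    finally show "cmod (exp (\<Sum>k\<in>UNIV. \<beta> k * of_real (a $ k) - \<alpha> k * (of_real (a $ k))\<^sup>2)) \<le> exp C * exp (- (\<delta> / 2) * (norm a)\<^sup>2)"
      by (simp add: norm_exp_eq_Re mult_exp_exp)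
  qed
qed

lemma gauss_eq_exp_quadratic:
  "gauss \<beta> = (\<lambda>a. exp (\<Sum>k\<in>UNIV. \<beta> k * of_real (a $ k) - 1 / 2 * (of_real (a $ k))\<^sup>2))"
  by (simp add: gauss_def fun_eq_iff)

lemma gauss_dominated_gauss: "gauss_dominated (gauss \<beta>)"
  unfolding gauss_eq_exp_quadratic by (rule gauss_dominated_exp_quadratic) simp

lemma partial_derivative_gauss: "partial_derivative i (gauss \<beta>) (\<lambda>a. (\<beta> i - of_real (a $ i)) * gauss \<beta> a)"
  using partial_derivative_exp_quadratic[of i \<beta> "\<lambda>_. 1 / 2"] unfolding gauss_eq_exp_quadratic by simp

lemma partial_derivative_mult:
  assumes "partial_derivative i f f'" "partial_derivative i g g'"
  shows "partial_derivative i (\<lambda>a. f a * g a) (\<lambda>a. f a * g' a + f' a * g a)"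
  unfolding partial_derivative_def
proof
  fix a
  have f: "((\<lambda>t. f (a + t *\<^sub>R axis i 1)) has_vector_derivative f' a) (at 0)"
    and g: "((\<lambda>t. g (a + t *\<^sub>R axis i 1)) has_vector_derivative g' a) (at 0)"
    using assms unfolding partial_derivative_def by blast+
  from has_vector_derivative_mult[OF f g]
  show "((\<lambda>t. f (a + t *\<^sub>R axis i 1) * g (a + t *\<^sub>R axis i 1)) has_vector_derivative f a * g' a + f' a * g a) (at 0)"
    by simp
qed

lemma partial_derivative_cnj:
  assumes "partial_derivative i f f'"
  shows "partial_derivative i (\<lambda>a. cnj (f a)) (\<lambda>a. cnj (f' a))"
  using assms unfolding partial_derivative_def by (auto intro: has_vector_derivative_cnj)

lemma integration_by_parts:
  fixes f f' g g' :: "real^'n::finite \<Rightarrow> complex"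
  assumes "partial_derivative i f f'" "partial_derivative i g g'"
    and gd: "gauss_dominated f" "gauss_dominated f'" "gauss_dominated g" "gauss_dominated g'"
  shows "(CLINT a|lborel. cnj (f' a) * g a) = - (CLINT a|lborel. cnj (f a) * g' a)"
proof -
  have 1: "gauss_dominated (\<lambda>a. cnj (f' a) * g a)" "gauss_dominated (\<lambda>a. cnj (f a) * g' a)" "gauss_dominated (\<lambda>a. cnj (f a) * g a)"
    by (intro gauss_dominated_mult gauss_dominated_cnj gd)+
  have "(CLINT a|lborel. cnj (f a) * g' a + cnj (f' a) * g a) = 0"
    using gauss_dominated_add[OF 1(2,1)]
    by (intro integral_partial_derivative_zero[OF partial_derivative_mult[OF partial_derivative_cnj[OF assms(1)] assms(2)]]
        gauss_dominated_integrable 1) (auto simp: gauss_dominated_def)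
  then show ?thesis using gauss_dominated_integrable[OF 1(1)] gauss_dominated_integrable[OF 1(2)]
    by (simp add: add_eq_0_iff)
qed

lemma sq_integrable_gauss: "sq_integrable (gauss \<beta>)"
  by (rule gauss_dominated_sq_integrable[OF gauss_dominated_gauss])

text \<open>With \<open>\<beta> = \<i> s\<close> the hypothesis is the vanishing of a Fourier transform.\<close>

lemma gauss_test_zero:
  fixes w :: "real^'n::finite \<Rightarrow> complex"
  assumes i: "integrable lborel (\<lambda>a. gauss (\<lambda>_. 0) a * w a)"
    and zero: "\<And>\<beta>. (CLINT a|lborel. gauss \<beta> a * w a) = 0"
  shows "AE a in lborel. w a = 0"
proof -
  have "AE a in lborel. gauss (\<lambda>_. 0) a * w a = 0"
  proof (rule fourier_uniqueness[OF i])
    fix s :: "'n \<Rightarrow> real"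
    have "gauss (\<lambda>k. \<i> * of_real (s k)) a * w a = iexp (\<Sum>k\<in>UNIV. s k * a $ k) * (gauss (\<lambda>_. 0) a * w a)" for a
      by (simp add: gauss_def sum_subtractf sum_distrib_left mult.assoc sum_negf mult_exp_exp)
    then show "(CLINT a|lborel. iexp (\<Sum>k\<in>UNIV. s k * a $ k) * (gauss (\<lambda>_. 0) a * w a)) = 0"
      using zero[of "\<lambda>k. \<i> * of_real (s k)"] by (simp only:)
  qed
  then show ?thesis by (simp add: gauss_def)
qed

lemma gaussian_total:
  assumes "\<And>\<beta>. cinner f (gaussian \<beta>) = 0"
  shows "f = 0"
proof -
  have c: "cinner f (gaussian \<beta>) = (CLINT a|lborel. gauss \<beta> a * cnj (rep_l2 f a))" for \<beta>
    using cinner_abs_l2[OF sq_integrable_rep[of f] sq_integrable_gauss[of \<beta>]]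
    by (simp add: gaussian_def mult.commute)
  have "AE a in lborel. cnj (rep_l2 f a) = 0"
  proof (rule gauss_test_zero)
    show "integrable lborel (\<lambda>a. gauss (\<lambda>_. 0) a * cnj (rep_l2 f a))"
      using sq_integrable_prod[OF sq_integrable_rep[of f] sq_integrable_gauss[of "\<lambda>_. 0"]]
      by (simp add: mult.commute)
    show "(CLINT a|lborel. gauss \<beta> a * cnj (rep_l2 f a)) = 0" for \<beta>
      using assms[of \<beta>] unfolding c .
  qed
  then have "AE a in lborel. (cmod (rep_l2 f a))\<^sup>2 = 0" by simp
  then have "(norm f)\<^sup>2 = 0" unfolding norm_rep by (rule integral_eq_zero_AE)
  then show ?thesis by simp
qed

lemma cinner_gaussian:
  "cinner (gaussian \<beta>) (gaussian \<gamma> :: 'n::finite l2)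
     = of_real (sqrt pi ^ CARD('n)) * exp (\<Sum>k\<in>UNIV. (cnj (\<beta> k) + \<gamma> k)\<^sup>2 / 4)"
proof -
  have "cnj (gauss \<beta> a) * gauss \<gamma> a
      = exp (\<Sum>k\<in>UNIV. (cnj (\<beta> k) + \<gamma> k) * of_real (a $ k) - of_real ((a $ k)\<^sup>2))" for a :: "real^'n"
    unfolding gauss_def exp_cnj mult_exp_exp cnj_sum sum.distrib[symmetric]
    by (rule arg_cong[where f = exp], rule sum.cong) (simp_all add: field_simps)
  then show ?thesis
    unfolding gaussian_def cinner_abs_l2[OF sq_integrable_gauss sq_integrable_gauss]
    using gaussian_integral_cart(2)[of "\<lambda>k. cnj (\<beta> k) + \<gamma> k"] by simp
qed

lemma gauss_dominated_affine:
  fixes c :: "'n::finite \<Rightarrow> complex"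
  assumes f: "gauss_dominated f"
  shows "gauss_dominated (\<lambda>a. (c0 + (\<Sum>k\<in>UNIV. c k * of_real (a $ k))) * f a)"
proof -
  have "gauss_dominated (\<lambda>a. c0 * f a + (\<Sum>k\<in>UNIV. c k * (of_real (a $ k) * f a)))"
    by (intro gauss_dominated_add gauss_dominated_const_mult gauss_dominated_sum gauss_dominated_coord f)
  then show ?thesis by (simp add: distrib_right sum_distrib_right mult.assoc)
qed

text \<open>Integration by parts against the derivative \<open>\<beta>\<^sub>k - a\<^sub>k\<close> of the exponents.\<close>

lemma gaussian_first_moment:
  "cinner (gaussian \<beta>) (abs_l2 (\<lambda>a. of_real (a $ k) * gauss \<gamma> a))
     = (cnj (\<beta> k) + \<gamma> k) / 2 * cinner (gaussian \<beta>) (gaussian \<gamma> :: 'n::finite l2)"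
proof -
  note gd = gauss_dominated_gauss
  have d: "gauss_dominated (\<lambda>a. (\<beta> k - of_real (a $ k)) * gauss \<beta> a)" for \<beta> :: "'n \<Rightarrow> complex"
  proof -
    have "gauss_dominated (\<lambda>a. \<beta> k * gauss \<beta> a + (-1) * (of_real (a $ k) * gauss \<beta> a))"
      by (intro gauss_dominated_add gauss_dominated_const_mult gauss_dominated_coord gd)
    then show ?thesis by (simp add: algebra_simps)
  qed
  have c: "gauss_dominated (\<lambda>a. of_real (a $ k) * gauss \<beta> a)" for \<beta> :: "'n \<Rightarrow> complex"
    by (intro gauss_dominated_coord gd)
  define I where "I = (CLINT a|lborel. cnj (gauss \<beta> a) * gauss \<gamma> a)"
  define M where "M = (CLINT a|lborel. cnj (gauss \<beta> a) * (of_real (a $ k) * gauss \<gamma> a))"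
  have i: "integrable lborel (\<lambda>a. cnj (gauss \<beta> a) * gauss \<gamma> a)"
    "integrable lborel (\<lambda>a. cnj (gauss \<beta> a) * (of_real (a $ k) * gauss \<gamma> a))"
    by (intro sq_integrable_prod gauss_dominated_sq_integrable c gd)+
  have "(CLINT a|lborel. cnj ((\<beta> k - of_real (a $ k)) * gauss \<beta> a) * gauss \<gamma> a)
      = - (CLINT a|lborel. cnj (gauss \<beta> a) * ((\<gamma> k - of_real (a $ k)) * gauss \<gamma> a))"
    by (intro integration_by_parts[of k] partial_derivative_gauss gd d)
  also have "(CLINT a|lborel. cnj ((\<beta> k - of_real (a $ k)) * gauss \<beta> a) * gauss \<gamma> a)
     = (CLINT a|lborel. cnj (\<beta> k) * (cnj (gauss \<beta> a) * gauss \<gamma> a) - cnj (gauss \<beta> a) * (of_real (a $ k) * gauss \<gamma> a))"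
    by (rule Bochner_Integration.integral_cong) (simp_all add: algebra_simps)
  also have "\<dots> = cnj (\<beta> k) * I - M" using i by (simp add: I_def M_def)
  also have "(CLINT a|lborel. cnj (gauss \<beta> a) * ((\<gamma> k - of_real (a $ k)) * gauss \<gamma> a))
     = (CLINT a|lborel. \<gamma> k * (cnj (gauss \<beta> a) * gauss \<gamma> a) - cnj (gauss \<beta> a) * (of_real (a $ k) * gauss \<gamma> a))"
    by (rule Bochner_Integration.integral_cong) (simp_all add: algebra_simps)
  also have "\<dots> = \<gamma> k * I - M" using i by (simp add: I_def M_def)
  finally have "M = (cnj (\<beta> k) + \<gamma> k) / 2 * I" by (simp add: field_simps)
  then show ?thesis
    unfolding gaussian_def I_def M_def cinner_abs_l2[OF sq_integrable_gauss sq_integrable_gauss]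
      cinner_abs_l2[OF sq_integrable_gauss gauss_dominated_sq_integrable[OF c]] .
qed

lemma gaussian_affine_moment:
  fixes c :: "'n::finite \<Rightarrow> complex"
  shows "cinner (gaussian \<beta>) (abs_l2 (\<lambda>a. (c0 + (\<Sum>k\<in>UNIV. c k * of_real (a $ k))) * gauss \<gamma> a))
     = (c0 + (\<Sum>k\<in>UNIV. c k * ((cnj (\<beta> k) + \<gamma> k) / 2))) * cinner (gaussian \<beta>) (gaussian \<gamma>)"
proof -
  have sq: "sq_integrable (\<lambda>a. of_real (a $ k) * gauss \<gamma> a)" for k
    by (intro gauss_dominated_sq_integrable gauss_dominated_coord gauss_dominated_gauss)
  have sum: "sq_integrable (\<lambda>a. \<Sum>k\<in>K. c k * (of_real (a $ k) * gauss \<gamma> a)) \<and>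
      cinner (gaussian \<beta>) (abs_l2 (\<lambda>a. \<Sum>k\<in>K. c k * (of_real (a $ k) * gauss \<gamma> a)))
      = (\<Sum>k\<in>K. c k * ((cnj (\<beta> k) + \<gamma> k) / 2)) * cinner (gaussian \<beta>) (gaussian \<gamma>)" if "finite K" for K
    using that
  proof (induction K)
    case empty
    then show ?case by (simp add: sq_integrable_zero abs_l2_zero)
  next
    case (insert k K)
    then show ?case
      by (simp add: sq_integrable_add sq_integrable_scale sq abs_l2_add abs_l2_scale cinner_add_right
          gaussian_first_moment distrib_right mult.assoc)
  qed
  have "abs_l2 (\<lambda>a. (c0 + (\<Sum>k\<in>UNIV. c k * of_real (a $ k))) * gauss \<gamma> a)
      = abs_l2 (\<lambda>a. c0 * gauss \<gamma> a + (\<Sum>k\<in>UNIV. c k * (of_real (a $ k) * gauss \<gamma> a)))"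
    by (simp add: distrib_right sum_distrib_right mult.assoc)
  also have "\<dots> = c0 *\<^sub>C gaussian \<gamma> + abs_l2 (\<lambda>a. \<Sum>k\<in>UNIV. c k * (of_real (a $ k) * gauss \<gamma> a))"
    using sum[of UNIV] by (simp add: abs_l2_add abs_l2_scale sq_integrable_scale sq_integrable_gauss gaussian_def)
  finally show ?thesis using sum[of UNIV] by (simp add: cinner_add_right distrib_right)
qed

section \<open>Partial Fourier transforms\<close>

text \<open>In one variable the unitary Fourier transform of \<open>exp (\<beta> a - a\<^sup>2/2)\<close> is
  \<open>exp (\<beta>\<^sup>2/2) exp (- \<i> \<beta> \<xi> - \<xi>\<^sup>2/2)\<close>.  This formula is applied to the coordinates in \<open>J\<close>.\<close>

definition fourier_parameter :: "'n set \<Rightarrow> ('n \<Rightarrow> complex) \<Rightarrow> 'n \<Rightarrow> complex" where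
  "fourier_parameter J \<beta> k = (if k \<in> J then - \<i> * \<beta> k else \<beta> k)"

definition fourier_factor :: "'n set \<Rightarrow> ('n \<Rightarrow> complex) \<Rightarrow> complex" where
  "fourier_factor J \<beta> = exp (\<Sum>k\<in>J. (\<beta> k)\<^sup>2 / 2)"

text \<open>In each transformed coordinate,
  \<open>(cnj \<beta>)\<^sup>2/2 + \<gamma>\<^sup>2/2 - (cnj \<beta> - \<gamma>)\<^sup>2/4 = (cnj \<beta> + \<gamma>)\<^sup>2/4\<close>.\<close>

lemma fourier_gram:
  "cinner (fourier_factor J \<beta> *\<^sub>C gaussian (fourier_parameter J \<beta>))
      (fourier_factor J \<gamma> *\<^sub>C gaussian (fourier_parameter J \<gamma>))
    = cinner (gaussian \<beta>) (gaussian \<gamma> :: 'n::finite l2)"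
proof -
  have J: "(\<Sum>k\<in>J. f k) = (\<Sum>k\<in>UNIV. if k \<in> J then f k else 0)" for f :: "'n \<Rightarrow> complex"
    by (simp add: sum.If_cases)
  have "cnj (fourier_factor J \<beta>) * fourier_factor J \<gamma> *
      exp (\<Sum>k\<in>UNIV. (cnj (fourier_parameter J \<beta> k) + fourier_parameter J \<gamma> k)\<^sup>2 / 4)
    = exp (\<Sum>k\<in>UNIV. (cnj (\<beta> k) + \<gamma> k)\<^sup>2 / 4)"
    unfolding fourier_factor_def exp_cnj cnj_sum J mult_exp_exp sum.distrib[symmetric]
    by (rule arg_cong[where f = exp], rule sum.cong)
      (auto simp: fourier_parameter_def power2_eq_square field_simps)
  then show ?thesis by (simp add: cinner_gaussian mult_ac)
qed

lemma surj_fourier_parameter: "\<exists>\<beta>. fourier_parameter J \<beta> = \<gamma>"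
  by (rule exI[of _ "\<lambda>k. if k \<in> J then \<i> * \<gamma> k else \<gamma> k"]) (auto simp: fourier_parameter_def)

lemma fourier_factor_nonzero: "fourier_factor J \<beta> \<noteq> 0"
  by (simp add: fourier_factor_def)

text \<open>The isometric extension is taken over the real scalars, for the family of all complex multiples of
  Gaussians.  Surjectivity comes from the extension in the opposite direction, and complex linearity
  from testing against the images of the family, which are again total.\<close>

lemma partial_fourier_exists:
  fixes J :: "'n::finite set"
  shows "\<exists>F. unitary_op F \<and>
    (\<forall>\<beta>. F (gaussian \<beta>) = fourier_factor J \<beta> *\<^sub>C gaussian (fourier_parameter J \<beta>))"
proof -
  define G where "G p = fst p *\<^sub>C gaussian (snd p)" for p :: "complex \<times> ('n \<Rightarrow> complex)"
  define H where "H p = fst p *\<^sub>C (fourier_factor J (snd p) *\<^sub>C gaussian (fourier_parameter J (snd p)))"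
    for p :: "complex \<times> ('n \<Rightarrow> complex)"
  have gram: "cinner (H p) (H q) = cinner (G p) (G q)" for p q
    unfolding G_def H_def cinner_scale_left[of "fst p"] cinner_scale_right[of _ "fst q"] fourier_gram ..
  have ig: "inner (G p) (G q) = inner (H p) (H q)" for p q by (simp add: gram flip: Re_cinner)
  have totalG: "x = 0" if "\<And>p. inner x (G p) = 0" for x
  proof (rule gaussian_total)
    fix \<beta>
    show "cinner x (gaussian \<beta>) = 0"
      using that[of "(1, \<beta>)"] that[of "(\<i>, \<beta>)"] unfolding cinner_eq_inner[of x "gaussian \<beta>"]
      by (simp add: G_def zero_complex.code)
  qed
  have totalH: "x = 0" if "\<And>p. inner x (H p) = 0" for x
  proof (rule totalG)
    fix p :: "complex \<times> ('n \<Rightarrow> complex)"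
    obtain \<beta> where b: "fourier_parameter J \<beta> = snd p" using surj_fourier_parameter by blast
    have "G p = H (fst p / fourier_factor J \<beta>, \<beta>)"
      using fourier_factor_nonzero[of J \<beta>] by (simp add: G_def H_def b)
    then show "inner x (G p) = 0" using that by simp
  qed
  have dense: "closure (span (range K)) = UNIV" if K: "\<And>x. (\<And>p. inner x (K p) = 0) \<Longrightarrow> x = 0"
    for K :: "complex \<times> ('n \<Rightarrow> complex) \<Rightarrow> 'n l2"
  proof (rule orthogonal_trivial_imp_dense[OF subspace_span])
    fix x assume x: "\<And>v. v \<in> span (range K) \<Longrightarrow> inner v x = 0"
    show "x = 0" by (rule K) (metis inner_commute x rangeI span_base)
  qed
  obtain F where F: "bounded_linear F" "\<And>x y. inner (F x) (F y) = inner x y" "\<And>p. F (G p) = H p"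
    using isometric_extension[of G H, OF ig dense[OF totalG]] by blast
  obtain F' where F': "bounded_linear F'" "\<And>x y. inner (F' x) (F' y) = inner x y" "\<And>p. F' (H p) = G p"
    using isometric_extension[of H G, OF ig[symmetric] dense[OF totalH]] by blast
  have "F (F' x) = x" for x
  proof -
    have "F (F' x) - x = 0"
    proof (rule totalH)
      fix p
      have "inner (F (F' x)) (H p) = inner (F' x) (G p)" using F(2)[of "F' x" "G p"] F(3) by simp
      also have "\<dots> = inner x (H p)" using F'(2)[of x "H p"] F'(3) by simp
      finally show "inner (F (F' x) - x) (H p) = 0" by (simp add: inner_diff_left)
    qed
    then show ?thesis by simp
  qed
  then have surj: "surj F" by (metis surjI)
  have innerI: "inner (\<i> *\<^sub>C x) y = - inner x (\<i> *\<^sub>C y)" for x y :: "'n l2"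
    by (simp flip: Re_cinner)
  have Fi: "F (\<i> *\<^sub>C x) = \<i> *\<^sub>C F x" for x
  proof -
    have "F (\<i> *\<^sub>C x) - \<i> *\<^sub>C F x = 0"
    proof (rule totalH)
      fix p
      have "inner (F (\<i> *\<^sub>C x)) (H p) = inner (\<i> *\<^sub>C x) (G p)" using F(2)[of "\<i> *\<^sub>C x" "G p"] F(3) by simp
      moreover have "inner (\<i> *\<^sub>C F x) (H p) = - inner x (\<i> *\<^sub>C G p)"
      proof -
        have "\<i> *\<^sub>C G p = G (\<i> * fst p, snd p)" "\<i> *\<^sub>C H p = H (\<i> * fst p, snd p)"
          by (simp_all add: G_def H_def mult.assoc)
        then have "inner (F x) (\<i> *\<^sub>C H p) = inner x (\<i> *\<^sub>C G p)"
          using F(2)[of x "G (\<i> * fst p, snd p)"] F(3) by simp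
        then show ?thesis by (simp add: innerI)
      qed
      ultimately show "inner (F (\<i> *\<^sub>C x) - \<i> *\<^sub>C F x) (H p) = 0"
        by (simp add: inner_diff_left innerI)
    qed
    then show ?thesis by simp
  qed
  have "cinner (F x) (F y) = cinner x y" for x y
    unfolding cinner_eq_inner Fi[symmetric] F(2) ..
  then have "unitary_op F" using surj by (simp add: unitary_op_def)
  moreover have "F (gaussian \<beta>) = fourier_factor J \<beta> *\<^sub>C gaussian (fourier_parameter J \<beta>)" for \<beta>
    using F(3)[of "(1, \<beta>)"] by (simp add: G_def H_def)
  ultimately show ?thesis by blast
qed

definition partial_fourier :: "'n::finite set \<Rightarrow> 'n l2 \<Rightarrow> 'n l2" where
  "partial_fourier J = (SOME F. unitary_op F \<and>
    (\<forall>\<beta>. F (gaussian \<beta>) = fourier_factor J \<beta> *\<^sub>C gaussian (fourier_parameter J \<beta>)))"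

lemma partial_fourier:
  "unitary_op (partial_fourier J)"
  "partial_fourier J (gaussian \<beta>) = fourier_factor J \<beta> *\<^sub>C gaussian (fourier_parameter J \<beta>)"
  using someI_ex[OF partial_fourier_exists[of J]] unfolding partial_fourier_def by blast+

section \<open>Weyl operators and their adjoints\<close>

text \<open>The operator \<open>\<i> \<kappa> \<partial>/\<partial>a\<^sub>i + \<Sum>k. r\<^sub>k a\<^sub>k\<close>, with the derivative passed as an argument.\<close>

definition weyl_op :: "real \<Rightarrow> ('n::finite \<Rightarrow> real) \<Rightarrow> (real^'n \<Rightarrow> complex) \<Rightarrow> (real^'n \<Rightarrow> complex) \<Rightarrow> real^'n \<Rightarrow> complex" where
  "weyl_op \<kappa> r f f' a = \<i> * of_real \<kappa> * f' a + of_real (\<Sum>k\<in>UNIV. r k * a $ k) * f a"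

definition weyl_gauss :: "real \<Rightarrow> ('n::finite \<Rightarrow> real) \<Rightarrow> 'n \<Rightarrow> ('n \<Rightarrow> complex) \<Rightarrow> real^'n \<Rightarrow> complex" where
  "weyl_gauss \<kappa> r i \<beta> = weyl_op \<kappa> r (gauss \<beta>) (\<lambda>a. (\<beta> i - of_real (a $ i)) * gauss \<beta> a)"

text \<open>The Weyl operator on the Gaussians only, without their linear span, which has the same adjoint.\<close>

definition gauss_graph :: "real \<Rightarrow> ('n::finite \<Rightarrow> real) \<Rightarrow> 'n \<Rightarrow> 'n unbounded_op" where
  "gauss_graph \<kappa> r i = range (\<lambda>\<beta>. (gaussian \<beta>, abs_l2 (weyl_gauss \<kappa> r i \<beta>)))"

definition fourier_symbol :: "real \<Rightarrow> ('n::finite \<Rightarrow> real) \<Rightarrow> 'n \<Rightarrow> real^'n \<Rightarrow> real" where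
  "fourier_symbol \<kappa> r i a = (\<Sum>k\<in>UNIV. r k * a $ k) - \<kappa> * a $ i"

lemma gauss_dominated_weyl_op:
  assumes "gauss_dominated f" "gauss_dominated f'"
  shows "gauss_dominated (weyl_op \<kappa> r f f')"
proof -
  have "gauss_dominated (\<lambda>a. (\<i> * of_real \<kappa>) * f' a + (0 + (\<Sum>k\<in>UNIV. of_real (r k) * of_real (a $ k))) * f a)"
    by (intro gauss_dominated_add gauss_dominated_const_mult gauss_dominated_affine assms)
  then show ?thesis unfolding weyl_op_def[abs_def] by simp
qed

lemma gauss_dominated_gauss_derivative: "gauss_dominated (\<lambda>a. (\<beta> i - of_real (a $ i)) * gauss \<beta> a)"
proof -
  have "gauss_dominated (\<lambda>a. \<beta> i * gauss \<beta> a + (-1) * (of_real (a $ i) * gauss \<beta> a))"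
    by (intro gauss_dominated_add gauss_dominated_const_mult gauss_dominated_coord gauss_dominated_gauss)
  then show ?thesis by (simp add: algebra_simps)
qed

lemma sq_integrable_weyl_gauss: "sq_integrable (weyl_gauss \<kappa> r i \<beta>)"
  unfolding weyl_gauss_def
  by (intro gauss_dominated_sq_integrable gauss_dominated_weyl_op gauss_dominated_gauss gauss_dominated_gauss_derivative)

lemma linear_form_split:
  fixes r :: "'n::finite \<Rightarrow> real"
  shows "(\<Sum>k\<in>UNIV. (of_real (r k) - (if k = i then z else 0)) * x k) = (\<Sum>k\<in>UNIV. of_real (r k) * x k) - z * (x i :: complex)"
  by (simp add: left_diff_distrib sum_subtractf if_distrib[of "\<lambda>c. c * _"] cong: if_cong)

lemma weyl_gauss_affine:
  "weyl_gauss \<kappa> r i \<beta> = (\<lambda>a. (\<i> * of_real \<kappa> * \<beta> i +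
     (\<Sum>k\<in>UNIV. (of_real (r k) - (if k = i then \<i> * of_real \<kappa> else 0)) * of_real (a $ k))) * gauss \<beta> a)"
  unfolding linear_form_split by (rule ext) (simp add: weyl_gauss_def weyl_op_def algebra_simps)

lemma fourier_symbol_affine:
  "of_real (fourier_symbol \<kappa> r i a) =
     0 + (\<Sum>k\<in>UNIV. (of_real (r k) - (if k = i then of_real \<kappa> else 0)) * complex_of_real (a $ k))"
  unfolding linear_form_split by (simp add: fourier_symbol_def)

lemma gauss_dominated_fourier_symbol: "gauss_dominated (\<lambda>a. of_real (fourier_symbol \<kappa> r i a) * gauss \<beta> a)"
  unfolding fourier_symbol_affine by (rule gauss_dominated_affine[OF gauss_dominated_gauss])

lemma measurable_fourier_symbol: "fourier_symbol \<kappa> r i \<in> borel_measurable borel"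
  unfolding fourier_symbol_def[abs_def] by (intro borel_measurable_continuous_onI continuous_intros)

text \<open>Both sides have the same inner products with the transformed Gaussians.  The coefficients \<open>r\<close>
  vanish on \<open>J\<close>, so the transform leaves the multiplication part alone and turns \<open>\<i> \<partial>/\<partial>a\<^sub>i\<close> into
  multiplication by \<open>- a\<^sub>i\<close>.\<close>

lemma partial_fourier_weyl_gauss:
  assumes i: "i \<in> J" and r: "\<And>k. k \<in> J \<Longrightarrow> r k = 0"
  shows "partial_fourier J (abs_l2 (weyl_gauss \<kappa> r i \<beta>)) =
    fourier_factor J \<beta> *\<^sub>C abs_l2 (\<lambda>a. of_real (fourier_symbol \<kappa> r i a) * gauss (fourier_parameter J \<beta>) a)"
proof -
  let ?F = "partial_fourier J"
  have "?F (abs_l2 (weyl_gauss \<kappa> r i \<beta>)) -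
    fourier_factor J \<beta> *\<^sub>C abs_l2 (\<lambda>a. of_real (fourier_symbol \<kappa> r i a) * gauss (fourier_parameter J \<beta>) a) = 0" (is "?L - ?R = 0")
  proof (rule gaussian_total)
    fix \<gamma>'
    obtain \<gamma> where \<gamma>: "fourier_parameter J \<gamma> = \<gamma>'" using surj_fourier_parameter by blast
    have "cinner (?F (gaussian \<gamma>)) ?L = cinner (?F (gaussian \<gamma>)) ?R"
    proof -
      have "cinner (?F (gaussian \<gamma>)) ?L = cinner (gaussian \<gamma>) (abs_l2 (weyl_gauss \<kappa> r i \<beta>))"
        by (rule unitary_cinner[OF partial_fourier(1)])
      also have "\<dots> = (\<i> * of_real \<kappa> * \<beta> i + (\<Sum>k\<in>UNIV. of_real (r k) * ((cnj (\<gamma> k) + \<beta> k) / 2))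
          - \<i> * of_real \<kappa> * ((cnj (\<gamma> i) + \<beta> i) / 2)) * cinner (gaussian \<gamma>) (gaussian \<beta>)"
        unfolding weyl_gauss_affine gaussian_affine_moment unfolding linear_form_split by simp
      also have "(\<Sum>k\<in>UNIV. of_real (r k) * ((cnj (\<gamma> k) + \<beta> k) / 2))
          = (\<Sum>k\<in>UNIV. of_real (r k) * ((cnj (fourier_parameter J \<gamma> k) + fourier_parameter J \<beta> k) / 2))"
        by (rule sum.cong) (auto simp: fourier_parameter_def r)
      also have "\<i> * of_real \<kappa> * \<beta> i + (\<Sum>k\<in>UNIV. of_real (r k) * ((cnj (fourier_parameter J \<gamma> k) + fourier_parameter J \<beta> k) / 2))
          - \<i> * of_real \<kappa> * ((cnj (\<gamma> i) + \<beta> i) / 2)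
        = 0 + ((\<Sum>k\<in>UNIV. of_real (r k) * ((cnj (fourier_parameter J \<gamma> k) + fourier_parameter J \<beta> k) / 2))
          - of_real \<kappa> * ((cnj (fourier_parameter J \<gamma> i) + fourier_parameter J \<beta> i) / 2))"
        using i by (simp add: fourier_parameter_def field_simps)
      also have "\<dots> * cinner (gaussian \<gamma>) (gaussian \<beta>) = cinner (?F (gaussian \<gamma>)) ?R"
        unfolding fourier_gram[of J \<gamma> \<beta>, symmetric] partial_fourier(2) fourier_symbol_affine
          cinner_scale_left[of "fourier_factor J \<gamma>"] cinner_scale_right[of _ "fourier_factor J \<beta>"] gaussian_affine_moment
        unfolding linear_form_split by (simp add: mult_ac)
      finally show ?thesis .
    qed
    then have "cnj (fourier_factor J \<gamma>) * cinner (gaussian \<gamma>') (?L - ?R) = 0"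
      by (simp add: partial_fourier(2) \<gamma> cinner_diff_right right_diff_distrib)
    then have "cinner (gaussian \<gamma>') (?L - ?R) = 0" by (simp add: fourier_factor_nonzero)
    then show "cinner (?L - ?R) (gaussian \<gamma>') = 0" using cinner_commute[of "?L - ?R" "gaussian \<gamma>'"] by simp
  qed
  then show ?thesis by simp
qed

text \<open>Membership of \<open>(u, v)\<close> in the adjoint says that the transforms satisfy
  \<open>\<integral> gauss \<beta> * (g * cnj (F u) - cnj (F v)) = 0\<close> for all \<open>\<beta>\<close>, where \<open>g\<close> is the symbol.  By
  \<open>gauss_test_zero\<close> this means \<open>F v = g * F u\<close> almost everywhere.\<close>

theorem adjoint_gauss_graph:
  assumes i: "i \<in> J" and r: "\<And>k. k \<in> J \<Longrightarrow> r k = 0"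
  shows "adjoint_op (gauss_graph \<kappa> r i) = mult_graph (partial_fourier J) (fourier_symbol \<kappa> r i)"
proof -
  let ?F = "partial_fourier J" and ?g = "fourier_symbol \<kappa> r i"
  note sqg = gauss_dominated_sq_integrable[OF gauss_dominated_fourier_symbol]
  have test: "(\<forall>\<beta>. cinner u (abs_l2 (weyl_gauss \<kappa> r i \<beta>)) = cinner v (gaussian \<beta>))
     \<longleftrightarrow> (AE a in lborel. rep_l2 (?F v) a = of_real (?g a) * rep_l2 (?F u) a)" for u v
  proof -
    have ig: "integrable lborel (\<lambda>a. cnj (rep_l2 f a) * (of_real (?g a) * gauss \<beta> a))"
      "integrable lborel (\<lambda>a. cnj (rep_l2 f a) * gauss \<beta> a)" for f \<beta>
      by (rule sq_integrable_prod[OF sq_integrable_rep sqg])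
         (rule sq_integrable_prod[OF sq_integrable_rep sq_integrable_gauss])
    define w where "w a = of_real (?g a) * cnj (rep_l2 (?F u) a) - cnj (rep_l2 (?F v) a)" for a
    have wsplit: "gauss \<beta> a * w a = cnj (rep_l2 (?F u) a) * (of_real (?g a) * gauss \<beta> a) - cnj (rep_l2 (?F v) a) * gauss \<beta> a" for \<beta> a
      by (simp add: w_def algebra_simps)
    have iw: "integrable lborel (\<lambda>a. gauss \<beta> a * w a)" for \<beta>
      unfolding wsplit by (intro Bochner_Integration.integrable_diff ig)
    have key: "cinner u (abs_l2 (weyl_gauss \<kappa> r i \<beta>)) - cinner v (gaussian \<beta>)
        = fourier_factor J \<beta> * (CLINT a|lborel. gauss (fourier_parameter J \<beta>) a * w a)" for \<beta>
    proof -
      have a1: "cinner u (abs_l2 (weyl_gauss \<kappa> r i \<beta>)) = fourier_factor J \<beta> *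
          (CLINT a|lborel. cnj (rep_l2 (?F u) a) * (of_real (?g a) * gauss (fourier_parameter J \<beta>) a))"
      proof -
        have "cinner u (abs_l2 (weyl_gauss \<kappa> r i \<beta>)) = cinner (?F u) (?F (abs_l2 (weyl_gauss \<kappa> r i \<beta>)))"
          by (rule unitary_cinner[OF partial_fourier(1), symmetric])
        also have "\<dots> = fourier_factor J \<beta> * cinner (abs_l2 (rep_l2 (?F u)))
            (abs_l2 (\<lambda>a. of_real (?g a) * gauss (fourier_parameter J \<beta>) a))"
          by (simp add: partial_fourier_weyl_gauss[OF i r])
        finally show ?thesis unfolding cinner_abs_l2[OF sq_integrable_rep sqg] .
      qed
      have a2: "cinner v (gaussian \<beta>) = fourier_factor J \<beta> *
          (CLINT a|lborel. cnj (rep_l2 (?F v) a) * gauss (fourier_parameter J \<beta>) a)"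
      proof -
        have "cinner v (gaussian \<beta>) = cinner (?F v) (?F (gaussian \<beta>))"
          by (rule unitary_cinner[OF partial_fourier(1), symmetric])
        also have "\<dots> = fourier_factor J \<beta> * cinner (abs_l2 (rep_l2 (?F v))) (abs_l2 (gauss (fourier_parameter J \<beta>)))"
          unfolding partial_fourier(2) cinner_scale_right by (simp add: gaussian_def)
        finally show ?thesis unfolding cinner_abs_l2[OF sq_integrable_rep sq_integrable_gauss] .
      qed
      show ?thesis unfolding a1 a2 wsplit using ig by (simp add: right_diff_distrib)
    qed
    have "cinner u (abs_l2 (weyl_gauss \<kappa> r i \<beta>)) = cinner v (gaussian \<beta>)
       \<longleftrightarrow> (CLINT a|lborel. gauss (fourier_parameter J \<beta>) a * w a) = 0" for \<beta>
      unfolding eq_iff_diff_eq_0[of "cinner u (abs_l2 (weyl_gauss \<kappa> r i \<beta>))"] key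
      by (simp add: fourier_factor_nonzero)
    then have "(\<forall>\<beta>. cinner u (abs_l2 (weyl_gauss \<kappa> r i \<beta>)) = cinner v (gaussian \<beta>))
       \<longleftrightarrow> (\<forall>\<beta>. (CLINT a|lborel. gauss (fourier_parameter J \<beta>) a * w a) = 0)"
      by (simp only:)
    also have "\<dots> \<longleftrightarrow> (\<forall>\<beta>. (CLINT a|lborel. gauss \<beta> a * w a) = 0)"
      using surj_fourier_parameter by metis
    also have "\<dots> \<longleftrightarrow> (AE a in lborel. w a = 0)"
    proof
      assume "\<forall>\<beta>. (CLINT a|lborel. gauss \<beta> a * w a) = 0"
      then show "AE a in lborel. w a = 0" by (intro gauss_test_zero iw) auto
    next
      assume *: "AE a in lborel. w a = 0"
      show "\<forall>\<beta>. (CLINT a|lborel. gauss \<beta> a * w a) = 0"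
      proof
        fix \<beta>
        have "AE a in lborel. gauss \<beta> a * w a = 0" using * by eventually_elim simp
        then show "(CLINT a|lborel. gauss \<beta> a * w a) = 0" by (rule integral_eq_zero_AE)
      qed
    qed
    also have "\<dots> \<longleftrightarrow> (AE a in lborel. rep_l2 (?F v) a = of_real (?g a) * rep_l2 (?F u) a)"
    proof (rule AE_cong)
      fix a
      have "w a = cnj (of_real (?g a) * rep_l2 (?F u) a - rep_l2 (?F v) a)" by (simp add: w_def)
      then show "w a = 0 \<longleftrightarrow> rep_l2 (?F v) a = of_real (?g a) * rep_l2 (?F u) a"
        unfolding complex_cnj_zero_iff by (auto simp del: complex_cnj_diff)
    qed
    finally show ?thesis .
  qed
  show ?thesis
    unfolding mult_graph_def test[symmetric] by (auto simp: adjoint_op_def gauss_graph_def)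
qed

lemma weyl_op_in_adjoint:
  assumes d: "partial_derivative i f f'" and gd: "gauss_dominated f" "gauss_dominated f'"
  shows "(abs_l2 f, abs_l2 (weyl_op \<kappa> r f f')) \<in> adjoint_op (gauss_graph \<kappa> r i)"
proof -
  have "cinner (abs_l2 f) (abs_l2 (weyl_gauss \<kappa> r i \<beta>)) = cinner (abs_l2 (weyl_op \<kappa> r f f')) (gaussian \<beta>)" for \<beta>
  proof -
    let ?G = "gauss \<beta>" and ?G' = "\<lambda>a. (\<beta> i - of_real (a $ i)) * gauss \<beta> a"
    let ?l = "\<lambda>a :: real^'a. complex_of_real (\<Sum>k\<in>UNIV. r k * a $ k)"
    note G = gauss_dominated_gauss[of \<beta>] gauss_dominated_gauss_derivative[of \<beta> i]
    have lG: "gauss_dominated (\<lambda>a. ?l a * ?G a)"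
      using gauss_dominated_affine[OF G(1), of 0 "\<lambda>k. of_real (r k)"] by simp
    have i1: "integrable lborel (\<lambda>a. cnj (f a) * ?G' a)" "integrable lborel (\<lambda>a. cnj (f a) * (?l a * ?G a))"
      "integrable lborel (\<lambda>a. cnj (f' a) * ?G a)"
      by (intro gauss_dominated_integrable gauss_dominated_mult gauss_dominated_cnj gd G lG)+
    have "cinner (abs_l2 f) (abs_l2 (weyl_gauss \<kappa> r i \<beta>)) = (CLINT a|lborel. cnj (f a) * weyl_gauss \<kappa> r i \<beta> a)"
      by (rule cinner_abs_l2[OF gauss_dominated_sq_integrable[OF gd(1)] sq_integrable_weyl_gauss])
    also have "\<dots> = (CLINT a|lborel. \<i> * of_real \<kappa> * (cnj (f a) * ?G' a) + cnj (f a) * (?l a * ?G a))"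
      by (rule Bochner_Integration.integral_cong) (simp_all add: weyl_gauss_def weyl_op_def algebra_simps)
    also have "\<dots> = \<i> * of_real \<kappa> * (CLINT a|lborel. cnj (f a) * ?G' a) + (CLINT a|lborel. cnj (f a) * (?l a * ?G a))"
      using i1 by simp
    also have "(CLINT a|lborel. cnj (f a) * ?G' a) = - (CLINT a|lborel. cnj (f' a) * ?G a)"
      using integration_by_parts[OF d partial_derivative_gauss[of i \<beta>] gd G] by simp
    also have "\<i> * of_real \<kappa> * - (CLINT a|lborel. cnj (f' a) * ?G a) + (CLINT a|lborel. cnj (f a) * (?l a * ?G a))
       = (CLINT a|lborel. (- (\<i> * of_real \<kappa>)) * (cnj (f' a) * ?G a) + cnj (f a) * (?l a * ?G a))"
      using i1 by simp
    also have "\<dots> = (CLINT a|lborel. cnj (weyl_op \<kappa> r f f' a) * ?G a)"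
      by (rule Bochner_Integration.integral_cong) (simp_all add: weyl_op_def algebra_simps)
    also have "\<dots> = cinner (abs_l2 (weyl_op \<kappa> r f f')) (gaussian \<beta>)"
      unfolding gaussian_def
      by (rule cinner_abs_l2[OF gauss_dominated_sq_integrable[OF gauss_dominated_weyl_op[OF gd]] sq_integrable_gauss, symmetric])
    finally show ?thesis .
  qed
  then show ?thesis by (auto simp: adjoint_op_def gauss_graph_def)
qed

section \<open>Essential self-adjointness on the core\<close>

lemma real_polynomial_directional:
  fixes p :: "real^'n::finite \<Rightarrow> real"
  assumes "real_polynomial_function p"
  shows "\<exists>p'. real_polynomial_function p' \<and>
    (\<forall>a. ((\<lambda>t. p (a + t *\<^sub>R axis i 1)) has_vector_derivative p' a) (at 0))"
  using assms
proof (induction rule: real_polynomial_function.induct)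
  case (linear f)
  interpret f: bounded_linear f by (rule linear)
  have "((\<lambda>t. f (a + t *\<^sub>R axis i 1)) has_vector_derivative f (axis i 1)) (at 0)" for a
    unfolding f.add f.scaleR by (auto intro!: derivative_eq_intros)
  then show ?case by (intro exI[of _ "\<lambda>_. f (axis i 1)"] conjI allI real_polynomial_function.intros(2))
next
  case (const c)
  show ?case by (rule exI[of _ "\<lambda>_. 0"]) (auto intro: real_polynomial_function.intros(2))
next
  case (add f g)
  then obtain f' g' where
    "real_polynomial_function f'" "\<forall>a. ((\<lambda>t. f (a + t *\<^sub>R axis i 1)) has_vector_derivative f' a) (at 0)"
    "real_polynomial_function g'" "\<forall>a. ((\<lambda>t. g (a + t *\<^sub>R axis i 1)) has_vector_derivative g' a) (at 0)"
    by blast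
  then show ?case
    by (intro exI[of _ "\<lambda>a. f' a + g' a"]) (auto intro: real_polynomial_function.intros(3) has_vector_derivative_add)
next
  case (mult f g)
  then obtain f' g' where
    *: "real_polynomial_function f'" "\<forall>a. ((\<lambda>t. f (a + t *\<^sub>R axis i 1)) has_vector_derivative f' a) (at 0)"
    "real_polynomial_function g'" "\<forall>a. ((\<lambda>t. g (a + t *\<^sub>R axis i 1)) has_vector_derivative g' a) (at 0)"
    by blast
  have "((\<lambda>t. f (a + t *\<^sub>R axis i 1) * g (a + t *\<^sub>R axis i 1)) has_vector_derivative f a * g' a + f' a * g a) (at 0)" for a
    using has_vector_derivative_mult[OF *(2)[rule_format] *(4)[rule_format], of a a] by simp
  then show ?case
    using * mult by (intro exI[of _ "\<lambda>a. f a * g' a + f' a * g a"])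
      (auto intro: real_polynomial_function.intros)
qed

lemma real_polynomial_growth:
  fixes p :: "real^'n::finite \<Rightarrow> real"
  assumes "real_polynomial_function p" "0 < \<epsilon>"
  shows "\<exists>K. \<forall>a. \<bar>p a\<bar> \<le> K * exp (\<epsilon> * (norm a)\<^sup>2)"
  using assms
proof (induction arbitrary: \<epsilon> rule: real_polynomial_function.induct)
  case (linear f)
  obtain c where c: "0 < c" "\<And>a. norm (f a) \<le> norm a * c"
    using bounded_linear.pos_bounded[OF linear(1)] by blast
  have "\<bar>f a\<bar> \<le> (1 + c\<^sup>2 / \<epsilon>) * exp (\<epsilon> * (norm a)\<^sup>2)" for a
    using exp_growth_linear[OF linear(2), of c "norm a"] c(1) c(2)[of a] by (simp add: mult.commute)
  then show ?case by blast
next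
  case (const c)
  have "\<bar>c\<bar> \<le> \<bar>c\<bar> * exp (\<epsilon> * (norm a)\<^sup>2)" for a :: "real^'n"
    using mult_left_mono[of 1 "exp (\<epsilon> * (norm a)\<^sup>2)" "\<bar>c\<bar>"] const by simp
  then show ?case by blast
next
  case (add f g)
  obtain K L where "\<And>a. \<bar>f a\<bar> \<le> K * exp (\<epsilon> * (norm a)\<^sup>2)" "\<And>a. \<bar>g a\<bar> \<le> L * exp (\<epsilon> * (norm a)\<^sup>2)"
    using add.IH[OF add.prems] by blast
  then have "\<bar>f a + g a\<bar> \<le> (K + L) * exp (\<epsilon> * (norm a)\<^sup>2)" for a
    using abs_triangle_ineq[of "f a" "g a"] by (smt (verit) distrib_right)
  then show ?case by blast
next
  case (mult f g)
  have "0 < \<epsilon> / 2" using mult.prems by simp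
  then obtain K L where KL: "\<And>a. \<bar>f a\<bar> \<le> K * exp (\<epsilon> / 2 * (norm a)\<^sup>2)" "\<And>a. \<bar>g a\<bar> \<le> L * exp (\<epsilon> / 2 * (norm a)\<^sup>2)"
    using mult.IH by meson
  have "\<bar>f a * g a\<bar> \<le> (K * L) * exp (\<epsilon> * (norm a)\<^sup>2)" for a
  proof -
    have "\<bar>f a * g a\<bar> \<le> (K * exp (\<epsilon> / 2 * (norm a)\<^sup>2)) * (L * exp (\<epsilon> / 2 * (norm a)\<^sup>2))"
      unfolding abs_mult using KL order_trans[OF abs_ge_zero KL(1)[of a]] by (intro mult_mono) auto
    also have "\<dots> = (K * L) * (exp (\<epsilon> / 2 * (norm a)\<^sup>2) * exp (\<epsilon> / 2 * (norm a)\<^sup>2))" by simp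
    also have "exp (\<epsilon> / 2 * (norm a)\<^sup>2) * exp (\<epsilon> / 2 * (norm a)\<^sup>2) = exp (\<epsilon> * (norm a)\<^sup>2)"
      unfolding mult_exp_exp by simp
    finally show ?thesis .
  qed
  then show ?case by blast
qed

lemma polynomial_function_components:
  fixes P :: "real^'n::finite \<Rightarrow> complex"
  assumes "polynomial_function P"
  shows "real_polynomial_function (\<lambda>a. Re (P a))" "real_polynomial_function (\<lambda>a. Im (P a))"
  using assms bounded_linear_Re bounded_linear_Im by (auto simp: polynomial_function_def o_def)

text \<open>Polynomials grow more slowly than every Gaussian.\<close>

lemma polynomial_times_dominated:
  fixes P f :: "real^'n::finite \<Rightarrow> complex"
  assumes re: "real_polynomial_function (\<lambda>a. Re (P a))" and im: "real_polynomial_function (\<lambda>a. Im (P a))"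
    and f: "gauss_dominated f"
  shows "gauss_dominated (\<lambda>a. P a * f a)"
proof -
  have r: "gauss_dominated (\<lambda>a. of_real (p a) * f a)" if "real_polynomial_function p" for p
  proof (rule gauss_dominated_mult_bounded_growth[OF f])
    show "continuous_on UNIV (\<lambda>a. complex_of_real (p a))"
      by (intro continuous_on_of_real continuous_on_polymonial_function)
        (use that in \<open>simp add: real_polynomial_function_eq\<close>)
  qed (use real_polynomial_growth[OF that] in simp)
  have "gauss_dominated (\<lambda>a. of_real (Re (P a)) * f a + \<i> * (of_real (Im (P a)) * f a))"
    by (intro gauss_dominated_add gauss_dominated_const_mult r re im)
  moreover have "of_real (Re (P a)) * f a + \<i> * (of_real (Im (P a)) * f a) = P a * f a" for a
  proof -
    have "of_real (Re (P a)) * f a + \<i> * (of_real (Im (P a)) * f a)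
        = (of_real (Re (P a)) + \<i> * of_real (Im (P a))) * f a" by (simp add: algebra_simps)
    then show ?thesis by (simp flip: complex_eq)
  qed
  ultimately show ?thesis by simp
qed

lemma gauss_poly_regular:
  fixes f :: "real^'n::finite \<Rightarrow> complex" and i :: 'n
  assumes "f \<in> gauss_poly"
  shows "\<exists>f'. partial_derivative i f f' \<and> gauss_dominated f \<and> gauss_dominated f'"
proof -
  obtain \<alpha> \<beta> P where f: "f = (\<lambda>a. exp (- (\<Sum>i\<in>UNIV. \<alpha> i * of_real (a $ i)^2 + \<beta> i * of_real (a $ i))) * P a)"
    and \<alpha>: "\<And>i. 0 < Re (\<alpha> i)" and P: "polynomial_function P"
    using assms unfolding gauss_poly_def by blast
  define Q where "Q a = exp (\<Sum>k\<in>UNIV. (- \<beta> k) * of_real (a $ k) - \<alpha> k * (of_real (a $ k))\<^sup>2)" for a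
  have fQ: "f = (\<lambda>a. Q a * P a)"
  proof -
    have "- (\<Sum>i\<in>UNIV. \<alpha> i * of_real (a $ i)^2 + \<beta> i * of_real (a $ i))
        = (\<Sum>k\<in>UNIV. (- \<beta> k) * of_real (a $ k) - \<alpha> k * (of_real (a $ k))\<^sup>2)" for a :: "real^'n"
      by (simp add: sum_subtractf sum_negf sum.distrib)
    then show ?thesis unfolding f Q_def by simp
  qed
  have Qd: "partial_derivative i Q (\<lambda>a. (- \<beta> i - 2 * \<alpha> i * of_real (a $ i)) * Q a)"
    unfolding Q_def by (rule partial_derivative_exp_quadratic)
  have Qg: "gauss_dominated Q"
    unfolding Q_def by (rule gauss_dominated_exp_quadratic[OF \<alpha>])
  have Qg': "gauss_dominated (\<lambda>a. (- \<beta> i - 2 * \<alpha> i * of_real (a $ i)) * Q a)"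
  proof -
    have "gauss_dominated (\<lambda>a. (- \<beta> i) * Q a + (- 2 * \<alpha> i) * (of_real (a $ i) * Q a))"
      by (intro gauss_dominated_add gauss_dominated_const_mult gauss_dominated_coord Qg)
    then show ?thesis by (simp add: algebra_simps)
  qed
  obtain pr pi where pr: "real_polynomial_function pr" "\<And>a. ((\<lambda>t. Re (P (a + t *\<^sub>R axis i 1))) has_vector_derivative pr a) (at 0)"
    and pi: "real_polynomial_function pi" "\<And>a. ((\<lambda>t. Im (P (a + t *\<^sub>R axis i 1))) has_vector_derivative pi a) (at 0)"
    using real_polynomial_directional[OF polynomial_function_components(1)[OF P], of i]
      real_polynomial_directional[OF polynomial_function_components(2)[OF P], of i] by blast
  have Pd: "partial_derivative i P (\<lambda>a. Complex (pr a) (pi a))"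
    unfolding partial_derivative_def
  proof
    fix a
    have "((\<lambda>t. of_real (Re (P (a + t *\<^sub>R axis i 1))) + \<i> * of_real (Im (P (a + t *\<^sub>R axis i 1))))
        has_vector_derivative (of_real (pr a) + \<i> * of_real (pi a))) (at 0)"
      by (intro has_vector_derivative_add has_vector_derivative_mult_right has_vector_derivative_of_real)
        (simp_all only: has_real_derivative_iff_has_vector_derivative pr(2) pi(2))
    then show "((\<lambda>t. P (a + t *\<^sub>R axis i 1)) has_vector_derivative Complex (pr a) (pi a)) (at 0)"
      by (simp add: Complex_eq flip: complex_eq)
  qed
  have "gauss_dominated (\<lambda>a. Complex (pr a) (pi a) * Q a + P a * ((- \<beta> i - 2 * \<alpha> i * of_real (a $ i)) * Q a))"
  proof (rule gauss_dominated_add)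
    show "gauss_dominated (\<lambda>a. Complex (pr a) (pi a) * Q a)"
      by (rule polynomial_times_dominated) (simp_all add: pr(1) pi(1) Qg)
    show "gauss_dominated (\<lambda>a. P a * ((- \<beta> i - 2 * \<alpha> i * of_real (a $ i)) * Q a))"
      by (rule polynomial_times_dominated[OF polynomial_function_components[OF P] Qg'])
  qed
  moreover have "gauss_dominated f"
    using polynomial_times_dominated[OF polynomial_function_components[OF P] Qg] by (simp add: fQ mult.commute)
  ultimately show ?thesis
    using partial_derivative_mult[OF Qd Pd] unfolding fQ
    by (intro exI[of _ "\<lambda>a. Q a * Complex (pr a) (pi a) + (- \<beta> i - 2 * \<alpha> i * of_real (a $ i)) * Q a * P a"])
      (simp add: mult_ac)
qed

lemma core_functions_regular:
  fixes f :: "real^'n::finite \<Rightarrow> complex" and i :: 'n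
  assumes "f \<in> core_functions"
  shows "\<exists>f'. partial_derivative i f f' \<and> gauss_dominated f \<and> gauss_dominated f'"
proof -
  obtain N :: nat and c h where f: "f = (\<lambda>a. \<Sum>m<N. c m * h m a)" and h: "\<And>m. m < N \<Longrightarrow> h m \<in> gauss_poly"
    using assms unfolding core_functions_def by blast
  define h' where "h' m = (SOME f'. partial_derivative i (h m) f' \<and> gauss_dominated (h m) \<and> gauss_dominated f')" for m
  have h': "partial_derivative i (h m) (h' m)" "gauss_dominated (h m)" "gauss_dominated (h' m)" if "m < N" for m
    using someI_ex[OF gauss_poly_regular[OF h[OF that], of i]] unfolding h'_def by blast+
  have "partial_derivative i f (\<lambda>a. \<Sum>m<N. c m * h' m a)"
    unfolding partial_derivative_def f
    using h'(1) by (auto simp: partial_derivative_def intro!: has_vector_derivative_sum has_vector_derivative_mult_right)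
  moreover have "gauss_dominated f" "gauss_dominated (\<lambda>a. \<Sum>m<N. c m * h' m a)"
    unfolding f using h' by (auto intro!: gauss_dominated_sum gauss_dominated_const_mult)
  ultimately show ?thesis by blast
qed

lemma gauss_in_core: "gauss \<beta> \<in> core_functions"
proof -
  have "gauss \<beta> \<in> gauss_poly"
    unfolding gauss_poly_def
  proof (intro CollectI exI conjI allI)
    show "gauss \<beta> = (\<lambda>a. exp (- (\<Sum>i\<in>UNIV. (1/2) * of_real (a $ i)^2 + (- \<beta> i) * of_real (a $ i))) * 1)"
      by (auto simp: gauss_def fun_eq_iff sum_subtractf sum_negf sum.distrib)
    show "0 < Re (1 / 2)" by simp
    show "polynomial_function (\<lambda>a. 1)" by simp
  qed
  then show ?thesis unfolding core_functions_def
    by (intro CollectI exI[of _ "1::nat"] exI[of _ "\<lambda>_. 1"] exI[of _ "\<lambda>_. gauss \<beta>"]) auto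
qed

text \<open>Taking adjoints reverses inclusions.  A self-adjoint extension of \<open>T\<close> extends \<open>T0\<close>, hence is contained
  in the adjoint of \<open>T0\<close>; as both are self-adjoint, they coincide.\<close>

lemma sa_extension_eq:
  assumes "T0 \<subseteq> T" "T \<subseteq> adjoint_op T0" "self_adjoint (adjoint_op T0)"
  shows "sa_extension T = adjoint_op T0"
  unfolding sa_extension_def
proof (rule the_equality)
  show "T \<subseteq> adjoint_op T0 \<and> self_adjoint (adjoint_op T0)" using assms by blast
  have anti: "adjoint_op B \<subseteq> adjoint_op A" if "A \<subseteq> B" for A B :: "'a unbounded_op"
    using that unfolding adjoint_op_def by blast
  fix S assume S: "T \<subseteq> S \<and> self_adjoint S"
  then have "S = adjoint_op S" by (simp add: self_adjoint_def)
  then have "S \<subseteq> adjoint_op T0" using anti[of T0 S] S assms(1) by blast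
  moreover have "adjoint_op T0 = adjoint_op (adjoint_op T0)" using assms(3) by (simp add: self_adjoint_def)
  ultimately show "S = adjoint_op T0" using anti[of S "adjoint_op T0"] S by (metis self_adjoint_def subset_antisym)
qed

lemma sa_extension_core_graph:
  assumes i: "i \<in> J" and r: "\<And>k. k \<in> J \<Longrightarrow> r k = 0"
    and A: "\<And>f f'. partial_derivative i f f' \<Longrightarrow> A f = weyl_op \<kappa> r f f'"
  shows "sa_extension (core_graph A) = adjoint_op (gauss_graph \<kappa> r i)"
proof (rule sa_extension_eq)
  show "gauss_graph \<kappa> r i \<subseteq> core_graph A"
    unfolding gauss_graph_def core_graph_def gaussian_def weyl_gauss_def
    using A[OF partial_derivative_gauss] gauss_in_core by fastforce
  show "core_graph A \<subseteq> adjoint_op (gauss_graph \<kappa> r i)"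
  proof
    fix x assume "x \<in> core_graph A"
    then obtain f where f: "f \<in> core_functions" "x = (abs_l2 f, abs_l2 (A f))" unfolding core_graph_def by blast
    obtain f' where "partial_derivative i f f'" "gauss_dominated f" "gauss_dominated f'"
      using core_functions_regular[OF f(1)] by blast
    then show "x \<in> adjoint_op (gauss_graph \<kappa> r i)"
      using weyl_op_in_adjoint[of i f f' \<kappa> r] A f(2) by simp
  qed
  show "self_adjoint (adjoint_op (gauss_graph \<kappa> r i))"
  proof -
    have "adjoint_op (gauss_graph \<kappa> r i) = mult_graph (partial_fourier J) (fourier_symbol \<kappa> r i)"
      by (rule adjoint_gauss_graph) (use i r in auto)
    then show ?thesis
      by (simp only: self_adjoint_mult_graph[OF partial_fourier(1) measurable_fourier_symbol])
  qed
qed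

lemma x_op_weyl:
  assumes "partial_derivative i f f'"
  shows "x_op hbar \<Gamma> i f = weyl_op (pi * hbar / symm \<Gamma> i) (\<lambda>k. - of_int (exch \<Gamma> i k)) f f'"
    "xt_op hbar \<Gamma> i f = weyl_op (pi * hbar / symm \<Gamma> i) (\<lambda>k. of_int (exch \<Gamma> i k)) f f'"
proof -
  have v: "vector_derivative (\<lambda>t. f (a + t *\<^sub>R axis i 1)) (at 0) = f' a" for a
    using assms unfolding partial_derivative_def by (intro vector_derivative_at) blast
  have coeff: "1/2 * inverse (of_nat (symm \<Gamma> i)) * (2 * of_real pi * \<i> * of_real hbar * z)
      = \<i> * of_real (pi * hbar / symm \<Gamma> i) * z" for z :: complex
    by (cases "symm \<Gamma> i = 0") (simp_all add: field_simps)
  show "x_op hbar \<Gamma> i f = weyl_op (pi * hbar / symm \<Gamma> i) (\<lambda>k. - of_int (exch \<Gamma> i k)) f f'"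
  proof (rule ext)
    fix a
    have "(\<Sum>k\<in>UNIV. of_int (exch \<Gamma> i k) * q_op k f a) = - (of_real (\<Sum>k\<in>UNIV. - of_int (exch \<Gamma> i k) * a $ k) * f a)"
      by (simp add: q_op_def sum_distrib_right sum_negf mult.assoc)
    then show "x_op hbar \<Gamma> i f a = weyl_op (pi * hbar / symm \<Gamma> i) (\<lambda>k. - of_int (exch \<Gamma> i k)) f f' a"
      by (simp only: x_op_def p_op_def v weyl_op_def coeff diff_minus_eq_add)
  qed
  show "xt_op hbar \<Gamma> i f = weyl_op (pi * hbar / symm \<Gamma> i) (\<lambda>k. of_int (exch \<Gamma> i k)) f f'"
  proof (rule ext)
    fix a
    have "(\<Sum>k\<in>UNIV. of_int (exch \<Gamma> i k) * q_op k f a) = of_real (\<Sum>k\<in>UNIV. of_int (exch \<Gamma> i k) * a $ k) * f a"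
      by (simp add: q_op_def sum_distrib_right mult.assoc)
    then show "xt_op hbar \<Gamma> i f a = weyl_op (pi * hbar / symm \<Gamma> i) (\<lambda>k. of_int (exch \<Gamma> i k)) f f' a"
      by (simp only: xt_op_def p_op_def v weyl_op_def coeff)
  qed
qed

section \<open>The quantum dilogarithm on the real line\<close>

lemma sinh_minus_cnj: "sinh (- cnj (w :: complex)) = - cnj (sinh w)"
  by (simp add: sinh_def exp_cnj scaleR_conv_of_real field_simps)

text \<open>The reflection \<open>p \<mapsto> - cnj p\<close> maps the contour of the quantum dilogarithm to itself with reversed
  orientation.  The three factors in the denominator each contribute a sign.\<close>

lemma qdilog_integrand_reflect:
  "qdilog_integrand h z (- cnj p) = - cnj (qdilog_integrand h z p)"
proof -
  have 1: "exp (- \<i> * (- cnj p) * of_real z) = cnj (exp (- \<i> * p * of_real z))"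
    by (simp add: exp_cnj)
  have s: "sinh (of_real c * (- cnj p)) = - cnj (sinh (of_real c * p))" for c
    using sinh_minus_cnj[of "of_real c * p"] by simp
  show ?thesis
    unfolding qdilog_integrand_def 1 s by simp
qed

lemma sinh_nonzero:
  assumes "w \<noteq> 0" "cmod w < pi"
  shows "sinh (w :: complex) \<noteq> 0"
proof
  assume "sinh w = 0"
  then have "exp w = exp (- w)" by (simp add: sinh_def)
  then obtain n :: int where n: "w = - w + of_int (2 * n) * of_real pi * \<i>"
    unfolding exp_eq by auto
  then have "w = of_int n * of_real pi * \<i>" using arg_cong[OF n, of "\<lambda>v. v + w"] by simp
  then have "cmod w = \<bar>of_int n\<bar> * pi" by (simp add: norm_mult)
  moreover have "n \<noteq> 0" using \<open>w = of_int n * of_real pi * \<i>\<close> assms(1) by auto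
  ultimately have "pi \<le> cmod w" by simp
  with assms(2) show False by simp
qed

context
  fixes h :: real
  assumes h: "0 < h"
begin

text \<open>The parametrization of the half circle by the unit interval used by \<open>part_circlepath\<close>.\<close>

private definition arc :: "real \<Rightarrow> complex" where
  "arc x = of_real (qdilog_radius h) * exp (\<i> * of_real ((1 - x) * pi))"

private lemma radius: "0 < qdilog_radius h" "qdilog_radius h < 1" "qdilog_radius h * h < 1"
proof -
  show "0 < qdilog_radius h" "qdilog_radius h < 1" using h by (auto simp: qdilog_radius_def)
  have "qdilog_radius h * h \<le> (1 / h) / 2 * h"
    unfolding qdilog_radius_def using h by (intro mult_right_mono) auto
  then show "qdilog_radius h * h < 1" using h by simp
qed

private lemma cmod_arc: "cmod (arc x) = qdilog_radius h"
  using radius(1) by (simp add: arc_def norm_mult)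

private lemma arc_reflect: "arc (1 - x) = - cnj (arc x)"
proof -
  have "exp (\<i> * of_real (x * pi)) = exp (\<i> * of_real pi) * exp (- (\<i> * of_real ((1 - x) * pi)))"
    unfolding mult_exp_exp by (rule arg_cong[where f = exp]) (simp add: algebra_simps)
  then show ?thesis by (simp add: arc_def exp_cnj)
qed

private definition arc_integrand :: "real \<Rightarrow> real \<Rightarrow> complex" where
  "arc_integrand z x = qdilog_integrand h z (arc x) * (- \<i> * of_real pi * arc x)"

private lemma arc_integrand_reflect: "arc_integrand z (1 - x) = - cnj (arc_integrand z x)"
  unfolding arc_integrand_def arc_reflect qdilog_integrand_reflect by simp

private lemma continuous_arc: "continuous_on S arc"
  unfolding arc_def[abs_def] by (intro continuous_intros)

private lemma continuous_arc_integrand: "continuous_on S (arc_integrand z)"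
proof -
  have n: "arc x \<noteq> 0" for x using cmod_arc[of x] radius(1) by auto
  have "sinh (of_real pi * arc x) \<noteq> 0" for x
    using n radius by (intro sinh_nonzero) (auto simp: norm_mult cmod_arc)
  moreover have "sinh (of_real (pi * h) * arc x) \<noteq> 0" for x
    using n radius h by (intro sinh_nonzero) (auto simp: norm_mult cmod_arc mult_ac)
  moreover have "continuous_on S (\<lambda>x. sinh (c * arc x))" for c
    unfolding sinh_def by (intro continuous_intros continuous_arc)
  ultimately show ?thesis
    unfolding arc_integrand_def[abs_def] qdilog_integrand_def
    by (intro continuous_intros continuous_arc) (auto simp: n)
qed

private lemma arc_integral:
  "contour_integral (part_circlepath 0 (qdilog_radius h) pi 0) (qdilog_integrand h z)
    = (LINT x|lborel. indicator {0..1} x *\<^sub>R arc_integrand z x)"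
proof -
  have "contour_integral (part_circlepath 0 (qdilog_radius h) pi 0) (qdilog_integrand h z)
     = integral {0..1} (arc_integrand z)"
    unfolding contour_integral_integral
  proof (rule Henstock_Kurzweil_Integration.integral_cong)
    fix x :: real assume x: "x \<in> {0..1}"
    have p: "part_circlepath 0 (qdilog_radius h) pi 0 x = arc x"
      by (simp add: part_circlepath_def linepath_def arc_def)
    have v: "vector_derivative (part_circlepath 0 (qdilog_radius h) pi 0) (at x)
        = - \<i> * of_real pi * arc x"
      by (simp add: vector_derivative_part_circlepath linepath_def arc_def)
    show "qdilog_integrand h z (part_circlepath 0 (qdilog_radius h) pi 0 x) *
        vector_derivative (part_circlepath 0 (qdilog_radius h) pi 0) (at x) = arc_integrand z x"
      by (simp only: p v arc_integrand_def)
  qed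
  also have "\<dots> = (LINT x:{0..1}|lborel. arc_integrand z x)"
    by (rule set_borel_integral_eq_integral(2)[symmetric])
      (rule borel_integrable_atLeastAtMost'[OF continuous_arc_integrand])
  finally show ?thesis by (simp add: set_lebesgue_integral_def)
qed

text \<open>Each of the two parts of the contour integral, the pair of rays and the half circle, is minus its own
  complex conjugate.\<close>

lemma Re_qdilog_integral: "Re (qdilog_integral h z) = 0"
proof -
  let ?f = "\<lambda>p. qdilog_integrand h z (of_real p)" and ?r = "qdilog_radius h"
  have refl: "?f (- p) = - cnj (?f p)" for p
    using qdilog_integrand_reflect[of h z "of_real p"] by simp
  have "(CLINT p|lborel. indicator {..- ?r} p *\<^sub>R ?f p) = (CLINT p|lborel. indicator {..- ?r} (- p) *\<^sub>R ?f (- p))"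
    using lborel_integral_real_affine[of "-1" "\<lambda>p. indicator {..- ?r} p *\<^sub>R ?f p" 0] by simp
  also have "\<dots> = (CLINT p|lborel. - cnj (indicator {?r..} p *\<^sub>R ?f p))"
    unfolding refl by (rule Bochner_Integration.integral_cong) (auto split: split_indicator)
  also have "\<dots> = - cnj (CLINT p|lborel. indicator {?r..} p *\<^sub>R ?f p)"
    unfolding Bochner_Integration.integral_minus Bochner_Integration.integral_cnj ..
  finally have "Re ((LINT p:{..- ?r}|lborel. ?f p) + (LINT p:{?r..}|lborel. ?f p)) = 0"
    by (simp add: set_lebesgue_integral_def)
  moreover have "Re (LINT x|lborel. indicator {0..1} x *\<^sub>R arc_integrand z x) = 0" (is "Re ?C = 0")
  proof -
    have "?C = (LINT x|lborel. indicator {0..1} (1 - x) *\<^sub>R arc_integrand z (1 - x))"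
      using lborel_integral_real_affine[of "-1" "\<lambda>x. indicator {0..1} x *\<^sub>R arc_integrand z x" 1] by simp
    also have "\<dots> = (LINT x|lborel. - cnj (indicator {0..1} x *\<^sub>R arc_integrand z x))"
      unfolding arc_integrand_reflect by (rule Bochner_Integration.integral_cong) (auto split: split_indicator)
    also have "\<dots> = - cnj ?C"
      unfolding Bochner_Integration.integral_minus Bochner_Integration.integral_cnj ..
    finally have "?C = - cnj ?C" .
    then have "Re ?C = Re (- cnj ?C)" by (rule arg_cong)
    then show ?thesis by simp
  qed
  ultimately show ?thesis
    unfolding qdilog_integral_def Let_def arc_integral by simp
qed

lemma cmod_qdilog: "cmod (qdilog h z) = 1"
  by (simp add: qdilog_def Re_qdilog_integral)

lemma measurable_qdilog: "qdilog h \<in> borel_measurable borel"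
proof -
  have [measurable]: "(sinh :: complex \<Rightarrow> complex) \<in> borel_measurable borel"
    unfolding sinh_def[abs_def] by (intro borel_measurable_continuous_onI continuous_intros)
  have [measurable]: "arc \<in> borel_measurable borel" by (intro borel_measurable_continuous_onI continuous_arc)
  have m1: "(\<lambda>(z, p). indicator A p *\<^sub>R qdilog_integrand h z (of_real p)) \<in> borel_measurable (borel \<Otimes>\<^sub>M lborel)"
    if [measurable]: "A \<in> sets borel" for A :: "real set"
    unfolding qdilog_integrand_def by measurable
  have m2: "(\<lambda>(z, x). indicator {0..1} x *\<^sub>R arc_integrand z x) \<in> borel_measurable (borel \<Otimes>\<^sub>M lborel)"
    unfolding qdilog_integrand_def arc_integrand_def by measurable
  have [measurable]: "(\<lambda>z. LINT p|lborel. indicator A p *\<^sub>R qdilog_integrand h z (of_real p)) \<in> borel_measurable borel"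
    if "A \<in> sets borel" for A :: "real set"
    by (rule sigma_finite_measure.borel_measurable_lebesgue_integral[OF sigma_finite_lborel m1[OF that]])
  have [measurable]: "(\<lambda>z. LINT x|lborel. indicator {0..1} x *\<^sub>R arc_integrand z x) \<in> borel_measurable borel"
    by (rule sigma_finite_measure.borel_measurable_lebesgue_integral[OF sigma_finite_lborel m2])
  show ?thesis
    unfolding qdilog_def[abs_def] qdilog_integral_def Let_def arc_integral set_lebesgue_integral_def by measurable
qed

end

section \<open>Linear changes of variables\<close>

definition pullback :: "(real^'n::finite \<Rightarrow> real^'n) \<Rightarrow> 'n l2 \<Rightarrow> 'n l2" where
  "pullback m f = abs_l2 (rep_l2 f \<circ> m)"

lemma nn_integral_translate:
  fixes f :: "'a::euclidean_space \<Rightarrow> ennreal"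
  assumes [measurable]: "f \<in> borel_measurable borel"
  shows "(\<integral>\<^sup>+ a. f (c + a) \<partial>lborel) = (\<integral>\<^sup>+ a. f a \<partial>lborel)"
proof -
  have "(\<integral>\<^sup>+ a. f a \<partial>distr lborel borel ((+) c)) = (\<integral>\<^sup>+ a. f (c + a) \<partial>lborel)"
    by (rule nn_integral_distr) auto
  then show ?thesis by (simp add: lborel_distr_plus)
qed

text \<open>On each line parallel to \<open>e\<close> the map \<open>m\<close> is a reflection, whose centre depends on the line.  The integral
  is averaged over translations along \<open>e\<close> with a weight \<open>w\<close> of total mass one; Tonelli's theorem and
  one-dimensional substitutions then remove \<open>m\<close>.\<close>

lemma skew_reflection_preserves_lborel:
  fixes m :: "'a::euclidean_space \<Rightarrow> 'a" and c :: "'a \<Rightarrow> real"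
  assumes m: "\<And>a. m a = a + c a *\<^sub>R e" and c: "\<And>a t. c (a + t *\<^sub>R e) = c a - 2 * t"
    and [measurable]: "c \<in> borel_measurable borel"
  shows "distr lborel borel m = lborel"
proof -
  have [measurable]: "m \<in> borel_measurable borel" unfolding m[abs_def] by measurable
  have nn: "(\<integral>\<^sup>+ a. f (m a) \<partial>lborel) = (\<integral>\<^sup>+ a. f a \<partial>lborel)"
    if [measurable]: "f \<in> borel_measurable borel" for f :: "'a \<Rightarrow> ennreal"
  proof -
    \<comment> \<open>Any weight of total mass one would do.\<close>
    define w :: "real \<Rightarrow> ennreal" where "w = indicator {0..1}"
    have [measurable]: "w \<in> borel_measurable borel" by (simp add: w_def)
    have w1: "(\<integral>\<^sup>+ t. w t \<partial>lborel) = 1" by (simp add: w_def)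
    have wmult: "(\<integral>\<^sup>+ t. w (r + t) * x \<partial>lborel) = x" for x r
      by (simp add: nn_integral_multc nn_integral_translate[of w r] w1)
    have mt: "m (t *\<^sub>R e + a) = a + (c a - t) *\<^sub>R e" for a t
    proof -
      have "m (t *\<^sub>R e + a) = (t *\<^sub>R e + a) + (c a - 2 * t) *\<^sub>R e"
        using c[of a t] by (simp add: m add.commute)
      also have "\<dots> = a + (t + (c a - 2 * t)) *\<^sub>R e" unfolding scaleR_add_left by simp
      finally show ?thesis by simp
    qed
    have "(\<integral>\<^sup>+ a. f (m a) \<partial>lborel) = (\<integral>\<^sup>+ t. w t * (\<integral>\<^sup>+ a. f (m a) \<partial>lborel) \<partial>lborel)"
      by (simp add: nn_integral_multc w1)
    also have "\<dots> = (\<integral>\<^sup>+ t. (\<integral>\<^sup>+ a. w t * f (a + (c a - t) *\<^sub>R e) \<partial>lborel) \<partial>lborel)"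
    proof (rule nn_integral_cong)
      fix t
      have "(\<integral>\<^sup>+ a. f (m a) \<partial>lborel) = (\<integral>\<^sup>+ a. f (a + (c a - t) *\<^sub>R e) \<partial>lborel)"
        using nn_integral_translate[of "\<lambda>a. f (m a)" "t *\<^sub>R e"] by (simp add: mt)
      then show "w t * (\<integral>\<^sup>+ a. f (m a) \<partial>lborel) = (\<integral>\<^sup>+ a. w t * f (a + (c a - t) *\<^sub>R e) \<partial>lborel)"
        by (simp add: nn_integral_cmult)
    qed
    also have "\<dots> = (\<integral>\<^sup>+ a. (\<integral>\<^sup>+ t. w t * f (a + (c a - t) *\<^sub>R e) \<partial>lborel) \<partial>lborel)"
      by (rule lborel_pair.Fubini') measurable
    also have "\<dots> = (\<integral>\<^sup>+ a. (\<integral>\<^sup>+ s. w (c a - s) * f (a + s *\<^sub>R e) \<partial>lborel) \<partial>lborel)"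
    proof (rule nn_integral_cong)
      fix a
      show "(\<integral>\<^sup>+ t. w t * f (a + (c a - t) *\<^sub>R e) \<partial>lborel) = (\<integral>\<^sup>+ s. w (c a - s) * f (a + s *\<^sub>R e) \<partial>lborel)"
        by (subst nn_integral_real_affine[where c = "-1" and t = "c a"]) simp_all
    qed
    also have "\<dots> = (\<integral>\<^sup>+ s. (\<integral>\<^sup>+ a. w (c a - s) * f (a + s *\<^sub>R e) \<partial>lborel) \<partial>lborel)"
      by (rule lborel_pair.Fubini') measurable
    also have "\<dots> = (\<integral>\<^sup>+ s. (\<integral>\<^sup>+ a. w (c a + s) * f a \<partial>lborel) \<partial>lborel)"
    proof (rule nn_integral_cong)
      fix s
      have "c (- s *\<^sub>R e + a) - s = c a + s" for a using c[of a "- s"] by (simp add: add.commute)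
      then show "(\<integral>\<^sup>+ a. w (c a - s) * f (a + s *\<^sub>R e) \<partial>lborel) = (\<integral>\<^sup>+ a. w (c a + s) * f a \<partial>lborel)"
        using nn_integral_translate[of "\<lambda>a. w (c a - s) * f (a + s *\<^sub>R e)" "- s *\<^sub>R e"] by (simp add: add.commute)
    qed
    also have "\<dots> = (\<integral>\<^sup>+ a. (\<integral>\<^sup>+ s. w (c a + s) * f a \<partial>lborel) \<partial>lborel)"
      by (rule lborel_pair.Fubini') measurable
    finally show ?thesis by (simp add: wmult)
  qed
  show ?thesis
  proof (rule measure_eqI)
    fix B assume "B \<in> sets (distr lborel borel m)"
    then have [measurable]: "B \<in> sets borel" by simp
    have "emeasure (distr lborel borel m) B = (\<integral>\<^sup>+ a. indicator B a \<partial>distr lborel borel m)" by simp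
    also have "\<dots> = (\<integral>\<^sup>+ a. indicator B (m a) \<partial>lborel)" by (rule nn_integral_distr) auto
    also have "\<dots> = emeasure lborel B" by (simp add: nn)
    finally show "emeasure (distr lborel borel m) B = emeasure lborel B" .
  qed simp
qed

context
  fixes m :: "real^'n::finite \<Rightarrow> real^'n"
  assumes lin: "linear m" and inv: "\<And>a. m (m a) = a" and pres: "distr lborel borel m = lborel"
begin

private lemma m_measurable [measurable]: "m \<in> borel_measurable borel"
  using lin by (intro borel_measurable_continuous_onI linear_continuous_on) (simp add: linear_conv_bounded_linear)

private lemma AE_comp:
  assumes "AE a in lborel. P a"
  shows "AE a in lborel. P (m a)"
proof (rule AE_distrD[of m lborel borel P])
  show "m \<in> measurable lborel borel" by measurable
  show "AE a in distr lborel borel m. P a"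
    unfolding pres by (rule assms)
qed

private lemma integral_comp:
  fixes f :: "real^'n \<Rightarrow> 'b::{banach, second_countable_topology}"
  assumes [measurable]: "f \<in> borel_measurable borel"
  shows "(LINT a|lborel. f (m a)) = (LINT a|lborel. f a)"
    and "integrable lborel (\<lambda>a. f (m a)) \<longleftrightarrow> integrable lborel f"
proof -
  have "(LINT a|distr lborel borel m. f a) = (LINT a|lborel. f (m a))"
    by (rule integral_distr) auto
  then show "(LINT a|lborel. f (m a)) = (LINT a|lborel. f a)"
    by (simp add: pres)
  have "integrable (distr lborel borel m) f \<longleftrightarrow> integrable lborel (\<lambda>a. f (m a))"
    by (rule integrable_distr_eq) auto
  then show "integrable lborel (\<lambda>a. f (m a)) \<longleftrightarrow> integrable lborel f"
    by (simp add: pres)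
qed

lemma sq_integrable_comp:
  assumes "sq_integrable f"
  shows "sq_integrable (f \<circ> m)"
proof -
  have f [measurable]: "f \<in> borel_measurable borel" using assms by (simp add: sq_integrable_def)
  have "integrable lborel (\<lambda>a. (cmod (f (m a)))\<^sup>2)"
    using integral_comp(2)[of "\<lambda>a. (cmod (f a))\<^sup>2"] assms by (simp add: sq_integrable_def)
  then show ?thesis unfolding sq_integrable_def o_def by simp
qed

lemma pullback_abs: "sq_integrable f \<Longrightarrow> pullback m (abs_l2 f) = abs_l2 (f \<circ> m)"
  unfolding pullback_def
  using AE_comp[OF rep_abs_l2] by (subst abs_l2_eq_iff) (auto intro!: sq_integrable_comp sq_integrable_rep)

lemma pullback_pullback: "pullback m (pullback m f) = f"
proof -
  have "pullback m (pullback m f) = abs_l2 ((rep_l2 f \<circ> m) \<circ> m)"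
    unfolding pullback_def[of m f] by (rule pullback_abs[OF sq_integrable_comp[OF sq_integrable_rep]])
  also have "(rep_l2 f \<circ> m) \<circ> m = rep_l2 f" by (simp add: fun_eq_iff inv)
  finally show ?thesis by simp
qed

lemma unitary_pullback: "unitary_op (pullback m)"
  unfolding unitary_op_def
proof (intro conjI allI)
  fix f g :: "'n l2"
  have [measurable]: "rep_l2 f \<in> borel_measurable borel" "rep_l2 g \<in> borel_measurable borel"
    using measurable_rep_l2 by simp_all
  have "cinner (pullback m f) (pullback m g) = (CLINT a|lborel. cnj (rep_l2 f (m a)) * rep_l2 g (m a))"
    unfolding pullback_def
    by (simp add: cinner_abs_l2 sq_integrable_comp sq_integrable_rep)
  also have "\<dots> = cinner f g" unfolding cinner_rep
    by (rule integral_comp(1)[of "\<lambda>a. cnj (rep_l2 f a) * rep_l2 g a"])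
      (use borel_measurable_cnj_mult[OF measurable_rep_l2[of f] measurable_rep_l2[of g]] in simp)
  finally show "cinner (pullback m f) (pullback m g) = cinner f g" .
  show "surj (pullback m)" by (metis pullback_pullback surjI)
qed

text \<open>If \<open>m\<close> fixes the direction \<open>e\<^sub>j\<close> and the linear form of the Weyl operator, the operator commutes with
  the substitution \<open>m\<close>.  The transformed Gaussians have exponents that need not be diagonal, but
  they still decay, so they lie in the domain of the adjoint, where symmetry applies.\<close>

lemma pullback_preserves_weyl_graph:
  assumes j: "j \<in> J" and r: "\<And>k. k \<in> J \<Longrightarrow> r k = 0"
    and axis: "m (axis j 1) = axis j 1"
    and rows: "\<And>a. (\<Sum>k\<in>UNIV. r k * m a $ k) = (\<Sum>k\<in>UNIV. r k * a $ k)"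
    and uv: "(u, v) \<in> adjoint_op (gauss_graph \<kappa> r j)"
  shows "(pullback m u, pullback m v) \<in> adjoint_op (gauss_graph \<kappa> r j)"
proof -
  have "cinner (pullback m u) (abs_l2 (weyl_gauss \<kappa> r j \<beta>)) = cinner (pullback m v) (gaussian \<beta>)" for \<beta>
  proof -
    let ?G = "gauss \<beta>" and ?G' = "\<lambda>a. (\<beta> j - of_real (a $ j)) * gauss \<beta> a"
    have "partial_derivative j (?G \<circ> m) (?G' \<circ> m)"
      using partial_derivative_gauss[of j \<beta>] unfolding partial_derivative_def
      by (simp add: linear_add[OF lin] linear_scale[OF lin] axis)
    then have "(abs_l2 (?G \<circ> m), abs_l2 (weyl_op \<kappa> r (?G \<circ> m) (?G' \<circ> m))) \<in> adjoint_op (gauss_graph \<kappa> r j)"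
      by (intro weyl_op_in_adjoint gauss_dominated_linear_change[OF _ lin inv]
          gauss_dominated_gauss gauss_dominated_gauss_derivative)
    moreover have "weyl_op \<kappa> r (?G \<circ> m) (?G' \<circ> m) = weyl_gauss \<kappa> r j \<beta> \<circ> m"
      by (simp add: fun_eq_iff weyl_gauss_def weyl_op_def rows)
    ultimately have gr: "(pullback m (gaussian \<beta>), pullback m (abs_l2 (weyl_gauss \<kappa> r j \<beta>))) \<in> adjoint_op (gauss_graph \<kappa> r j)"
      unfolding gaussian_def pullback_abs[OF sq_integrable_gauss] pullback_abs[OF sq_integrable_weyl_gauss] by simp
    have "adjoint_op (gauss_graph \<kappa> r j) = mult_graph (partial_fourier J) (fourier_symbol \<kappa> r j)"
      by (rule adjoint_gauss_graph) (use j r in auto)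
    then have "cinner u (pullback m (abs_l2 (weyl_gauss \<kappa> r j \<beta>))) = cinner v (pullback m (gaussian \<beta>))"
      using mult_graph_symmetric[OF partial_fourier(1)] uv gr by metis
    then show ?thesis
      using unitary_cinner[OF unitary_pullback, of u "pullback m (abs_l2 (weyl_gauss \<kappa> r j \<beta>))"]
        unitary_cinner[OF unitary_pullback, of v "pullback m (gaussian \<beta>)"]
      by (simp add: pullback_pullback)
  qed
  then show ?thesis by (auto simp: adjoint_op_def gauss_graph_def)
qed

end

text \<open>A unitary \<open>V\<close> that preserves the graph provides a second diagonalization \<open>W \<circ> V\<close> with the same symbol.
  The functional calculus does not depend on the diagonalization.\<close>

lemma fun_calculus_commutes:
  assumes W: "unitary_op W" and g: "g \<in> borel_measurable borel"
    and \<phi>: "\<phi> \<in> borel_measurable borel" "\<And>t. cmod (\<phi> t) \<le> 1"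
    and V: "unitary_op V" and inv: "\<And>u v. (V u, V v) \<in> mult_graph W g \<longleftrightarrow> (u, v) \<in> mult_graph W g"
  shows "fun_calculus \<phi> (mult_graph W g) (V f) = V (fun_calculus \<phi> (mult_graph W g) f)"
proof -
  have "mult_graph (W \<circ> V) g = mult_graph W g"
    using inv unfolding mult_graph_def by auto
  then have "fun_calculus \<phi> (mult_graph W g) f = Hilbert_Choice.inv (W \<circ> V) (mult_l2 (\<lambda>a. \<phi> (g a)) ((W \<circ> V) f))"
    using fun_calculus_mult_graph[OF unitary_comp[OF W V] g \<phi>] by metis
  also have "\<dots> = Hilbert_Choice.inv V (Hilbert_Choice.inv W (mult_l2 (\<lambda>a. \<phi> (g a)) (W (V f))))"
    by (simp add: o_inv_distrib[OF unitary_bij[OF W] unitary_bij[OF V]])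
  also have "\<dots> = Hilbert_Choice.inv V (fun_calculus \<phi> (mult_graph W g) (V f))"
    by (simp add: fun_calculus_mult_graph[OF W g \<phi>])
  finally show ?thesis by (simp add: unitary_inv_right[OF V])
qed

definition diag_op :: "('n::finite l2 \<Rightarrow> 'n l2) \<Rightarrow> (real^'n \<Rightarrow> complex) \<Rightarrow> 'n l2 \<Rightarrow> 'n l2" where
  "diag_op W p f = inv W (mult_l2 p (W f))"

definition unimodular_symbol :: "(real^'n::finite \<Rightarrow> complex) \<Rightarrow> bool" where
  "unimodular_symbol p \<longleftrightarrow> p \<in> borel_measurable borel \<and> (\<forall>a. cmod (p a) = 1)"

lemma unimodular_contraction: "unimodular_symbol p \<Longrightarrow> contraction_symbol p"
  unfolding unimodular_symbol_def contraction_symbol_def by (metis order_refl)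

lemma unimodular_times: "unimodular_symbol p \<Longrightarrow> unimodular_symbol q \<Longrightarrow> unimodular_symbol (\<lambda>a. p a * q a)"
  unfolding unimodular_symbol_def norm_mult by (metis borel_measurable_times mult_1)

lemma unimodular_inverse: "unimodular_symbol p \<Longrightarrow> unimodular_symbol (\<lambda>a. inverse (p a))"
  unfolding unimodular_symbol_def norm_inverse by (metis borel_measurable_inverse inverse_1)

context
  fixes W :: "'n::finite l2 \<Rightarrow> 'n l2"
  assumes W: "unitary_op W"
begin

lemma diag_op_diag_op:
  assumes "unimodular_symbol p" "unimodular_symbol q"
  shows "diag_op W p (diag_op W q f) = diag_op W (\<lambda>a. p a * q a) f"
  using mult_l2_mult_l2[OF assms[THEN unimodular_contraction]]
  by (simp add: diag_op_def unitary_inv_right[OF W])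

lemma diag_op_commute:
  assumes "unimodular_symbol p" "unimodular_symbol q"
  shows "diag_op W p (diag_op W q f) = diag_op W q (diag_op W p f)"
  by (simp add: diag_op_diag_op assms mult.commute)

lemma diag_op_inverse:
  assumes p: "unimodular_symbol p"
  shows "diag_op W p (diag_op W (\<lambda>a. inverse (p a)) f) = f" "diag_op W (\<lambda>a. inverse (p a)) (diag_op W p f) = f"
    and "inv (diag_op W p) = diag_op W (\<lambda>a. inverse (p a))"
proof -
  have "p a \<noteq> 0" for a using p by (auto simp: unimodular_symbol_def dest: spec[of _ a])
  then have one: "(\<lambda>a. p a * inverse (p a)) = (\<lambda>a. 1)" "(\<lambda>a. inverse (p a) * p a) = (\<lambda>a. 1)"
    by (simp_all add: fun_eq_iff)
  have id: "diag_op W (\<lambda>a. 1) f = f" for f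
    by (simp add: diag_op_def mult_l2_one unitary_inv_left[OF W])
  show 1: "diag_op W p (diag_op W (\<lambda>a. inverse (p a)) f) = f" for f
    by (simp only: diag_op_diag_op[OF p unimodular_inverse[OF p]] one id)
  show 2: "diag_op W (\<lambda>a. inverse (p a)) (diag_op W p f) = f" for f
    by (simp only: diag_op_diag_op[OF unimodular_inverse[OF p] p] one id)
  show "inv (diag_op W p) = diag_op W (\<lambda>a. inverse (p a))"
    by (rule inv_equality) (simp_all add: 1 2)
qed

lemma unitary_diag_op:
  assumes p: "unimodular_symbol p"
  shows "unitary_op (diag_op W p)"
  unfolding unitary_op_def
proof (intro conjI allI)
  fix f h
  have "cinner (mult_l2 p f') (mult_l2 p h') = cinner f' h'" for f' h'
    unfolding cinner_rep
  proof (rule integral_cong_AE)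
    show "AE a in lborel. cnj (rep_l2 (mult_l2 p f') a) * rep_l2 (mult_l2 p h') a = cnj (rep_l2 f' a) * rep_l2 h' a"
      using rep_mult_l2[OF unimodular_contraction[OF p], of f'] rep_mult_l2[OF unimodular_contraction[OF p], of h']
    proof eventually_elim
      case (elim a)
      have "cnj (p a) * p a = 1"
        using p complex_norm_square[of "p a"] by (simp add: unimodular_symbol_def mult.commute)
      then have "cnj (p a) * cnj (rep_l2 f' a) * (p a * rep_l2 h' a) = cnj (rep_l2 f' a) * rep_l2 h' a"
        by (metis mult.assoc mult.commute mult.left_neutral)
      with elim show ?case by simp
    qed
  qed (intro borel_measurable_cnj_mult measurable_rep_l2)+
  then show "cinner (diag_op W p f) (diag_op W p h) = cinner f h"
    by (simp add: diag_op_def unitary_cinner[OF unitary_inv[OF W]] unitary_cinner[OF W])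
  show "surj (diag_op W p)" by (metis diag_op_inverse(1)[OF p] surjI)
qed

end

section \<open>Intertwiners of orthogonal indices\<close>

lemma linear_mutate_coords: "linear (mutate_coords \<Gamma> k)"
  by (rule linearI)
    (auto simp: mutate_coords_def vec_eq_iff sum.distrib sum_distrib_left algebra_simps)

lemma mutate_coords_nth:
  "mutate_coords \<Gamma> k a $ l = (if l = k then - (a $ k) + (\<Sum>j\<in>UNIV. of_int (max (- exch \<Gamma> k j) 0) * a $ j) else a $ l)"
  by (simp add: mutate_coords_def)

text \<open>The substitution only changes the coordinate \<open>k\<close>.\<close>

lemma mutate_coords_row_invariant:
  assumes "c k = 0"
  shows "(\<Sum>j\<in>UNIV. c j * mutate_coords \<Gamma> k a $ j) = (\<Sum>j\<in>UNIV. c j * a $ j)"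
  by (rule sum.cong) (auto simp: mutate_coords_nth assms)

lemma mutate_coords_involution:
  assumes "exch \<Gamma> k k = 0"
  shows "mutate_coords \<Gamma> k (mutate_coords \<Gamma> k a) = a"
proof (rule vec_eq_iff[THEN iffD2, rule_format])
  fix l
  show "mutate_coords \<Gamma> k (mutate_coords \<Gamma> k a) $ l = a $ l"
    using mutate_coords_row_invariant[of "\<lambda>j. of_int (max (- exch \<Gamma> k j) 0)" k \<Gamma> a] assms
    by (simp add: mutate_coords_nth[of _ _ "mutate_coords \<Gamma> k a"] mutate_coords_nth[of \<Gamma> k a])
qed

lemma mutate_coords_preserves_lborel:
  assumes "exch \<Gamma> k k = 0"
  shows "distr lborel borel (mutate_coords \<Gamma> k) = lborel"
proof (rule skew_reflection_preserves_lborel)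
  let ?n = "\<lambda>j. real_of_int (max (- exch \<Gamma> k j) 0)"
  let ?c = "\<lambda>a :: real^'a. (\<Sum>j\<in>UNIV. ?n j * a $ j) - 2 * a $ k"
  show "mutate_coords \<Gamma> k a = a + ?c a *\<^sub>R axis k 1" for a
    by (auto simp: vec_eq_iff mutate_coords_nth axis_def)
  have "(\<Sum>j\<in>UNIV. ?n j * axis k 1 $ j) = (0::real)"
    by (rule sum.neutral) (auto simp: axis_def assms)
  then show "?c (a + t *\<^sub>R axis k 1) = ?c a - 2 * t" for a t
    by (simp add: distrib_left sum.distrib mult.left_commute flip: sum_distrib_left)
  show "?c \<in> borel_measurable borel"
    by (intro borel_measurable_continuous_onI continuous_intros)
qed

lemma mutate_coords_commute:
  assumes "i \<noteq> j" "exch \<Gamma> i j = 0" "exch \<Gamma> j i = 0"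
  shows "mutate_coords \<Gamma> i (mutate_coords \<Gamma> j a) = mutate_coords \<Gamma> j (mutate_coords \<Gamma> i a)"
proof (rule vec_eq_iff[THEN iffD2, rule_format])
  fix l
  show "mutate_coords \<Gamma> i (mutate_coords \<Gamma> j a) $ l = mutate_coords \<Gamma> j (mutate_coords \<Gamma> i a) $ l"
    using mutate_coords_row_invariant[of "\<lambda>l. of_int (max (- exch \<Gamma> i l) 0)" j \<Gamma> a]
      mutate_coords_row_invariant[of "\<lambda>l. of_int (max (- exch \<Gamma> j l) 0)" i \<Gamma> a] assms
    by (simp add: mutate_coords_nth[of _ _ "mutate_coords \<Gamma> i a"] mutate_coords_nth[of _ _ "mutate_coords \<Gamma> j a"]
        mutate_coords_nth[of \<Gamma> i a] mutate_coords_nth[of \<Gamma> j a])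
qed

lemma mutate_coords_axis:
  assumes "i \<noteq> j" "exch \<Gamma> i j = 0"
  shows "mutate_coords \<Gamma> i (axis j 1) = axis j 1"
proof (rule vec_eq_iff[THEN iffD2, rule_format])
  fix l
  have "(\<Sum>k\<in>UNIV. of_int (max (- exch \<Gamma> i k) 0) * axis j 1 $ k) = (0::real)"
    by (rule sum.neutral) (auto simp: axis_def assms)
  then show "mutate_coords \<Gamma> i (axis j 1) $ l = axis j 1 $ l"
    using assms(1) by (simp add: mutate_coords_nth axis_def)
qed

lemma K_prime_pullback: "K_prime \<Gamma> k = pullback (mutate_coords \<Gamma> k)"
  by (simp add: fun_eq_iff K_prime_def pullback_def)

lemma intertwiner_cong:
  assumes "exch \<Gamma> k = exch \<Gamma>' k" "symm \<Gamma> k = symm \<Gamma>' k"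
  shows "intertwiner hbar \<Gamma> k = intertwiner hbar \<Gamma>' k"
proof -
  have "x_op hbar \<Gamma> k = x_op hbar \<Gamma>' k" "xt_op hbar \<Gamma> k = xt_op hbar \<Gamma>' k"
    by (simp_all add: fun_eq_iff x_op_def xt_op_def assms)
  moreover have "mutate_coords \<Gamma> k = mutate_coords \<Gamma>' k"
    by (simp add: fun_eq_iff mutate_coords_def assms)
  ultimately show ?thesis
    by (simp add: intertwiner_def x_hat_def xt_hat_def K_prime_pullback assms)
qed

text \<open>Mutation at \<open>i\<close> changes an entry of row \<open>j\<close> only by multiples of \<open>exch \<Gamma> j i\<close>, or by a sign in column \<open>i\<close>,
  where the entry vanishes.\<close>

lemma intertwiner_mutate_orthogonal:
  assumes "i \<noteq> j" "exch \<Gamma> j i = 0"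
  shows "intertwiner hbar (mutate i \<Gamma>) j = intertwiner hbar \<Gamma> j"
  by (rule intertwiner_cong) (use assms in \<open>auto simp: mutate_def fun_eq_iff\<close>)

context
  fixes hbar :: real and \<Gamma> :: "'n::finite seed" and i j :: 'n
  assumes hbar: "0 < hbar" and seed: "D_seed \<Gamma>" and ij: "i \<noteq> j" "exch \<Gamma> i j = 0" "exch \<Gamma> j i = 0"
begin

private abbreviation "F \<equiv> partial_fourier {i, j}"

private definition weight :: "'n \<Rightarrow> real" where "weight k = pi * hbar / symm \<Gamma> k"

text \<open>The sign \<open>s\<close> is \<open>-1\<close> for \<open>x_hat\<close> and \<open>1\<close> for \<open>xt_hat\<close>.\<close>

private definition row :: "int \<Rightarrow> 'n \<Rightarrow> 'n \<Rightarrow> real" where "row s k l = of_int (s * exch \<Gamma> k l)"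

private definition phase :: "int \<Rightarrow> 'n \<Rightarrow> real^'n \<Rightarrow> complex" where
  "phase s k a = qdilog (hbar / of_nat (symm \<Gamma> k)) (fourier_symbol (weight k) (row s k) k a)"

private lemma row_zero: "k \<in> {i, j} \<Longrightarrow> l \<in> {i, j} \<Longrightarrow> row s k l = 0"
  using ij D_seed_exch_diag[OF seed] by (auto simp: row_def)

private lemma hbar_k: "0 < hbar / of_nat (symm \<Gamma> k)"
  using hbar seed by (simp add: D_seed_def)

private lemma x_hats:
  assumes k: "k \<in> {i, j}"
  shows "x_hat hbar \<Gamma> k = adjoint_op (gauss_graph (weight k) (row (-1) k) k)"
    and "xt_hat hbar \<Gamma> k = adjoint_op (gauss_graph (weight k) (row 1 k) k)"
    and "adjoint_op (gauss_graph (weight k) (row s k) k) = mult_graph F (fourier_symbol (weight k) (row s k) k)"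
proof -
  show "x_hat hbar \<Gamma> k = adjoint_op (gauss_graph (weight k) (row (-1) k) k)"
    unfolding x_hat_def
  proof (rule sa_extension_core_graph[OF k])
    show "x_op hbar \<Gamma> k f = weyl_op (weight k) (row (-1) k) f f'" if "partial_derivative k f f'" for f f'
      using x_op_weyl(1)[OF that, of hbar \<Gamma>] by (simp add: weight_def row_def[abs_def])
  qed (rule row_zero[OF k])
  show "xt_hat hbar \<Gamma> k = adjoint_op (gauss_graph (weight k) (row 1 k) k)"
    unfolding xt_hat_def
  proof (rule sa_extension_core_graph[OF k])
    show "xt_op hbar \<Gamma> k f = weyl_op (weight k) (row 1 k) f f'" if "partial_derivative k f f'" for f f'
      using x_op_weyl(2)[OF that, of hbar \<Gamma>] by (simp add: weight_def row_def[abs_def])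
  qed (rule row_zero[OF k])
  show "adjoint_op (gauss_graph (weight k) (row s k) k) = mult_graph F (fourier_symbol (weight k) (row s k) k)"
    by (rule adjoint_gauss_graph[OF k]) (rule row_zero[OF k])
qed

private lemma phase_unimodular: "unimodular_symbol (phase s k)"
  unfolding unimodular_symbol_def phase_def[abs_def]
  using measurable_compose[OF measurable_fourier_symbol measurable_qdilog[OF hbar_k]]
  by (simp add: cmod_qdilog[OF hbar_k])

private lemma fun_calculus_phase:
  assumes k: "k \<in> {i, j}"
  shows "fun_calculus (qdilog (hbar / of_nat (symm \<Gamma> k))) (adjoint_op (gauss_graph (weight k) (row s k) k)) = diag_op F (phase s k)"
  unfolding x_hats(3)[OF k]
  by (subst fun_calculus_mult_graph[OF partial_fourier(1) measurable_fourier_symbol measurable_qdilog[OF hbar_k]])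
    (simp_all add: cmod_qdilog[OF hbar_k] diag_op_def[abs_def] phase_def[abs_def])

private abbreviation "K k \<equiv> pullback (mutate_coords \<Gamma> k)"

private lemma mutate_involution: "linear (mutate_coords \<Gamma> k)" "mutate_coords \<Gamma> k (mutate_coords \<Gamma> k a) = a"
  "distr lborel borel (mutate_coords \<Gamma> k) = lborel"
  using D_seed_exch_diag[OF seed]
  by (auto intro: linear_mutate_coords mutate_coords_involution mutate_coords_preserves_lborel)

private lemma intertwiner_formula:
  assumes k: "k \<in> {i, j}"
  shows "intertwiner hbar \<Gamma> k = diag_op F (\<lambda>a. phase (-1) k a * inverse (phase 1 k a)) \<circ> K k"
  unfolding intertwiner_def Let_def x_hats(1,2)[OF k] fun_calculus_phase[OF k]
    diag_op_inverse(3)[OF partial_fourier(1) phase_unimodular] K_prime_pullback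
  by (simp add: fun_eq_iff diag_op_diag_op[OF partial_fourier(1) phase_unimodular unimodular_inverse[OF phase_unimodular]])

text \<open>The substitution at \<open>k\<close> fixes the direction \<open>e\<^sub>l\<close> because \<open>exch \<Gamma> k l = 0\<close>, and it fixes the linear form of
  the operators at \<open>l\<close> because \<open>exch \<Gamma> l k = 0\<close>.\<close>

private lemma K_commutes_phase:
  assumes kl: "k \<in> {i, j}" "l \<in> {i, j}" "k \<noteq> l"
  shows "diag_op F (phase s l) (K k f) = K k (diag_op F (phase s l) f)"
proof -
  let ?S = "adjoint_op (gauss_graph (weight l) (row s l) l)"
  have fwd: "(K k u, K k v) \<in> ?S" if "(u, v) \<in> ?S" for u v
  proof (rule pullback_preserves_weyl_graph[OF mutate_involution kl(2) _ _ _ that])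
    show "row s l m = 0" if "m \<in> {i, j}" for m by (rule row_zero[OF kl(2) that])
    show "mutate_coords \<Gamma> k (axis l 1) = axis l 1"
      using kl ij by (intro mutate_coords_axis) auto
    show "(\<Sum>m\<in>UNIV. row s l m * mutate_coords \<Gamma> k a $ m) = (\<Sum>m\<in>UNIV. row s l m * a $ m)" for a
      by (rule mutate_coords_row_invariant) (rule row_zero[OF kl(2,1)])
  qed
  have iff: "(K k u, K k v) \<in> ?S \<longleftrightarrow> (u, v) \<in> ?S" for u v
    using fwd[of u v] fwd[of "K k u" "K k v"] pullback_pullback[OF mutate_involution] by auto
  show ?thesis
    unfolding fun_calculus_phase[OF kl(2), symmetric] x_hats(3)[OF kl(2)]
    by (rule fun_calculus_commutes[OF partial_fourier(1) measurable_fourier_symbol measurable_qdilog[OF hbar_k]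
          _ unitary_pullback[OF mutate_involution]])
      (use iff in \<open>simp_all add: cmod_qdilog[OF hbar_k] x_hats(3)[OF kl(2)]\<close>)
qed

private lemma K_commutes:
  assumes kl: "k \<in> {i, j}" "l \<in> {i, j}" "k \<noteq> l"
  shows "K k (diag_op F (\<lambda>a. phase (-1) l a * inverse (phase 1 l a)) f)
    = diag_op F (\<lambda>a. phase (-1) l a * inverse (phase 1 l a)) (K k f)"
proof -
  let ?D = "\<lambda>s. diag_op F (phase s l)" and ?I = "diag_op F (\<lambda>a. inverse (phase 1 l a))"
  note inv = diag_op_inverse[OF partial_fourier(1) phase_unimodular]
  have "K k (?I f) = ?I (?D 1 (K k (?I f)))" by (simp add: inv)
  also have "\<dots> = ?I (K k f)" by (simp add: K_commutes_phase[OF kl] inv)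
  finally have I: "K k (?I f) = ?I (K k f)" .
  have split: "diag_op F (\<lambda>a. phase (-1) l a * inverse (phase 1 l a)) h = ?D (-1) (?I h)" for h
    by (rule diag_op_diag_op[OF partial_fourier(1) phase_unimodular unimodular_inverse[OF phase_unimodular], symmetric])
  show ?thesis by (simp only: split I[symmetric] K_commutes_phase[OF kl])
qed

lemma intertwiners_commute:
  "intertwiner hbar \<Gamma> i \<circ> intertwiner hbar \<Gamma> j = intertwiner hbar \<Gamma> j \<circ> intertwiner hbar \<Gamma> i"
proof (rule ext)
  fix f
  let ?p = "\<lambda>k a. phase (-1) k a * inverse (phase 1 k a)"
  have p: "unimodular_symbol (?p k)" for k
    by (intro unimodular_times unimodular_inverse phase_unimodular)
  have KK: "K i (K j f) = K j (K i f)"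
  proof -
    have s: "sq_integrable (rep_l2 f \<circ> mutate_coords \<Gamma> k)" for k
      by (rule sq_integrable_comp[OF mutate_involution sq_integrable_rep])
    have "K k (K l f) = abs_l2 (rep_l2 f \<circ> mutate_coords \<Gamma> l \<circ> mutate_coords \<Gamma> k)" for k l
      unfolding pullback_def[of "mutate_coords \<Gamma> l"]
      by (rule pullback_abs[OF mutate_involution s])
    then show ?thesis
      using mutate_coords_commute[OF ij] by (simp add: o_def)
  qed
  have "(intertwiner hbar \<Gamma> i \<circ> intertwiner hbar \<Gamma> j) f
      = diag_op F (?p i) (diag_op F (?p j) (K i (K j f)))"
    using ij by (simp add: intertwiner_formula K_commutes)
  also have "\<dots> = diag_op F (?p j) (diag_op F (?p i) (K j (K i f)))"
    unfolding KK by (rule diag_op_commute[OF partial_fourier(1) p p])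
  also have "\<dots> = (intertwiner hbar \<Gamma> j \<circ> intertwiner hbar \<Gamma> i) f"
    using ij by (simp add: intertwiner_formula K_commutes)
  finally show "(intertwiner hbar \<Gamma> i \<circ> intertwiner hbar \<Gamma> j) f = (intertwiner hbar \<Gamma> j \<circ> intertwiner hbar \<Gamma> i) f" .
qed

lemma unitary_intertwiner: "k \<in> {i, j} \<Longrightarrow> unitary_op (intertwiner hbar \<Gamma> k)"
  unfolding intertwiner_formula
  by (intro unitary_comp unitary_diag_op partial_fourier(1) unimodular_times unimodular_inverse
      phase_unimodular unitary_pullback mutate_involution)

end

theorem proposition133:
  fixes hbar :: real and \<Gamma>0 \<Gamma>1 \<Gamma>2 \<Gamma>3 :: "'n::finite seed" and i j :: 'n and c :: complex
  assumes "hbar > 0" and "hbar \<notin> \<rat>"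
    and "D_seed \<Gamma>0"
    and "i \<noteq> j" and "exch \<Gamma>0 i j = 0" and "exch \<Gamma>0 j i = 0"
    and "\<Gamma>1 = mutate i \<Gamma>0" and "\<Gamma>2 = mutate j \<Gamma>1" and "\<Gamma>3 = mutate j \<Gamma>0"
    and "cmod c = 1"
    and "intertwiner hbar \<Gamma>0 i \<circ> intertwiner hbar \<Gamma>1 j
         = (\<lambda>f. c *\<^sub>C (intertwiner hbar \<Gamma>0 j \<circ> intertwiner hbar \<Gamma>3 i) f)"
  shows "c = 1"
proof -
  have i1: "intertwiner hbar \<Gamma>1 j = intertwiner hbar \<Gamma>0 j"
    unfolding assms(7) by (rule intertwiner_mutate_orthogonal) (use assms in auto)
  have i3: "intertwiner hbar \<Gamma>3 i = intertwiner hbar \<Gamma>0 i"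
    unfolding assms(9) by (rule intertwiner_mutate_orthogonal) (use assms in auto)
  let ?K = "intertwiner hbar \<Gamma>0 i \<circ> intertwiner hbar \<Gamma>0 j"
  have u: "unitary_op ?K"
    using assms by (intro unitary_comp unitary_intertwiner[OF assms(1,3,4,5,6)]) auto
  \<comment> \<open>Any nonzero vector serves as a witness.\<close>
  define f :: "'n l2" where "f = gaussian (\<lambda>_. 0)"
  have "cinner f f \<noteq> 0" by (simp add: f_def cinner_gaussian)
  then have "norm f \<noteq> 0" by auto
  then have nz: "norm (?K f) \<noteq> 0" by (simp only: unitary_norm[OF u]) simp
  have "?K f = c *\<^sub>C ?K f"
    using fun_cong[OF assms(11), of f] intertwiners_commute[OF assms(1,3,4,5,6)]
    unfolding i1 i3 by metis
  then have "(1 - c) *\<^sub>C ?K f = 0"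
    using scaleC_add_left[of "1 - c" c "?K f"] by simp
  then have "cmod (1 - c) * norm (?K f) = 0" unfolding norm_scaleC[symmetric] by simp
  then show "c = 1" using nz by simp
qed

end
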